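(* Let $X$ be a reflexive and separable Banach space and let $f:X\to\mathbb{R}$ be quasiconvex and densely continuous. With $m:=\mathcal{T}\operatorname{ess\,inf}_X f$, suppose that $F_m$ is nowhere dense. Then $f$ is Hadamard differentiable on $X$ except at the points of a Haar null set.
   Context: Banach spaces are real. A function $f:X\to\mathbb{R}$ is quasiconvex if $f(\lambda x+(1-\lambda)y)\le\max\{f(x),f(y)\}$ for all $x,y\in X$ and $\lambda\in[0,1]$. It is densely continuous if it is continuous at the points of a dense subset of $X$. For $\alpha\in\mathbb{R}\cup\{-\infty\}$, $F_\alpha:=\{x\in X:f(x)<\alpha\}$ (empty for $\alpha=-\infty$). First category means a countable union of nowhere dense subsets of $X$; second category means not of first category. The topological essential infimum is $\mathcal{T}\operatorname{ess\,inf}_X f:=\sup\{\alpha\in\mathbb{R}:F_\alpha\text{ is of first category}\}=\inf\{\alpha\in\mathbb{R}:F_\alpha\text{ is of second category}\}\in[-\infty,\infty)$. $f$ is Gâteaux differentiable at $x$ with derivative $Df(x)\in X^*$ if $Df(x)h=\lim_{t\to0}\frac{f(x+th)-f(x)}{t}$ for every $h\in X$; it is Hadamard differentiable at $x$ if moreover the limit is uniform for $h$ in every compact subset of $X$. A Borel set $E\subset X$ is Haar null if there is a Borel probability measure $\mu$ on $X$ with $\mu(x+E)=0$ for every $x\in X$. "A property holds on $X$ except at the points of a Haar null set" means that there is a Haar null set $N$ such that the property holds at every point of $X\setminus N$. *)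

theory Defs
  imports "HOL-Probability.Probability"
begin

definition quasiconvex :: "('a::real_vector \<Rightarrow> real) \<Rightarrow> bool" where
  "quasiconvex f \<longleftrightarrow>
     (\<forall>x y. \<forall>t\<in>{0..1}. f (t *\<^sub>R x + (1 - t) *\<^sub>R y) \<le> max (f x) (f y))"

definition densely_continuous :: "('a::t2_space \<Rightarrow> real) \<Rightarrow> bool" where
  "densely_continuous f \<longleftrightarrow> closure {x. isCont f x} = UNIV"

definition nowhere_dense :: "'a::topological_space set \<Rightarrow> bool" where
  "nowhere_dense S \<longleftrightarrow> interior (closure S) = {}"

definition first_category :: "'a::topological_space set \<Rightarrow> bool" where
  "first_category S \<longleftrightarrow>
     (\<exists>A :: nat \<Rightarrow> 'a set. (\<forall>n. nowhere_dense (A n)) \<and> S = (\<Union>n. A n))"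

abbreviation second_category :: "'a::topological_space set \<Rightarrow> bool" where
  "second_category S \<equiv> \<not> first_category S"

text \<open>The level is an extended real because it may be \<open>-\<infinity>\<close>, where the set is empty.\<close>

definition strict_sublevel :: "('a \<Rightarrow> real) \<Rightarrow> ereal \<Rightarrow> 'a set" where
  "strict_sublevel f \<alpha> = {x. ereal (f x) < \<alpha>}"

definition top_ess_inf :: "('a::topological_space \<Rightarrow> real) \<Rightarrow> ereal" where
  "top_ess_inf f = (SUP \<alpha>\<in>{\<alpha>::real. first_category (strict_sublevel f (ereal \<alpha>))}. ereal \<alpha>)"

lemma first_category_subset:
  assumes "first_category T" "S \<subseteq> T"
  shows "first_category S"
proof -
  obtain A where A: "\<And>n. nowhere_dense (A n)" "T = (\<Union>n::nat. A n)"
    using assms(1) unfolding first_category_def by blast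
  have "nowhere_dense (A n \<inter> S)" for n
    using A(1)[of n] interior_mono[OF closure_mono[of "A n \<inter> S" "A n"]]
    unfolding nowhere_dense_def by auto
  moreover have "S = (\<Union>n. A n \<inter> S)"
    using A(2) assms(2) by auto
  ultimately show ?thesis
    unfolding first_category_def by (intro exI[of _ "\<lambda>n. A n \<inter> S"]) auto
qed

lemma top_ess_inf_eq_INF:
  "top_ess_inf f = (INF \<alpha>\<in>{\<alpha>::real. second_category (strict_sublevel f (ereal \<alpha>))}. ereal \<alpha>)"
    (is "_ = ?I")
proof (rule antisym)
  have "\<alpha> \<le> \<beta>" if "first_category (strict_sublevel f (ereal \<alpha>))"
    "second_category (strict_sublevel f (ereal \<beta>))" for \<alpha> \<beta> :: real
  proof (rule ccontr)
    assume "\<not> \<alpha> \<le> \<beta>"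
    then have "strict_sublevel f (ereal \<beta>) \<subseteq> strict_sublevel f (ereal \<alpha>)"
      by (auto simp: strict_sublevel_def)
    with that show False using first_category_subset by blast
  qed
  then show "top_ess_inf f \<le> ?I"
    unfolding top_ess_inf_def by (auto intro!: SUP_least INF_greatest)
next
  show "?I \<le> top_ess_inf f"
  proof (rule ccontr)
    assume "\<not> ?I \<le> top_ess_inf f"
    then obtain \<gamma> where g: "top_ess_inf f < ereal \<gamma>" "ereal \<gamma> < ?I"
      using ereal_dense2[of "top_ess_inf f" ?I] by (auto simp: not_le)
    show False
    proof (cases "first_category (strict_sublevel f (ereal \<gamma>))")
      case True
      then have "ereal \<gamma> \<le> top_ess_inf f"
        unfolding top_ess_inf_def by (auto intro: SUP_upper)
      with g(1) show False by simp
    next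
      case False
      then have "?I \<le> ereal \<gamma>" by (auto intro: INF_lower)
      with g(2) show False by simp
    qed
  qed
qed

text \<open>The canonical embedding into the bidual is onto.\<close>

definition reflexive_space :: "'a::real_normed_vector itself \<Rightarrow> bool" where
  "reflexive_space _ \<longleftrightarrow>
     (\<forall>\<Phi> :: ('a \<Rightarrow>\<^sub>L real) \<Rightarrow>\<^sub>L real. \<exists>x::'a. \<forall>\<phi>.
        blinfun_apply \<Phi> \<phi> = blinfun_apply \<phi> x)"

definition has_gateaux_derivative ::
    "('a::real_normed_vector \<Rightarrow> real) \<Rightarrow> ('a \<Rightarrow>\<^sub>L real) \<Rightarrow> 'a \<Rightarrow> bool" where
  "has_gateaux_derivative f D x \<longleftrightarrow>
     (\<forall>h. ((\<lambda>t::real. (f (x + t *\<^sub>R h) - f x) / t) \<longlongrightarrow> blinfun_apply D h) (at 0))"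

definition hadamard_differentiable :: "('a::real_normed_vector \<Rightarrow> real) \<Rightarrow> 'a \<Rightarrow> bool" where
  "hadamard_differentiable f x \<longleftrightarrow>
     (\<exists>D. has_gateaux_derivative f D x \<and>
        (\<forall>K. compact K \<longrightarrow>
           uniform_limit K (\<lambda>(t::real) h. (f (x + t *\<^sub>R h) - f x) / t) (blinfun_apply D) (at 0)))"

definition haar_null :: "'a::real_normed_vector set \<Rightarrow> bool" where
  "haar_null E \<longleftrightarrow> E \<in> sets borel \<and>
     (\<exists>\<mu> :: 'a measure. prob_space \<mu> \<and> sets \<mu> = sets borel \<and>
        (\<forall>x. emeasure \<mu> ((\<lambda>y. x + y) ` E) = 0))"

end

theory Submission
  imports Defs
begin

text \<open>
  Write \<open>m\<close> for the topological essential infimum of \<open>f\<close>. The proof separates the points of \<open>X\<close>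
  according to whether \<open>\<bar>f (x + w) - f x\<bar> \<le> L * norm w\<close> holds for all small \<open>w\<close>, with \<open>L\<close> depending
  on \<open>x\<close> (\<open>pointwise_lipschitz\<close>).

  At almost every point of this kind \<open>f\<close> is Hadamard differentiable, for an arbitrary function
  \<open>f\<close> (\<open>stepanov_haar\<close>). On a small ball \<open>f\<close> lies between its largest \<open>n\<close>-Lipschitz minorant and its
  smallest \<open>n\<close>-Lipschitz majorant, and all three agree at the points where \<open>f\<close> is \<open>n\<close>-Lipschitz
  relative to the ball; a function squeezed between two functions that are differentiable
  at a common point of contact is differentiable there. So everything reduces to
  Lipschitz functions. For these, the derivative in a fixed direction exists almost everywhere
  on each line in that direction, and the set of points where two
  directional derivatives fail to add up is covered by countably many sets that meet each line of one of
  the directions in isolated points only. Countably many directions suffice in a separable space.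

  It remains to see that almost every point is pointwise Lipschitz.
  For \<open>\<alpha> > m\<close> the convex set \<open>{f < \<alpha>}\<close> is of second category, hence contains a point
  of continuity of \<open>f\<close> and therefore a ball. Outside this set \<open>f\<close> does not increase in any direction that
  points into the ball, so \<open>f\<close> is locally monotone with respect to a cone with nonempty interior. Therefore
  \<open>f\<close> is pointwise Lipschitz at \<open>x\<close> as soon as it is so along one direction inside the cone, and along
  a line the exceptional points of a monotone function form a Lebesgue null set
  (\<open>sigma_thin_above_level\<close>).
  The points with \<open>f x \<le> m\<close> form a convex set. If its closure has empty interior, the closure is
  itself negligible; otherwise \<open>f\<close> is constant near the
  points of its interior that are not in the closure of \<open>{f < m}\<close>, and both that closure and the boundary of
  \<open>{f \<le> m}\<close> are negligible (\<open>sigma_thin_at_or_below_ess_inf\<close>).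

  Reflexivity enters only through the fact that a closed convex set \<open>C\<close> with empty interior is
  negligible (\<open>sigma_thin_convex_empty_interior\<close>). If the differences of points of \<open>C\<close> miss some direction, this is clear on the lines in that direction. Otherwise, for
  bounded \<open>C\<close>, there are arbitrarily small vectors \<open>y n\<close> such that every point of \<open>X\<close> has only finitely many of its translates by \<open>y n\<close> in \<open>C\<close>. Since nested
  bounded closed convex sets have a common point, the sets of indices that occur form a compact
  family of finite sets, and Ptak's combinatorial lemma yields a finitely supported
  distribution on the vectors \<open>y n\<close> that gives no translate of \<open>C\<close> more than a prescribed mass.

  All exceptional sets are treated in the same way: a Borel set is called thin if
  for every \<open>\<epsilon>\<close> there is a random vector of norm at most \<open>\<epsilon>\<close> that falls into any given translate of the set
  with probability at most \<open>\<epsilon>\<close>. The sum of independent random vectors of rapidly decreasing size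
  shows that countable unions of thin sets are Haar null (\<open>haar_null_UN_thin_sets\<close>).
\<close>

section \<open>Hahn-Banach and nested convex sets\<close>

definition sublinear :: "('a::real_vector \<Rightarrow> real) \<Rightarrow> bool" where
  "sublinear p \<longleftrightarrow> (\<forall>x y. p (x + y) \<le> p x + p y) \<and> (\<forall>c x. 0 \<le> c \<longrightarrow> p (c *\<^sub>R x) = c * p x)"

lemma sublinearI:
  assumes "\<And>x y. p (x + y) \<le> p x + p y"
    and "\<And>c x. 0 < c \<Longrightarrow> p (c *\<^sub>R x) \<le> c * p x" and "p 0 = 0"
  shows "sublinear p"
proof -
  have "p (c *\<^sub>R x) = c * p x" if "0 \<le> c" for c x
  proof (cases "c = 0")
    case False
    with that have c: "c > 0" by simp
    have "p x = p ((1/c) *\<^sub>R (c *\<^sub>R x))" using c by simp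
    also have "\<dots> \<le> (1/c) * p (c *\<^sub>R x)" using assms(2)[of "1/c" "c *\<^sub>R x"] c by simp
    finally have "c * p x \<le> p (c *\<^sub>R x)" using c by (simp add: field_simps)
    with assms(2)[OF c, of x] show ?thesis by linarith
  qed (simp add: assms(3))
  with assms(1) show ?thesis unfolding sublinear_def by blast
qed

lemma sublinearD:
  assumes "sublinear p"
  shows "p (x + y) \<le> p x + p y" "0 \<le> c \<Longrightarrow> p (c *\<^sub>R x) = c * p x" "p 0 = 0" "- p (- x) \<le> p x"
proof -
  show *: "p (x + y) \<le> p x + p y" for x y using assms unfolding sublinear_def by blast
  show "0 \<le> c \<Longrightarrow> p (c *\<^sub>R x) = c * p x" for c x using assms unfolding sublinear_def by blast
  from this[of 0 0] show "p 0 = 0" by simp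
  with *[of x "- x"] show "- p (- x) \<le> p x" by simp
qed

text \<open>
  A sublinear functional \<open>p\<close> satisfies \<open>p x \<ge> - p (- x)\<close>, so a common upper bound \<open>p0\<close> also bounds
  the chain from below and the infimum is finite. The chain condition is what makes subadditivity survive: for
  two members one of them is below both.
\<close>

lemma sublinear_INF_chain:
  assumes ne: "P \<noteq> {}" and sub: "\<And>p. p \<in> P \<Longrightarrow> sublinear p"
    and chain: "\<And>p q. p \<in> P \<Longrightarrow> q \<in> P \<Longrightarrow> p \<le> q \<or> q \<le> p"
    and bound: "\<And>p. p \<in> P \<Longrightarrow> p \<le> p0"
  shows "sublinear (\<lambda>x. INF p\<in>P. p x)" and "p \<in> P \<Longrightarrow> (INF p\<in>P. p x) \<le> p x"
proof -
  have bdd: "bdd_below ((\<lambda>p. p x) ` P)" for x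
  proof (rule bdd_belowI2)
    fix p assume "p \<in> P"
    then show "- p0 (- x) \<le> p x"
      using sublinearD(4)[OF sub, of p x] le_funD[OF bound, of p "- x"] by simp
  qed
  show low: "p \<in> P \<Longrightarrow> (INF p\<in>P. p x) \<le> p x" for p x
    using bdd by (rule cINF_lower)
  show "sublinear (\<lambda>x. INF p\<in>P. p x)"
  proof (rule sublinearI)
    fix x y
    have "(INF p\<in>P. p (x + y)) \<le> p x + q y" if pq: "p \<in> P" "q \<in> P" for p q
    proof -
      obtain r where r: "r \<in> P" "r \<le> p" "r \<le> q" using chain[OF pq] pq by blast
      have "(INF p\<in>P. p (x + y)) \<le> r (x + y)" using low[OF r(1)] .
      also have "\<dots> \<le> r x + r y" using sublinearD(1)[OF sub[OF r(1)]] .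
      also have "\<dots> \<le> p x + q y" by (intro add_mono le_funD[OF r(2)] le_funD[OF r(3)])
      finally show ?thesis .
    qed
    then have "(INF p\<in>P. p (x + y)) - q y \<le> (INF p\<in>P. p x)" if "q \<in> P" for q
      using that by (intro cINF_greatest[OF ne]) (simp add: algebra_simps)
    then have "(INF p\<in>P. p (x + y)) - (INF p\<in>P. p x) \<le> (INF p\<in>P. p y)"
      by (intro cINF_greatest[OF ne]) (simp add: algebra_simps)
    then show "(INF p\<in>P. p (x + y)) \<le> (INF p\<in>P. p x) + (INF p\<in>P. p y)" by simp
  next
    fix c :: real and x assume c: "0 < c"
    have "(INF p\<in>P. p (c *\<^sub>R x)) / c \<le> (INF p\<in>P. p x)"
    proof (rule cINF_greatest[OF ne])
      fix p assume p: "p \<in> P"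
      then have "(INF p\<in>P. p (c *\<^sub>R x)) \<le> c * p x"
        using low[OF p, of "c *\<^sub>R x"] sublinearD(2)[OF sub[OF p], of c x] c by simp
      then show "(INF p\<in>P. p (c *\<^sub>R x)) / c \<le> p x" using c by (simp add: field_simps)
    qed
    then show "(INF p\<in>P. p (c *\<^sub>R x)) \<le> c * (INF p\<in>P. p x)" using c by (simp add: field_simps)
  next
    have "(\<lambda>p. p 0) ` P = {0}" using ne sublinearD(3)[OF sub] by force
    then show "(INF p\<in>P. p 0) = 0" by simp
  qed
qed

text \<open>
  Lowering \<open>p\<close> as much as possible along the ray from \<open>z\<close> in direction \<open>v\<close> gives another sublinear
  functional below \<open>p\<close>. If \<open>p\<close> is minimal nothing is gained, which at \<open>z = - v\<close> says \<open>p (- v) = - p v\<close>; an odd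
  sublinear functional is linear.
\<close>

lemma linear_if_minimal_sublinear:
  assumes p: "sublinear p" and min: "\<And>q. sublinear q \<Longrightarrow> q \<le> p \<Longrightarrow> q = p"
  shows "linear p"
proof -
  have odd: "p (- v) = - p v" for v
  proof -
    define q where "q z = (INF t\<in>{0::real..}. p (z + t *\<^sub>R v) - t * p v)" for z
    have lb: "- p (- z) \<le> p (z + t *\<^sub>R v) - t * p v" if "0 \<le> t" for z t
    proof -
      have "t * p v = p ((z + t *\<^sub>R v) + (- z))" using sublinearD(2)[OF p that, of v] by simp
      also have "\<dots> \<le> p (z + t *\<^sub>R v) + p (- z)" by (rule sublinearD(1)[OF p])
      finally show ?thesis by simp
    qed
    have low: "q z \<le> p (z + t *\<^sub>R v) - t * p v" if "0 \<le> t" for z t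
      unfolding q_def using lb that by (intro cINF_lower bdd_belowI2[where m = "- p (- z)"]) auto
    have "sublinear q"
    proof (rule sublinearI)
      fix x y
      have "q (x + y) \<le> (p (x + t *\<^sub>R v) - t * p v) + (p (y + s *\<^sub>R v) - s * p v)"
        if "0 \<le> t" "0 \<le> s" for t s
      proof -
        have "q (x + y) \<le> p ((x + t *\<^sub>R v) + (y + s *\<^sub>R v)) - (t + s) * p v"
          using low[of "t + s" "x + y"] that by (simp add: algebra_simps)
        also have "\<dots> \<le> p (x + t *\<^sub>R v) + p (y + s *\<^sub>R v) - (t + s) * p v"
          using sublinearD(1)[OF p] by simp
        finally show ?thesis by (simp add: algebra_simps)
      qed
      then have "q (x + y) - (p (y + s *\<^sub>R v) - s * p v) \<le> q x" if "0 \<le> s" for s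
        unfolding q_def[of x] using that by (intro cINF_greatest) (auto simp: algebra_simps)
      then have "q (x + y) - q x \<le> q y"
        unfolding q_def[of y] by (intro cINF_greatest) (auto simp: algebra_simps)
      then show "q (x + y) \<le> q x + q y" by simp
    next
      fix c :: real and x assume c: "0 < c"
      have "q (c *\<^sub>R x) / c \<le> q x" unfolding q_def[of x]
      proof (rule cINF_greatest)
        fix t :: real assume t: "t \<in> {0..}"
        have "q (c *\<^sub>R x) \<le> p (c *\<^sub>R (x + t *\<^sub>R v)) - (c * t) * p v"
          using low[of "c * t" "c *\<^sub>R x"] c t by (simp add: algebra_simps)
        also have "\<dots> = c * (p (x + t *\<^sub>R v) - t * p v)"
          unfolding sublinearD(2)[OF p less_imp_le[OF c]] by (simp add: right_diff_distrib)
        finally show "q (c *\<^sub>R x) / c \<le> p (x + t *\<^sub>R v) - t * p v" using c by (simp add: field_simps)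
      qed simp
      then show "q (c *\<^sub>R x) \<le> c * q x" using c by (simp add: field_simps)
    next
      have "p (t *\<^sub>R v) - t * p v = 0" if "0 \<le> t" for t using sublinearD(2)[OF p that] by simp
      then show "q 0 = 0" unfolding q_def by simp
    qed
    moreover have "q \<le> p" using low[of 0] by (simp add: le_fun_def)
    ultimately have "q = p" by (rule min)
    then have "p (- v) \<le> p (- v + 1 *\<^sub>R v) - 1 * p v" using low[of 1 "- v"] by simp
    then show ?thesis using sublinearD(3)[OF p] sublinearD(4)[OF p, of v] by simp
  qed
  show ?thesis
  proof (rule linearI)
    fix x y
    have "p (- x + - y) \<le> p (- x) + p (- y)" by (rule sublinearD(1)[OF p])
    then have "p (- (x + y)) \<le> - p x - p y" by (simp add: odd)
    then show "p (x + y) = p x + p y" using sublinearD(1)[OF p, of x y] odd[of "x + y"] by simp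
  next
    fix c :: real and x
    show "p (c *\<^sub>R x) = c *\<^sub>R p x"
    proof (cases "0 \<le> c")
      case False
      then have "p ((- c) *\<^sub>R x) = (- c) * p x" by (intro sublinearD(2)[OF p]) simp
      then show ?thesis using odd[of "c *\<^sub>R x"] by simp
    qed (simp add: sublinearD(2)[OF p])
  qed
qed

text \<open>
  The Hahn-Banach theorem without a subspace to extend from: a minimal sublinear functional
  below \<open>p\<close> exists by Zorn's lemma. Separation and the bidual argument below encode all further
  constraints in the choice of \<open>p\<close>.
\<close>

lemma linear_dominated_by_sublinear:
  assumes p: "sublinear p"
  shows "\<exists>\<phi>. linear \<phi> \<and> (\<forall>x. \<phi> x \<le> p x)"
proof -
  define A where "A = {q. sublinear q \<and> q \<le> p}"
  have "\<exists>m\<in>A. \<forall>a\<in>A. m \<ge> a \<longrightarrow> a = m"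
  proof (rule predicate_Zorn)
    show "partial_order_on A (relation_of (\<ge>) A)"
      unfolding partial_order_on_def preorder_on_def refl_on_def trans_def antisym_def relation_of_def
      by auto
    fix C assume C: "C \<in> Chains (relation_of (\<ge>) A)"
    then have CA: "C \<subseteq> A" and ch: "\<And>q r. q \<in> C \<Longrightarrow> r \<in> C \<Longrightarrow> q \<le> r \<or> r \<le> q"
      unfolding Chains_def relation_of_def by blast+
    show "\<exists>u\<in>A. \<forall>a\<in>C. a \<ge> u"
    proof (cases "C = {}")
      case True
      with p show ?thesis unfolding A_def by blast
    next
      case False
      have *: "\<And>q. q \<in> C \<Longrightarrow> sublinear q" "\<And>q. q \<in> C \<Longrightarrow> q \<le> p" using CA unfolding A_def by auto
      note inf = sublinear_INF_chain[OF False *(1) ch *(2)]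
      obtain q where "q \<in> C" using False by blast
      then have "(\<lambda>x. INF q\<in>C. q x) \<le> p"
        by (intro le_funI order_trans[OF inf(2) le_funD[OF *(2)]])
      then have "(\<lambda>x. INF q\<in>C. q x) \<in> A" unfolding A_def using inf(1) by simp
      moreover have "\<forall>a\<in>C. (\<lambda>x. INF q\<in>C. q x) \<le> a" using inf(2) by (auto simp: le_fun_def)
      ultimately show ?thesis by blast
    qed
  qed
  then obtain m where m: "m \<in> A" "\<And>q. q \<in> A \<Longrightarrow> q \<le> m \<Longrightarrow> q = m" by blast
  have "linear m"
  proof (rule linear_if_minimal_sublinear)
    show "sublinear m" using m unfolding A_def by blast
    show "q = m" if "sublinear q" "q \<le> m" for q
      using m(1) m(2)[of q] that order_trans[of q m p] unfolding A_def by simp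
  qed
  with m(1) show ?thesis unfolding A_def by (auto simp: le_fun_def)
qed

lemma blinfun_of_bounded_linear_form:
  fixes \<phi> :: "'a::real_normed_vector \<Rightarrow> real"
  assumes "linear \<phi>" and "\<And>x. \<phi> x \<le> K * norm x"
  shows "\<exists>\<psi>::'a \<Rightarrow>\<^sub>L real. blinfun_apply \<psi> = \<phi>"
proof -
  have "bounded_linear \<phi>"
  proof (rule bounded_linear_intro[where K = K])
    show "\<phi> (x + y) = \<phi> x + \<phi> y" for x y using assms(1) by (rule linear_add)
    show "\<phi> (r *\<^sub>R x) = r *\<^sub>R \<phi> x" for r x using assms(1) by (rule linear_scale)
    show "norm (\<phi> x) \<le> norm x * K" for x
      using assms(2)[of x] assms(2)[of "- x"] linear_neg[OF assms(1), of x] by (simp add: mult.commute abs_le_iff)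
  qed
  then show ?thesis using bounded_linear_Blinfun_apply by blast
qed

text \<open>
  The functional \<open>p\<close> below is the largest sublinear functional under the norm that is at most \<open>- d\<close> at
  every \<open>z - c\<close> with \<open>c \<in> D\<close>, where \<open>d\<close> is the radius of a ball around \<open>z\<close> that misses \<open>D\<close>; it is finite because
  \<open>norm (c - z) \<ge> d\<close>. Every linear functional below \<open>p\<close> separates.
\<close>

lemma separation_closed_convex:
  fixes D :: "'a::real_normed_vector set"
  assumes "closed D" "convex D" "z \<notin> D"
  shows "\<exists>(\<phi>::'a \<Rightarrow>\<^sub>L real) d. 0 < d \<and> (\<forall>c\<in>D. blinfun_apply \<phi> z + d \<le> blinfun_apply \<phi> c)"
proof (cases "D = {}")
  case True
  then show ?thesis by (auto intro: exI[of _ 1])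
next
  case False
  obtain d where d: "0 < d" "\<And>c. c \<in> D \<Longrightarrow> d \<le> norm (c - z)"
  proof -
    obtain d where d: "0 < d" "ball z d \<subseteq> - D"
      using assms(1,3) openE[of "- D" z] by (auto simp: closed_def)
    have "d \<le> norm (c - z)" if "c \<in> D" for c
    proof (rule ccontr)
      assume "\<not> d \<le> norm (c - z)"
      then have "c \<in> ball z d" by (simp add: dist_norm norm_minus_commute)
      with that d(2) show False by blast
    qed
    with d(1) that show ?thesis by blast
  qed
  define I where "I = {0::real..} \<times> D"
  have Ine: "I \<noteq> {}" using False unfolding I_def by auto
  define F where "F x = (\<lambda>(t, c). norm (x + t *\<^sub>R (c - z)) - t * d)" for x :: 'a
  define p where "p x = (INF i\<in>I. F x i)" for x
  have lb: "- norm x \<le> F x i" if iI: "i \<in> I" for x i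
  proof -
    obtain t c where i: "i = (t, c)" "0 \<le> t" "c \<in> D" using iI unfolding I_def by auto
    have "t * d \<le> norm (t *\<^sub>R (c - z))" using d(2)[OF i(3)] i(2) by (simp add: mult_left_mono)
    also have "\<dots> \<le> norm (x + t *\<^sub>R (c - z)) + norm x"
      using norm_triangle_ineq4[of "x + t *\<^sub>R (c - z)" x] by simp
    finally show ?thesis unfolding F_def i by simp
  qed
  have low: "p x \<le> F x i" if "i \<in> I" for x i
    unfolding p_def using lb that by (intro cINF_lower bdd_belowI2[where m = "- norm x"]) auto
  have le_norm: "p x \<le> norm x" for x
  proof -
    obtain c where "c \<in> D" using False by blast
    then show ?thesis using low[of "(0, c)" x] unfolding I_def F_def by simp
  qed
  have "sublinear p"
  proof (rule sublinearI)
    fix x y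
    have "p (x + y) \<le> F x i + F y j" if ij: "i \<in> I" "j \<in> I" for i j
    proof -
      obtain t c s b where i: "i = (t, c)" "0 \<le> t" "c \<in> D" and j: "j = (s, b)" "0 \<le> s" "b \<in> D"
        using ij unfolding I_def by auto
      show ?thesis
      proof (cases "t + s = 0")
        case True
        then have "t = 0" "s = 0" using i j by auto
        then show ?thesis using le_norm[of "x + y"] norm_triangle_ineq[of x y] unfolding F_def i j by simp
      next
        case False
        define a where "a = (t / (t + s)) *\<^sub>R c + (s / (t + s)) *\<^sub>R b"
        have ts: "0 < t + s" using False i(2) j(2) by simp
        have "a \<in> D" unfolding a_def
          using i j ts by (intro convexD[OF assms(2)]) (auto simp flip: add_divide_distrib)
        then have "p (x + y) \<le> norm (x + y + (t + s) *\<^sub>R (a - z)) - (t + s) * d"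
          using low[of "(t + s, a)" "x + y"] ts unfolding I_def F_def by simp
        also have "x + y + (t + s) *\<^sub>R (a - z) = (x + t *\<^sub>R (c - z)) + (y + s *\<^sub>R (b - z))"
          using False unfolding a_def scaleR_diff_right scaleR_add_right
          by (simp add: scaleR_left_distrib)
        also have "norm \<dots> \<le> norm (x + t *\<^sub>R (c - z)) + norm (y + s *\<^sub>R (b - z))"
          by (rule norm_triangle_ineq)
        finally show ?thesis unfolding F_def i j by (simp add: algebra_simps)
      qed
    qed
    then have "p (x + y) - F y j \<le> p x" if "j \<in> I" for j
      unfolding p_def[of x] using that by (intro cINF_greatest[OF Ine]) (auto simp: algebra_simps)
    then have "p (x + y) - p x \<le> p y"
      unfolding p_def[of y] by (intro cINF_greatest[OF Ine]) (auto simp: algebra_simps)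
    then show "p (x + y) \<le> p x + p y" by simp
  next
    fix c :: real and x assume c: "0 < c"
    have "p (c *\<^sub>R x) / c \<le> p x" unfolding p_def[of x]
    proof (rule cINF_greatest[OF Ine])
      fix i assume "i \<in> I"
      then obtain t b where i: "i = (t, b)" "0 \<le> t" "b \<in> D" unfolding I_def by auto
      have "p (c *\<^sub>R x) \<le> norm (c *\<^sub>R x + (c * t) *\<^sub>R (b - z)) - (c * t) * d"
        using low[of "(c * t, b)" "c *\<^sub>R x"] i c unfolding I_def F_def by simp
      also have "c *\<^sub>R x + (c * t) *\<^sub>R (b - z) = c *\<^sub>R (x + t *\<^sub>R (b - z))" by (simp add: algebra_simps)
      also have "norm \<dots> = c * norm (x + t *\<^sub>R (b - z))" using c by simp
      finally show "p (c *\<^sub>R x) / c \<le> F x i" using c unfolding F_def i by (simp add: field_simps)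
    qed
    then show "p (c *\<^sub>R x) \<le> c * p x" using c by (simp add: field_simps)
  next
    have "0 \<le> p 0" unfolding p_def using lb[of _ 0] by (intro cINF_greatest[OF Ine]) auto
    then show "p 0 = 0" using le_norm[of 0] by simp
  qed
  then obtain \<phi> where \<phi>: "linear \<phi>" "\<And>x. \<phi> x \<le> p x"
    using linear_dominated_by_sublinear by blast
  then obtain \<psi> :: "'a \<Rightarrow>\<^sub>L real" where \<psi>: "blinfun_apply \<psi> = \<phi>"
    using blinfun_of_bounded_linear_form[of \<phi> 1] le_norm by (metis mult_1 order_trans)
  have "\<phi> z + d \<le> \<phi> c" if "c \<in> D" for c
  proof -
    have "\<phi> (z - c) \<le> F (z - c) (1, c)"
      using order_trans[OF \<phi>(2) low[of "(1, c)" "z - c"]] that unfolding I_def by simp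
    then show ?thesis unfolding F_def using linear_diff[OF \<phi>(1), of z c] by simp
  qed
  then show ?thesis using \<psi> d(1) by metis
qed

text \<open>
  The suprema over \<open>D k\<close> are sublinear functionals on the dual and decrease with \<open>k\<close>. A linear
  functional below all of them belongs to the bidual, hence is the evaluation at some \<open>x\<close>; by separation \<open>x\<close> cannot lie outside
  any \<open>D k\<close>.
\<close>

lemma reflexive_nested_Inter_nonempty:
  fixes D :: "nat \<Rightarrow> 'a::real_normed_vector set"
  assumes refl: "reflexive_space TYPE('a)"
    and D: "\<And>k. closed (D k)" "\<And>k. convex (D k)" "\<And>k. D k \<noteq> {}" "decseq D" "bounded (D 0)"
  shows "(\<Inter>k. D k) \<noteq> {}"
proof -
  obtain R where R: "\<And>x. x \<in> D 0 \<Longrightarrow> norm x \<le> R" using D(5) unfolding bounded_iff by blast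
  have sub0: "D k \<subseteq> D 0" for k using D(4) by (auto simp: decseq_def)
  define s where "s k \<phi> = (SUP x\<in>D k. blinfun_apply \<phi> x)" for k and \<phi> :: "'a \<Rightarrow>\<^sub>L real"
  have bd: "blinfun_apply \<phi> x \<le> R * norm \<phi>" if "x \<in> D k" for \<phi> :: "'a \<Rightarrow>\<^sub>L real" and x k
  proof -
    have "blinfun_apply \<phi> x \<le> norm \<phi> * norm x" using norm_blinfun[of \<phi> x] by simp
    also have "\<dots> \<le> norm \<phi> * R" using R that sub0 by (intro mult_left_mono) auto
    finally show ?thesis by (simp add: mult.commute)
  qed
  have up: "blinfun_apply \<phi> x \<le> s k \<phi>" if "x \<in> D k" for \<phi> x k
    unfolding s_def using bd that by (intro cSUP_upper bdd_aboveI2[where M = "R * norm \<phi>"]) auto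
  have least: "s k \<phi> \<le> B" if "\<And>x. x \<in> D k \<Longrightarrow> blinfun_apply \<phi> x \<le> B" for \<phi> k B
    unfolding s_def using that D(3) by (intro cSUP_least) auto
  have sub: "sublinear (s k)" for k
  proof (rule sublinearI)
    fix \<phi> \<psi> :: "'a \<Rightarrow>\<^sub>L real"
    show "s k (\<phi> + \<psi>) \<le> s k \<phi> + s k \<psi>"
      by (rule least) (simp add: blinfun.add_left add_mono up)
    show "s k (c *\<^sub>R \<phi>) \<le> c * s k \<phi>" if "0 < c" for c
      using that by (intro least) (simp add: blinfun.scaleR_left up)
    show "s k 0 = 0" unfolding s_def using D(3) by simp
  qed
  have dec: "s j \<le> s k" if "k \<le> j" for j k
    using that D(4) by (auto simp: le_fun_def decseq_def intro!: least up)
  define p where "p \<phi> = (INF q\<in>range s. q \<phi>)" for \<phi>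
  have ch: "q \<le> r \<or> r \<le> q" if "q \<in> range s" "r \<in> range s" for q r
    using that dec nle_le by (metis imageE)
  have "range s \<noteq> {}" "\<And>q. q \<in> range s \<Longrightarrow> sublinear q" "\<And>q. q \<in> range s \<Longrightarrow> q \<le> s 0"
    using sub dec[OF le0] by auto
  note inf = sublinear_INF_chain[OF this(1,2) ch this(3)]
  have p: "sublinear p" "\<And>k \<phi>. p \<phi> \<le> s k \<phi>" unfolding p_def using inf by auto
  obtain \<Phi> where \<Phi>: "linear \<Phi>" "\<And>\<phi>. \<Phi> \<phi> \<le> p \<phi>"
    using linear_dominated_by_sublinear[OF p(1)] by blast
  have \<Phi>s: "\<Phi> \<phi> \<le> s k \<phi>" for \<phi> k using \<Phi>(2) p(2) by (rule order_trans)
  have "\<Phi> \<phi> \<le> R * norm \<phi>" for \<phi> using \<Phi>s[of \<phi> 0] least[of 0 \<phi> "R * norm \<phi>"] bd by force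
  then obtain \<Psi> where \<Psi>: "blinfun_apply \<Psi> = \<Phi>" using blinfun_of_bounded_linear_form[OF \<Phi>(1)] by blast
  obtain x where x: "\<And>\<phi>. \<Phi> \<phi> = blinfun_apply \<phi> x"
    using refl \<Psi> unfolding reflexive_space_def by metis
  have "x \<in> D k" for k
  proof (rule ccontr)
    assume "x \<notin> D k"
    from separation_closed_convex[OF D(1,2) this] obtain \<phi> :: "'a \<Rightarrow>\<^sub>L real" and d
      where \<phi>: "0 < d" "\<And>c. c \<in> D k \<Longrightarrow> blinfun_apply \<phi> x + d \<le> blinfun_apply \<phi> c" by blast
    have "s k (- \<phi>) \<le> - blinfun_apply \<phi> x - d"
      using \<phi>(2) by (intro least) (force simp: blinfun.minus_left)
    moreover have "- blinfun_apply \<phi> x \<le> s k (- \<phi>)"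
      using \<Phi>s[of "- \<phi>" k] by (simp add: x blinfun.minus_left)
    ultimately show False using \<phi>(1) by simp
  qed
  then show ?thesis by blast
qed

section \<open>Translates of a convex set with empty interior\<close>

text \<open>
  A functional that separates \<open>z\<close> from \<open>D\<close> takes values on the ball of radius \<open>r\<close> that go
  below those on \<open>D\<close> by more than \<open>\<eta>\<close> times its norm.
\<close>

lemma closed_convex_fills_cball:
  fixes D :: "'a::real_normed_vector set"
  assumes D: "closed D" "convex D" and r: "0 < r" "\<eta> < r"
    and near: "\<And>y. norm y \<le> r \<Longrightarrow> \<exists>c\<in>D. norm (y - c) \<le> \<eta>"
    and z: "norm z \<le> r - \<eta>"
  shows "z \<in> D"
proof (rule ccontr)
  assume "z \<notin> D"
  from separation_closed_convex[OF D this] obtain \<phi> :: "'a \<Rightarrow>\<^sub>L real" and d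
    where \<phi>: "0 < d" "\<And>c. c \<in> D \<Longrightarrow> blinfun_apply \<phi> z + d \<le> blinfun_apply \<phi> c" by blast
  define k where "k = \<eta> * norm \<phi> - blinfun_apply \<phi> z - d"
  have low: "- k \<le> blinfun_apply \<phi> y" if y: "norm y \<le> r" for y
  proof -
    obtain c where c: "c \<in> D" "norm (y - c) \<le> \<eta>" using near[OF y] by blast
    have "blinfun_apply \<phi> (c - y) \<le> norm \<phi> * norm (c - y)" using norm_blinfun[of \<phi> "c - y"] by simp
    also have "\<dots> \<le> norm \<phi> * \<eta>" using c(2) by (intro mult_left_mono) (auto simp: norm_minus_commute)
    finally show ?thesis using \<phi>(2)[OF c(1)] unfolding k_def by (simp add: blinfun.diff_right mult.commute)
  qed
  have up: "blinfun_apply \<phi> y \<le> k" if "norm y \<le> r" for y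
    using low[of "- y"] that by (simp add: blinfun.minus_right)
  have "norm \<phi> \<le> k / r"
  proof (rule norm_blinfun_bound)
    show "0 \<le> k / r" using up[of 0] r by simp
    fix x show "norm (blinfun_apply \<phi> x) \<le> k / r * norm x"
    proof (cases "x = 0")
      case False
      then have n: "norm ((r / norm x) *\<^sub>R x) \<le> r" using r by simp
      have "(r / norm x) * blinfun_apply \<phi> x \<le> k" "- k \<le> (r / norm x) * blinfun_apply \<phi> x"
        using up[OF n] low[OF n] by (simp_all add: blinfun.scaleR_right)
      then show ?thesis using False r by (simp add: field_simps abs_le_iff)
    qed simp
  qed
  then have "r * norm \<phi> \<le> k" using r by (simp add: field_simps)
  moreover have "- blinfun_apply \<phi> z \<le> norm \<phi> * (r - \<eta>)"
    using norm_blinfun[of \<phi> z] mult_left_mono[OF z norm_ge_zero[of \<phi>]] by simp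
  ultimately show False using \<phi>(1) unfolding k_def by (simp add: algebra_simps)
qed

lemma far_point_if_empty_interior:
  fixes D :: "'a::real_normed_vector set"
  assumes "closed D" "convex D" "interior D = {}" "0 < \<eta>" "\<eta> < r"
  shows "\<exists>y. norm y \<le> r \<and> (\<forall>c\<in>D. \<eta> < norm (y - c))"
proof (rule ccontr)
  assume "\<not> ?thesis"
  then have "\<exists>c\<in>D. norm (y - c) \<le> \<eta>" if "norm y \<le> r" for y using that by (force simp: not_less)
  then have "cball 0 (r - \<eta>) \<subseteq> D"
    using closed_convex_fills_cball[OF assms(1,2), of r \<eta>] assms(4,5) by auto
  then have "ball 0 (r - \<eta>) \<subseteq> interior D" by (intro interior_maximal) auto
  then show False using assms(3,5) by auto
qed

definition segment_sum :: "'a::real_normed_vector set \<Rightarrow> 'a \<Rightarrow> 'a set" where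
  "segment_sum D v = (\<Union>x\<in>D. \<Union>y\<in>(\<lambda>t. t *\<^sub>R v) ` {0..1::real}. {x + y})"

lemma segment_sum_iff: "z \<in> segment_sum D v \<longleftrightarrow> (\<exists>x\<in>D. \<exists>t. 0 \<le> t \<and> t \<le> 1 \<and> z = x + t *\<^sub>R v)"
  unfolding segment_sum_def by force

lemma closed_segment_sum: "closed D \<Longrightarrow> closed (segment_sum D v)"
  unfolding segment_sum_def
  by (intro closed_compact_sums compact_continuous_image continuous_intros) auto

lemma convex_segment_sum:
  assumes "convex D"
  shows "convex (segment_sum D v)"
proof -
  have "convex ((\<lambda>t::real. t *\<^sub>R v) ` {0..1})"
    by (intro convex_linear_image linearI) (auto simp: algebra_simps)
  then show ?thesis unfolding segment_sum_def by (intro convex_sums assms)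
qed

text \<open>
  If \<open>D\<close> contains a segment parallel to \<open>v\<close>, then \<open>D\<close> contains a homothetic copy of
  \<open>segment_sum D v\<close>: average \<open>D\<close> with that segment, the weights being chosen such that the shares of \<open>D\<close> and of
  the segment are scaled alike.
\<close>

lemma interior_segment_sum_empty:
  fixes D :: "'a::real_normed_vector set"
  assumes D: "convex D" "interior D = {}" and c: "c \<in> D" "c' \<in> D" and a: "0 < a"
    and v: "v = a *\<^sub>R (c - c')"
  shows "interior (segment_sum D v) = {}"
proof (rule ccontr)
  assume "interior (segment_sum D v) \<noteq> {}"
  then obtain y e where e: "0 < e" "ball y e \<subseteq> segment_sum D v" by (auto simp: mem_interior)
  \<comment> \<open>This weight makes \<open>l / a = 1 - l\<close>: the averaged segment is \<open>1 - l\<close> times the segment from \<open>0\<close> to \<open>v\<close>.\<close>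
  define l where "l = a / (1 + a)"
  have l: "0 < l" "l < 1" "l = a * (1 - l)" using a unfolding l_def by (auto simp: field_simps)
  have in_D: "(1 - l) *\<^sub>R z + l *\<^sub>R c' \<in> D" if "z \<in> segment_sum D v" for z
  proof -
    obtain x t where x: "x \<in> D" "0 \<le> t" "t \<le> 1" "z = x + t *\<^sub>R v"
      using \<open>z \<in> _\<close> unfolding segment_sum_iff by blast
    have "(1 - l) *\<^sub>R x + l *\<^sub>R ((1 - t) *\<^sub>R c' + t *\<^sub>R c) \<in> D"
      using x c l by (intro convexD[OF D(1)]) auto
    also have "(1 - l) *\<^sub>R x + l *\<^sub>R ((1 - t) *\<^sub>R c' + t *\<^sub>R c)
        = (1 - l) *\<^sub>R x + (l * t) *\<^sub>R (c - c') + l *\<^sub>R c'" by (simp add: algebra_simps)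
    also have "(l * t) *\<^sub>R (c - c') = ((1 - l) * t) *\<^sub>R v"
      unfolding v using l(3) by (metis mult.assoc mult.commute scaleR_scaleR)
    finally show ?thesis unfolding x(4) by (simp add: algebra_simps)
  qed
  have "ball ((1 - l) *\<^sub>R y + l *\<^sub>R c') ((1 - l) * e) \<subseteq> D"
  proof
    fix w assume w: "w \<in> ball ((1 - l) *\<^sub>R y + l *\<^sub>R c') ((1 - l) * e)"
    define z where "z = (1 / (1 - l)) *\<^sub>R (w - l *\<^sub>R c')"
    have wz: "w = (1 - l) *\<^sub>R z + l *\<^sub>R c'" unfolding z_def using l by simp
    have "dist ((1 - l) *\<^sub>R y + l *\<^sub>R c') w = norm ((1 - l) *\<^sub>R (y - z))"
      unfolding wz dist_norm by (simp add: algebra_simps)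
    also have "\<dots> = (1 - l) * dist y z" using l by (simp add: dist_norm)
    finally have "z \<in> ball y e" using w l by simp
    then show "w \<in> D" unfolding wz using e(2) in_D by blast
  qed
  then have "ball ((1 - l) *\<^sub>R y + l *\<^sub>R c') ((1 - l) * e) \<subseteq> interior D" by (intro interior_maximal) auto
  moreover have "0 < (1 - l) * e" using e(1) l by simp
  ultimately show False using D(2) by auto
qed

text \<open>
  Adding to \<open>C\<close> the segments from \<open>0\<close> to \<open>- d 0\<close>, \<open>- d 1\<close>, ... one after the other, the
  interior remains empty, because \<open>C - C\<close> spans every direction. So \<open>y n\<close> can be chosen
  farther than \<open>r / 2\<close> from the \<open>n\<close>-th sum. If \<open>x\<close> is within \<open>r / 2\<close> of \<open>d n\<close>, then \<open>C - x\<close> is within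
  \<open>r / 2\<close> of all later sums, and so it contains none of the later \<open>y k\<close>.
\<close>

lemma escaping_sequence:
  fixes C :: "'a::real_normed_vector set" and d :: "nat \<Rightarrow> 'a"
  assumes C: "closed C" "convex C" "interior C = {}"
    and span: "\<And>v. \<exists>a>0. \<exists>c\<in>C. \<exists>c'\<in>C. v = a *\<^sub>R (c - c')"
    and d: "\<And>x e. 0 < e \<Longrightarrow> \<exists>n. dist (d n) x < e" and r: "0 < r"
  shows "\<exists>y. (\<forall>n. norm (y n) \<le> r) \<and> (\<forall>x. finite {n::nat. x + y n \<in> C})"
proof -
  define D where "D = rec_nat C (\<lambda>n S. segment_sum S (- d n))"
  have D0: "D 0 = C" and DS: "D (Suc n) = segment_sum (D n) (- d n)" for n unfolding D_def by simp_all
  have sub: "D n \<subseteq> D (Suc n)" for n unfolding DS by (force simp: segment_sum_iff)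
  have mono: "D n \<subseteq> D k" if "n \<le> k" for n k using sub that by (rule lift_Suc_mono_le)
  have shift: "c - d n \<in> D (Suc n)" if "c \<in> D n" for c n
    unfolding DS segment_sum_iff using that by (intro bexI[of _ c] exI[of _ 1]) auto
  have D: "closed (D n) \<and> convex (D n) \<and> interior (D n) = {}" for n
  proof (induction n)
    case 0
    then show ?case using C by (simp add: D0)
  next
    case (Suc n)
    obtain a c c' where "a > 0" "c \<in> C" "c' \<in> C" "- d n = a *\<^sub>R (c - c')" using span by blast
    moreover have "C \<subseteq> D n" using mono[of 0 n] D0 by simp
    ultimately show ?case unfolding DS
      using Suc closed_segment_sum convex_segment_sum interior_segment_sum_empty[of "D n" c c' a "- d n"]
      by blast
  qed
  have "\<exists>y. norm y \<le> r \<and> (\<forall>c\<in>D n. r / 2 < norm (y - c))" for n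
    using D[of n] r by (intro far_point_if_empty_interior) auto
  then obtain y where y: "\<And>n. norm (y n) \<le> r" "\<And>n c. c \<in> D n \<Longrightarrow> r / 2 < norm (y n - c)" by metis
  have "finite {n. x + y n \<in> C}" for x
  proof -
    obtain n where n: "dist (d n) x < r / 2" using d[of "r / 2" x] r by auto
    have "x + y k \<notin> C" if "n < k" for k
    proof
      assume "x + y k \<in> C"
      then have "x + y k \<in> D n" using mono[of 0 n] D0 by auto
      then have "x + y k - d n \<in> D k" using shift mono[of "Suc n" k] \<open>n < k\<close> by auto
      from y(2)[OF this] n show False by (simp add: dist_norm)
    qed
    then have "{n. x + y n \<in> C} \<subseteq> {..n}" by (auto simp: not_less[symmetric])
    then show ?thesis by (rule finite_subset) simp
  qed
  with y(1) show ?thesis by blast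
qed

section \<open>Ptak's lemma on averages\<close>

lemma emeasure_bind_pmf_le:
  assumes "\<And>i. i \<in> set_pmf q \<Longrightarrow> emeasure (measure_pmf (f i)) I \<le> c"
  shows "emeasure (measure_pmf (bind_pmf q f)) I \<le> c"
proof -
  have "emeasure (measure_pmf (bind_pmf q f)) I \<le> (\<integral>\<^sup>+i. c \<partial>measure_pmf q)"
    unfolding emeasure_bind_pmf using assms by (intro nn_integral_mono_AE) (simp add: AE_measure_pmf_iff)
  then show ?thesis by (simp add: measure_pmf.emeasure_space_1[simplified])
qed

text \<open>
  The next three definitions set up the induction behind Ptak's lemma. Its claim for a
  finite set \<open>s\<close> concerns only the members of the family that contain \<open>s\<close>, but it allows
  arbitrary blocks \<open>w\<close> moving to infinity in place of single indices; this is what makes it possible to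
  treat finitely many sets \<open>s\<close> at the same time.
\<close>

definition small_above :: "nat set set \<Rightarrow> real \<Rightarrow> nat set \<Rightarrow> nat pmf \<Rightarrow> bool" where
  "small_above \<F> \<delta> s \<mu> \<longleftrightarrow> (\<forall>I\<in>\<F>. s \<subseteq> I \<longrightarrow> emeasure (measure_pmf \<mu>) I \<le> ennreal \<delta>)"

definition drifting :: "(nat \<Rightarrow> nat pmf) \<Rightarrow> bool" where
  "drifting w \<longleftrightarrow> (\<forall>i. finite (set_pmf (w i)) \<and> set_pmf (w i) \<subseteq> {i..})"

definition averages_small :: "nat set set \<Rightarrow> nat set \<Rightarrow> bool" where
  "averages_small \<F> s \<longleftrightarrow> (\<forall>w \<delta>. drifting w \<longrightarrow> 0 < \<delta> \<longrightarrow>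
     (\<exists>q. finite (set_pmf q) \<and> small_above \<F> \<delta> s (bind_pmf q w)))"

lemma averages_small_tail:
  assumes "averages_small \<F> s" "drifting w" "0 < \<delta>"
  shows "\<exists>q. finite (set_pmf q) \<and> set_pmf q \<subseteq> {N..} \<and> small_above \<F> \<delta> s (bind_pmf q w)"
proof -
  have "drifting (\<lambda>i. w (i + N))" using assms(2) unfolding drifting_def by (meson le_add1 atLeast_subset_iff subset_trans)
  then obtain q where q: "finite (set_pmf q)" "small_above \<F> \<delta> s (bind_pmf q (\<lambda>i. w (i + N)))"
    using assms(1,3) unfolding averages_small_def by blast
  have "bind_pmf (map_pmf (\<lambda>i. i + N) q) w = bind_pmf q (\<lambda>i. w (i + N))"
    by (simp add: bind_map_pmf)
  with q show ?thesis by (intro exI[of _ "map_pmf (\<lambda>i. i + N) q"]) auto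
qed

text \<open>
  Averages of blocks that are good for some sets remain good for them, so the remaining set can be handled by
  averaging such blocks once more.
\<close>

lemma averages_small_simultaneously:
  assumes "finite S" "\<And>s. s \<in> S \<Longrightarrow> averages_small \<F> s" "drifting w" "0 < \<delta>"
  shows "\<exists>q. finite (set_pmf q) \<and> set_pmf q \<subseteq> {N..} \<and> (\<forall>s\<in>S. small_above \<F> \<delta> s (bind_pmf q w))"
  using assms(1,2)
proof (induction S arbitrary: N rule: finite_induct)
  case empty
  then show ?case by (intro exI[of _ "return_pmf N"]) auto
next
  case (insert s S)
  have "\<exists>q. finite (set_pmf q) \<and> set_pmf q \<subseteq> {N..} \<and> (\<forall>s\<in>S. small_above \<F> \<delta> s (bind_pmf q w))" for N
    using insert.IH insert.prems by blast
  then obtain q where q: "\<And>i. finite (set_pmf (q i))" "\<And>i. set_pmf (q i) \<subseteq> {i..}"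
    "\<And>i t. t \<in> S \<Longrightarrow> small_above \<F> \<delta> t (bind_pmf (q i) w)" by metis
  have "drifting (\<lambda>i. bind_pmf (q i) w)"
    using q(1,2) assms(3) unfolding drifting_def
    by (auto simp: subset_iff) (meson atLeast_iff order_trans)+
  from averages_small_tail[OF _ this assms(4)] insert.prems
  obtain p where p: "finite (set_pmf p)" "set_pmf p \<subseteq> {N..}"
    "small_above \<F> \<delta> s (bind_pmf p (\<lambda>i. bind_pmf (q i) w))" by blast
  have "small_above \<F> \<delta> t (bind_pmf p (\<lambda>i. bind_pmf (q i) w))" if "t \<in> insert s S" for t
  proof (cases "t = s")
    case False
    then have t: "t \<in> S" using that by simp
    show ?thesis unfolding small_above_def
    proof (intro ballI impI)
      fix I assume I: "I \<in> \<F>" "t \<subseteq> I"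
      have "emeasure (measure_pmf (bind_pmf (q i) w)) I \<le> ennreal \<delta>" for i
        using q(3)[OF t, of i] I unfolding small_above_def by simp
      then show "emeasure (measure_pmf (bind_pmf p (\<lambda>i. bind_pmf (q i) w))) I \<le> ennreal \<delta>"
        by (rule emeasure_bind_pmf_le)
    qed
  next
    case True
    with p(3) show ?thesis by simp
  qed
  moreover have "set_pmf (bind_pmf p q) \<subseteq> {N..}"
  proof
    fix n assume "n \<in> set_pmf (bind_pmf p q)"
    then obtain i where "i \<in> set_pmf p" "n \<in> set_pmf (q i)" by auto
    then have "N \<le> i" "i \<le> n" using p(2) q(2)[of i] by blast+
    then show "n \<in> {N..}" by simp
  qed
  moreover have "finite (set_pmf (bind_pmf p q))" using p(1) q(1) by simp
  ultimately show ?case unfolding bind_assoc_pmf[symmetric] by blast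
qed

lemma measure_uniform_mixture:
  assumes "0 < k"
  shows "measure (measure_pmf (bind_pmf (pmf_of_set {..<k}) f)) I
    = (\<Sum>i<k. measure (measure_pmf (f i)) I) / real k"
proof -
  have ne: "{..<k} \<noteq> {}" using assms by auto
  have "ennreal (measure (measure_pmf (bind_pmf (pmf_of_set {..<k}) f)) I)
    = (\<Sum>i<k. ennreal (measure (measure_pmf (f i)) I)) / of_nat k"
    unfolding measure_pmf.emeasure_eq_measure[symmetric]
    using nn_integral_pmf_of_set[OF ne] by (simp add: ennreal_of_nat_eq_real_of_nat)
  also have "\<dots> = ennreal ((\<Sum>i<k. measure (measure_pmf (f i)) I) / real k)"
    using assms by (simp add: sum_nonneg divide_ennreal ennreal_of_nat_eq_real_of_nat)
  finally show ?thesis by (subst (asm) ennreal_inj) (auto intro!: sum_nonneg divide_nonneg_nonneg)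
qed

text \<open>
  Choose blocks one after the other, each of them good for all \<open>insert n s\<close> with \<open>n\<close> in the
  support of an earlier block. A member of the family that contains \<open>s\<close> and meets the blocks then has small mass in
  all blocks after the first one that it meets, so a long uniform average of the blocks is good for \<open>s\<close>.
\<close>

lemma averages_small_step:
  assumes s: "finite s" and step: "\<And>n. n \<notin> s \<Longrightarrow> averages_small \<F> (insert n s)"
  shows "averages_small \<F> s"
  unfolding averages_small_def
proof (intro allI impI)
  fix w and \<delta> :: real assume w: "drifting w" and \<delta>: "0 < \<delta>"
  define B where "B q = bind_pmf q w" for q
  obtain N where N: "s \<subseteq> {..<N}" using s finite_nat_iff_bounded by blast
  have supp: "finite (set_pmf (B q)) \<and> set_pmf (B q) \<inter> s = {}" if "finite (set_pmf q)" "set_pmf q \<subseteq> {N..}" for q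
    using that w N unfolding B_def drifting_def by (fastforce simp: subset_iff)
  have blocks: "\<exists>q. \<forall>i<k. finite (set_pmf (q i)) \<and> set_pmf (q i) \<subseteq> {N..} \<and>
      (\<forall>j<i. \<forall>n\<in>set_pmf (B (q j)). small_above \<F> (\<delta> / 2) (insert n s) (B (q i)))" for k :: nat
  proof (induction k)
    case 0
    then show ?case by simp
  next
    case (Suc k)
    then obtain q where q: "\<forall>i<k. finite (set_pmf (q i)) \<and> set_pmf (q i) \<subseteq> {N..} \<and>
      (\<forall>j<i. \<forall>n\<in>set_pmf (B (q j)). small_above \<F> (\<delta> / 2) (insert n s) (B (q i)))" by blast
    define T where "T = (\<Union>j<k. set_pmf (B (q j)))"
    have "finite (set_pmf (B (q j))) \<and> set_pmf (B (q j)) \<inter> s = {}" if "j < k" for j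
      using q that by (intro supp) blast+
    then have T: "finite T" "T \<inter> s = {}" unfolding T_def by (simp, blast)
    have "\<And>t. t \<in> (\<lambda>n. insert n s) ` T \<Longrightarrow> averages_small \<F> t" using step T(2) by auto
    from averages_small_simultaneously[where N = N, OF finite_imageI[OF T(1), of "\<lambda>n. insert n s"] this w half_gt_zero[OF \<delta>]]
    obtain p where p: "finite (set_pmf p)" "set_pmf p \<subseteq> {N..}"
      "\<forall>n\<in>T. small_above \<F> (\<delta> / 2) (insert n s) (B p)" unfolding B_def by auto
    show ?case
    proof (intro exI[of _ "q(k := p)"] allI impI)
      fix i assume "i < Suc k"
      then consider "i < k" | "i = k" by linarith
      then show "finite (set_pmf ((q(k := p)) i)) \<and> set_pmf ((q(k := p)) i) \<subseteq> {N..} \<and>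
        (\<forall>j<i. \<forall>n\<in>set_pmf (B ((q(k := p)) j)). small_above \<F> (\<delta> / 2) (insert n s) (B ((q(k := p)) i)))"
        using q p unfolding T_def by cases auto
    qed
  qed
  \<comment> \<open>With at least \<open>2 / \<delta>\<close> blocks, the first block that is met contributes at most \<open>\<delta> / 2\<close> to the average.\<close>
  obtain k :: nat where k: "2 / \<delta> < real k" using reals_Archimedean2 by blast
  have "0 < 2 / \<delta>" using \<delta> by simp
  then have k0: "0 < k" using k by linarith
  obtain q where q: "\<And>i. i < k \<Longrightarrow> finite (set_pmf (q i))" "\<And>i. i < k \<Longrightarrow> set_pmf (q i) \<subseteq> {N..}"
    "\<And>i j n. j < i \<Longrightarrow> i < k \<Longrightarrow> n \<in> set_pmf (B (q j)) \<Longrightarrow> small_above \<F> (\<delta> / 2) (insert n s) (B (q i))"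
    using blocks[of k] by blast
  define p where "p = bind_pmf (pmf_of_set {..<k}) q"
  have Bp: "bind_pmf p w = bind_pmf (pmf_of_set {..<k}) (\<lambda>i. B (q i))"
    unfolding p_def B_def by (simp add: bind_assoc_pmf)
  have "measure (measure_pmf (bind_pmf p w)) I \<le> \<delta>" if I: "I \<in> \<F>" "s \<subseteq> I" for I
  proof -
    define a where "a i = measure (measure_pmf (B (q i))) I" for i
    have a: "0 \<le> a i" "a i \<le> 1" for i unfolding a_def by auto
    have "(\<Sum>i<k. a i) \<le> 1 + real k * (\<delta> / 2)"
    proof (cases "\<exists>i<k. a i \<noteq> 0")
      case False
      then show ?thesis using \<delta> by simp
    next
      case True
      define j where "j = (LEAST i. i < k \<and> a i \<noteq> 0)"
      have j: "j < k" "a j \<noteq> 0" using LeastI_ex[OF True] unfolding j_def by auto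
      have before: "a i = 0" if "i < j" for i
        using not_less_Least[of i "\<lambda>i. i < k \<and> a i \<noteq> 0"] that j(1) unfolding j_def by auto
      obtain n where n: "n \<in> set_pmf (B (q j))" "n \<in> I"
        using j(2) unfolding a_def by (metis Int_emptyI measure_pmf_zero_iff)
      have after: "a i \<le> \<delta> / 2" if "j < i" "i < k" for i
        using q(3)[OF that n(1)] I n(2) \<delta> unfolding small_above_def a_def
        by (auto simp: measure_pmf.emeasure_eq_measure)
      have "a i \<le> \<delta> / 2 + (if i = j then 1 else 0)" if "i < k" for i
        using before[of i] after[of i] a(2)[of i] that \<delta> by (cases i j rule: linorder_cases) auto
      then have "(\<Sum>i<k. a i) \<le> (\<Sum>i<k. \<delta> / 2 + (if i = j then 1 else 0))" by (intro sum_mono) auto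
      also have "\<dots> = real k * (\<delta> / 2) + 1" using j(1) by (simp add: sum.distrib)
      finally show ?thesis by simp
    qed
    also have "\<dots> \<le> real k * \<delta>" using k \<delta> by (simp add: field_simps)
    finally show ?thesis unfolding Bp measure_uniform_mixture[OF k0] a_def using k0 by (simp add: field_simps)
  qed
  then have "small_above \<F> \<delta> s (bind_pmf p w)"
    unfolding small_above_def measure_pmf.emeasure_eq_measure by (simp add: ennreal_leI)
  moreover have "finite (set_pmf p)" unfolding p_def using q(1) k0 by (subst set_bind_pmf) (auto simp: set_pmf_of_set lessThan_empty_iff)
  ultimately show "\<exists>q. finite (set_pmf q) \<and> small_above \<F> \<delta> s (bind_pmf q w)" by blast
qed

text \<open>
  If the claim failed for the empty set, the induction step would produce an infinite increasing
  chain of finite sets at which it fails. Each of them has to be contained in a member of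
  the family, since otherwise the claim is void, and the union of the chain contradicts the assumption.
\<close>

theorem Ptak_averages:
  fixes \<F> :: "nat set set"
  assumes no_inf: "\<And>A. infinite A \<Longrightarrow> \<exists>s\<subseteq>A. finite s \<and> (\<forall>I\<in>\<F>. \<not> s \<subseteq> I)" and \<delta>: "0 < \<delta>"
  shows "\<exists>\<mu>. \<forall>I\<in>\<F>. emeasure (measure_pmf \<mu>) I \<le> ennreal \<delta>"
proof -
  have "averages_small \<F> {}"
  proof (rule ccontr)
    assume not: "\<not> averages_small \<F> {}"
    have "\<exists>f. \<forall>k. (finite (f k) \<and> \<not> averages_small \<F> (f k)) \<and> (f k \<subset> f (Suc k))"
    proof (rule dependent_nat_choice)
      show "\<exists>s. finite s \<and> \<not> averages_small \<F> s" using not by blast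
      fix s assume "finite s \<and> \<not> averages_small \<F> s"
      then show "\<exists>t. (finite t \<and> \<not> averages_small \<F> t) \<and> s \<subset> t"
        using averages_small_step[of s \<F>] by (metis finite_insert psubset_insert_iff psubsetI subset_insertI insertI1)
    qed
    then obtain f where f: "\<And>k. finite (f k)" "\<And>k. \<not> averages_small \<F> (f k)" "\<And>k. f k \<subset> f (Suc k)" by blast
    have mono: "mono f" using f(3) by (intro incseq_SucI) auto
    have "k \<le> card (f k)" for k
    proof (induction k)
      case (Suc k)
      then show ?case using psubset_card_mono[OF f(1) f(3), of k] by simp
    qed simp
    then have inf: "infinite (\<Union>k. f k)"
      using card_mono[of "\<Union>k. f k"] by (metis Suc_n_not_le_n UN_upper UNIV_I order_trans)
    then obtain s where s: "s \<subseteq> (\<Union>k. f k)" "finite s" "\<forall>I\<in>\<F>. \<not> s \<subseteq> I"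
      using no_inf[OF inf] by blast
    have "\<forall>n\<in>s. \<exists>k. n \<in> f k" using s(1) by blast
    then obtain g where g: "\<And>n. n \<in> s \<Longrightarrow> n \<in> f (g n)" by (auto simp: bchoice_iff)
    define k where "k = Max (insert 0 (g ` s))"
    have "g n \<le> k" if "n \<in> s" for n unfolding k_def using that s(2) by (intro Max_ge) auto
    then have k: "s \<subseteq> f k" using g monoD[OF mono] by blast
    have "small_above \<F> \<delta> (f k) \<mu>" for \<delta> \<mu>
      unfolding small_above_def using s(3) k by (meson order_trans)
    then have "averages_small \<F> (f k)" unfolding averages_small_def
      by (auto intro: exI[of _ "return_pmf 0"])
    with f(2) show False by blast
  qed
  moreover have "drifting return_pmf" unfolding drifting_def by simp
  ultimately obtain q where "small_above \<F> \<delta> {} (bind_pmf q return_pmf)"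
    using \<delta> unfolding averages_small_def by blast
  then show ?thesis unfolding small_above_def by blast
qed

section \<open>Thin sets and Haar null sets\<close>

text \<open>
  The small random vector \<open>\<gamma>\<close> is a continuous image of a random element of \<open>nat \<times> real\<close>, which is large enough for discrete vectors and
  for vectors on a segment. A sum of independent vectors then is a continuous function on the space of sequences in
  \<open>nat \<times> real\<close>, hence measurable.
\<close>

definition thin_set :: "'a::real_normed_vector set \<Rightarrow> bool" where
  "thin_set E \<longleftrightarrow> E \<in> sets borel \<and>
     (\<forall>\<epsilon>>0. \<exists>(M :: (nat \<times> real) measure) \<gamma>. prob_space M \<and> sets M = sets borel \<and>
        continuous_on UNIV \<gamma> \<and> (\<forall>a. norm (\<gamma> a) \<le> \<epsilon>) \<and>
        (\<forall>x. emeasure M {a. x + \<gamma> a \<in> E} \<le> ennreal \<epsilon>))"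

lemma thin_setD_borel: "thin_set E \<Longrightarrow> E \<in> sets borel"
  unfolding thin_set_def by blast

lemma continuous_vimage_borel:
  "continuous_on UNIV f \<Longrightarrow> E \<in> sets borel \<Longrightarrow> {a. f a \<in> E} \<in> sets borel"
  using measurable_sets[OF borel_measurable_continuous_onI, of f E] by (simp add: vimage_def)

text \<open>
  Take independent vectors \<open>\<gamma> n\<close> of norm at most \<open>(1/2) ^ n\<close>, the \<open>n\<close>-th one chosen
  for the set \<open>E j\<close> with \<open>j\<close> the first component of \<open>prod_decode n\<close>. Their sum converges uniformly. Conditioning on all
  vectors except the \<open>n\<close>-th shows that the sum falls into a translate of \<open>E j\<close> with probability at most \<open>(1/2) ^ n\<close>, and
  every \<open>j\<close> occurs for arbitrarily large \<open>n\<close>.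
\<close>

lemma haar_null_UN_thin_sets:
  fixes E :: "nat \<Rightarrow> 'a::banach set"
  assumes thin: "\<And>j. thin_set (E j)"
  shows "haar_null (\<Union>j. E j)"
proof -
  define e where "e n = (1/2::real)^n" for n
  have "\<forall>n. \<exists>(M :: (nat \<times> real) measure) \<gamma>. prob_space M \<and> sets M = sets borel \<and>
      continuous_on UNIV \<gamma> \<and> (\<forall>a. norm (\<gamma> a) \<le> e n) \<and>
      (\<forall>x. emeasure M {a. x + \<gamma> a \<in> E (fst (prod_decode n))} \<le> ennreal (e n))"
    using thin unfolding thin_set_def e_def by (metis zero_less_power half_gt_zero_iff zero_less_one)
  then obtain M :: "nat \<Rightarrow> (nat \<times> real) measure" and \<gamma> where M: "\<And>n. prob_space (M n)" "\<And>n. sets (M n) = sets borel"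
    and \<gamma>: "\<And>n. continuous_on UNIV (\<gamma> n)" "\<And>n a. norm (\<gamma> n a) \<le> e n"
    and small: "\<And>n x. emeasure (M n) {a. x + \<gamma> n a \<in> E (fst (prod_decode n))} \<le> ennreal (e n)"
    by metis
  define P where "P = PiM UNIV M"
  define T where "T \<omega> = (\<Sum>n. \<gamma> n (\<omega> n))" for \<omega>
  have space_M: "space (M n) = UNIV" for n using sets_eq_imp_space_eq[OF M(2)] by simp
  have summable_e: "summable e" unfolding e_def by (rule summable_geometric) simp
  have summable: "summable (\<lambda>n. \<gamma> n (\<omega> n))" for \<omega>
    by (rule summable_comparison_test'[OF summable_e \<gamma>(2)])
  have P: "prob_space P" unfolding P_def using M(1) by (rule prob_space_PiM)
  have space_P: "space P = UNIV" unfolding P_def by (simp add: space_PiM space_M)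
  have "sets P = sets (PiM UNIV (\<lambda>_. borel :: (nat \<times> real) measure))"
    unfolding P_def using M(2) by (intro sets_PiM_cong) auto
  then have sets_P: "sets P = sets borel" using sets_PiM_equal_borel by metis
  have cont_T: "continuous_on UNIV T"
  proof (rule uniform_limit_theorem)
    show "uniform_limit UNIV (\<lambda>n \<omega>. \<Sum>i<n. \<gamma> i (\<omega> i)) T sequentially"
      unfolding T_def by (rule Weierstrass_m_test[OF \<gamma>(2) summable_e])
    show "\<forall>\<^sub>F n in sequentially. continuous_on UNIV (\<lambda>\<omega>. \<Sum>i<n. \<gamma> i (\<omega> i))"
      by (intro always_eventually allI continuous_on_sum
          continuous_on_compose2[OF \<gamma>(1) continuous_on_product_coordinates] subset_UNIV)
  qed simp
  have E_borel: "E j \<in> sets borel" for j using thin thin_setD_borel by blast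
  have zero: "emeasure P {\<omega>. T \<omega> - x \<in> E j} = 0" for x j
  proof -
    define A where "A = {\<omega>. T \<omega> - x \<in> E j}"
    have A: "A \<in> sets P" unfolding A_def sets_P
      by (intro continuous_vimage_borel E_borel continuous_intros cont_T)
    have le: "emeasure P A \<le> ennreal (e n)" if n: "fst (prod_decode n) = j" for n
    proof -
      define Q where "Q = PiM (UNIV - {n}) M"
      have Q: "prob_space Q" unfolding Q_def using M(1) by (intro prob_space_PiM)
      interpret Mn: prob_space "M n" by (rule M)
      interpret Q: prob_space Q by (rule Q)
      interpret MQ: pair_sigma_finite "M n" Q ..
      have ins: "insert n (UNIV - {n}) = UNIV" by auto
      have distr: "distr (M n \<Otimes>\<^sub>M Q) P (\<lambda>(a, X). X(n := a)) = P"
        using distr_pair_PiM_eq_PiM[of "UNIV - {n}" M n] M(1) unfolding ins P_def Q_def by simp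
      have "(\<lambda>(a, X). X(n := a)) \<in> measurable (M n \<Otimes>\<^sub>M Q) (PiM (insert n (UNIV - {n})) M)"
        unfolding Q_def split_beta' by (rule measurable_fun_upd[where J = "UNIV - {n}"]) auto
      then have meas: "(\<lambda>(a, X). X(n := a)) \<in> measurable (M n \<Otimes>\<^sub>M Q) P" unfolding ins P_def .
      define B where "B = (\<lambda>(a, X). X(n := a)) -` A \<inter> space (M n \<Otimes>\<^sub>M Q)"
      have B: "B \<in> sets (M n \<Otimes>\<^sub>M Q)" unfolding B_def using measurable_sets[OF meas A] .
      have "emeasure P A = emeasure (M n \<Otimes>\<^sub>M Q) B"
        using emeasure_distr[OF meas A] unfolding distr B_def .
      also have "\<dots> = (\<integral>\<^sup>+X. emeasure (M n) ((\<lambda>a. (a, X)) -` B) \<partial>Q)"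
        by (rule MQ.emeasure_pair_measure_alt2[OF B])
      also have "\<dots> \<le> (\<integral>\<^sup>+X. ennreal (e n) \<partial>Q)"
      proof (rule nn_integral_mono)
        fix X
        \<comment> \<open>Any reference value for the \<open>n\<close>-th coordinate will do.\<close>
        define b where "b = (undefined :: nat \<times> real)"
        have split: "T (X(n := a)) = T (X(n := b)) - \<gamma> n b + \<gamma> n a" for a
        proof -
          have "(\<lambda>m. \<gamma> m ((X(n := b)) m)) sums T (X(n := b))"
            unfolding T_def by (rule summable_sums[OF summable])
          moreover have "(\<lambda>m. if m = n then \<gamma> n a - \<gamma> n b else 0) sums (\<gamma> n a - \<gamma> n b)"
            using sums_single[of n "\<lambda>_. \<gamma> n a - \<gamma> n b"] by simp
          ultimately have "(\<lambda>m. \<gamma> m ((X(n := b)) m) + (if m = n then \<gamma> n a - \<gamma> n b else 0))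
            sums (T (X(n := b)) + (\<gamma> n a - \<gamma> n b))" by (rule sums_add)
          also have "(\<lambda>m. \<gamma> m ((X(n := b)) m) + (if m = n then \<gamma> n a - \<gamma> n b else 0)) = (\<lambda>m. \<gamma> m ((X(n := a)) m))"
            by auto
          finally have "T (X(n := a)) = T (X(n := b)) + (\<gamma> n a - \<gamma> n b)"
            unfolding T_def[of "X(n := a)"] by (rule sums_unique[THEN sym])
          then show ?thesis by simp
        qed
        define z where "z = T (X(n := b)) - \<gamma> n b - x"
        have "z + \<gamma> n a = T (X(n := a)) - x" for a unfolding z_def by (subst split) simp
        then have "(\<lambda>a. (a, X)) -` B \<subseteq> {a. z + \<gamma> n a \<in> E j}"
          unfolding B_def A_def by auto
        moreover have "{a. z + \<gamma> n a \<in> E j} \<in> sets (M n)"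
          unfolding M(2) by (intro continuous_vimage_borel E_borel continuous_intros \<gamma>)
        ultimately have "emeasure (M n) ((\<lambda>a. (a, X)) -` B) \<le> emeasure (M n) {a. z + \<gamma> n a \<in> E j}"
          by (rule emeasure_mono)
        then show "emeasure (M n) ((\<lambda>a. (a, X)) -` B) \<le> ennreal (e n)"
          using order_trans[OF _ small[of n z]] n by simp
      qed
      also have "\<dots> = ennreal (e n)" by (simp add: Q.emeasure_space_1)
      finally show ?thesis .
    qed
    have "emeasure P A \<le> ennreal r" if r: "0 < r" for r
    proof -
      obtain N where N: "e N < r" unfolding e_def using real_arch_pow_inv[OF r, of "1/2"] by auto
      have "e (prod_encode (j, N)) \<le> e N" unfolding e_def
        by (intro power_decreasing le_prod_encode_2) auto
      then have "ennreal (e (prod_encode (j, N))) \<le> ennreal r" using N by (intro ennreal_leI) simp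
      with le[of "prod_encode (j, N)"] show ?thesis by simp
    qed
    then have "emeasure P A \<le> 0" using ennreal_le_epsilon[of 0 "emeasure P A"] by simp
    then show ?thesis unfolding A_def by simp
  qed
  define \<mu> where "\<mu> = distr P borel T"
  have T_meas: "T \<in> measurable P borel"
    using borel_measurable_continuous_onI[OF cont_T] measurable_cong_sets[OF sets_P refl] by blast
  have E: "(\<Union>j. E j) \<in> sets borel" using E_borel by blast
  have "emeasure \<mu> ((\<lambda>y. x + y) ` (\<Union>j. E j)) = 0" for x
  proof -
    have img: "(\<lambda>y. x + y) ` (\<Union>j. E j) = {y. y - x \<in> (\<Union>j. E j)}"
    proof (intro equalityI subsetI)
      fix y assume "y \<in> {y. y - x \<in> (\<Union>j. E j)}"
      then show "y \<in> (\<lambda>y. x + y) ` (\<Union>j. E j)" by (intro image_eqI[of _ _ "y - x"]) simp_all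
    qed auto
    have "{y. y - x \<in> (\<Union>j. E j)} \<in> sets borel" by (intro continuous_vimage_borel E continuous_intros)
    then have "emeasure \<mu> ((\<lambda>y. x + y) ` (\<Union>j. E j)) = emeasure P (T -` {y. y - x \<in> (\<Union>j. E j)} \<inter> space P)"
      unfolding \<mu>_def img by (intro emeasure_distr T_meas)
    also have "T -` {y. y - x \<in> (\<Union>j. E j)} \<inter> space P = (\<Union>j. {\<omega>. T \<omega> - x \<in> E j})"
      unfolding space_P by auto
    also have "emeasure P \<dots> = 0"
      unfolding sets_P[symmetric]
      by (intro emeasure_UN_eq_0 zero)
        (auto simp: sets_P intro!: continuous_vimage_borel E_borel continuous_intros cont_T)
    finally show ?thesis .
  qed
  moreover have "prob_space \<mu>" unfolding \<mu>_def by (intro prob_space.prob_space_distr P T_meas)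
  ultimately show ?thesis unfolding haar_null_def using E by (auto simp: \<mu>_def)
qed

text \<open>
  Use a vector that is uniformly distributed on a short segment parallel to \<open>v\<close>.
\<close>

lemma thin_set_if_null_on_lines:
  fixes E :: "'a::real_normed_vector set"
  assumes E: "E \<in> sets borel" and null: "\<And>x. negligible {t::real. x + t *\<^sub>R v \<in> E}"
  shows "thin_set E"
  unfolding thin_set_def
proof (intro conjI E allI impI)
  fix \<epsilon> :: real assume \<epsilon>: "0 < \<epsilon>"
  \<comment> \<open>Adding \<open>1\<close> to the norm covers \<open>v = 0\<close>.\<close>
  define c where "c = \<epsilon> / (1 + norm v)"
  have pos: "0 < 1 + norm v" by (simp add: add_pos_nonneg)
  have c: "0 < c" "c * norm v \<le> \<epsilon>" unfolding c_def using \<epsilon> pos by (auto simp: field_simps)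
  define U where "U = uniform_measure lborel {0..c}"
  have U: "prob_space U" unfolding U_def using c by (intro prob_space_uniform_measure) auto
  have meas: "(\<lambda>t. (0::nat, t)) \<in> measurable U borel"
    unfolding U_def by (simp add: measurable_def vimage_def continuous_vimage_borel continuous_intros)
  define M where "M = distr U borel (\<lambda>t. (0::nat, t))"
  define \<gamma> where "\<gamma> a = max 0 (min c (snd a)) *\<^sub>R v" for a :: "nat \<times> real"
  have "prob_space M" unfolding M_def by (rule prob_space.prob_space_distr[OF U meas])
  moreover have "sets M = sets borel" unfolding M_def by simp
  moreover have cont: "continuous_on UNIV \<gamma>" unfolding \<gamma>_def by (intro continuous_intros)
  moreover have "norm (\<gamma> a) \<le> \<epsilon>" for a
  proof -
    have "norm (\<gamma> a) = max 0 (min c (snd a)) * norm v" unfolding \<gamma>_def by simp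
    also have "\<dots> \<le> c * norm v" using c by (intro mult_right_mono) auto
    finally show ?thesis using c by simp
  qed
  moreover have "emeasure M {a. x + \<gamma> a \<in> E} \<le> ennreal \<epsilon>" for x
  proof -
    obtain N where N: "N \<in> null_sets lborel" "{t::real. x + t *\<^sub>R v \<in> E} \<subseteq> N"
      using null[of x] unfolding negligible_iff_null_sets null_sets_completion_iff2 by blast
    have "{a. x + \<gamma> a \<in> E} \<in> sets borel" by (intro continuous_vimage_borel E continuous_intros cont)
    then have "emeasure M {a. x + \<gamma> a \<in> E} = emeasure U ((\<lambda>t. (0, t)) -` {a. x + \<gamma> a \<in> E} \<inter> space U)"
      unfolding M_def by (rule emeasure_distr[OF meas])
    also have "(\<lambda>t. (0, t)) -` {a. x + \<gamma> a \<in> E} \<inter> space U = {t. x + \<gamma> (0, t) \<in> E}"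
      unfolding U_def by auto
    also have "emeasure U {t. x + \<gamma> (0, t) \<in> E}
      = emeasure lborel ({0..c} \<inter> {t. x + \<gamma> (0, t) \<in> E}) / emeasure lborel {0..c}"
    proof -
      have "{t. x + \<gamma> (0, t) \<in> E} \<in> sets borel"
        unfolding \<gamma>_def by (intro continuous_vimage_borel E continuous_intros)
      then show ?thesis unfolding U_def by (intro emeasure_uniform_measure) auto
    qed
    also have "emeasure lborel ({0..c} \<inter> {t. x + \<gamma> (0, t) \<in> E}) = 0"
    proof -
    have "emeasure lborel ({0..c} \<inter> {t. x + \<gamma> (0, t) \<in> E}) \<le> emeasure lborel N"
      using N by (intro emeasure_mono) (auto simp: \<gamma>_def null_sets_def min_def max_def split: if_splits)
    then show ?thesis using N(1) by (simp add: null_sets_def)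
    qed
    finally show ?thesis by simp
  qed
  ultimately show "\<exists>(M :: (nat \<times> real) measure) \<gamma>. prob_space M \<and> sets M = sets borel \<and>
        continuous_on UNIV \<gamma> \<and> (\<forall>a. norm (\<gamma> a) \<le> \<epsilon>) \<and>
        (\<forall>x. emeasure M {a. x + \<gamma> a \<in> E} \<le> ennreal \<epsilon>)" by blast
qed

lemma thin_set_if_small_averages:
  fixes E :: "'a::real_normed_vector set"
  assumes E: "E \<in> sets borel"
    and small: "\<And>\<epsilon>. 0 < \<epsilon> \<Longrightarrow> \<exists>(\<mu>::nat pmf) y. (\<forall>n. norm (y n) \<le> \<epsilon>) \<and>
      (\<forall>x. emeasure (measure_pmf \<mu>) {n. x + y n \<in> E} \<le> ennreal \<epsilon>)"
  shows "thin_set E"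
  unfolding thin_set_def
proof (intro conjI E allI impI)
  fix \<epsilon> :: real assume "0 < \<epsilon>"
  then obtain \<mu> :: "nat pmf" and y where y: "\<And>n. norm (y n) \<le> \<epsilon>"
    "\<And>x. emeasure (measure_pmf \<mu>) {n. x + y n \<in> E} \<le> ennreal \<epsilon>" using small by blast
  have meas: "(\<lambda>n. (n, 0::real)) \<in> measurable (measure_pmf \<mu>) borel" by simp
  define M where "M = distr (measure_pmf \<mu>) borel (\<lambda>n. (n, 0::real))"
  have "prob_space M" unfolding M_def by (rule prob_space.prob_space_distr[OF prob_space_measure_pmf meas])
  moreover have "sets M = sets borel" unfolding M_def by simp
  moreover have cont: "continuous_on UNIV (\<lambda>a::nat \<times> real. y (fst a))"
    by (rule continuous_on_compose2[of UNIV y]) (auto intro: continuous_intros)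
  moreover have "emeasure M {a. x + y (fst a) \<in> E} \<le> ennreal \<epsilon>" for x
  proof -
    have "{a. x + y (fst a) \<in> E} \<in> sets (borel :: (nat \<times> real) measure)"
      by (intro continuous_vimage_borel E continuous_intros cont)
    then have "emeasure M {a. x + y (fst a) \<in> E} = emeasure (measure_pmf \<mu>) {n. x + y n \<in> E}"
      unfolding M_def using emeasure_distr[OF meas] by (simp add: vimage_def)
    then show ?thesis using y(2) by simp
  qed
  ultimately show "\<exists>(M :: (nat \<times> real) measure) \<gamma>. prob_space M \<and> sets M = sets borel \<and>
        continuous_on UNIV \<gamma> \<and> (\<forall>a. norm (\<gamma> a) \<le> \<epsilon>) \<and>
        (\<forall>x. emeasure M {a. x + \<gamma> a \<in> E} \<le> ennreal \<epsilon>)" using y(1) by blast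
qed

definition sigma_thin :: "'a::real_normed_vector set \<Rightarrow> bool" where
  "sigma_thin S \<longleftrightarrow> (\<exists>\<N>. countable \<N> \<and> (\<forall>N\<in>\<N>. thin_set N) \<and> S \<subseteq> \<Union>\<N>)"

lemma sigma_thin_if_thin_set: "thin_set E \<Longrightarrow> sigma_thin E"
  unfolding sigma_thin_def by (intro exI[of _ "{E}"]) simp

lemma sigma_thin_subset: "sigma_thin T \<Longrightarrow> S \<subseteq> T \<Longrightarrow> sigma_thin S"
  unfolding sigma_thin_def by (meson order_trans)

lemma sigma_thin_UN:
  assumes "countable I" "\<And>i. i \<in> I \<Longrightarrow> sigma_thin (S i)"
  shows "sigma_thin (\<Union>i\<in>I. S i)"
proof -
  have "\<forall>i\<in>I. \<exists>\<N>. countable \<N> \<and> (\<forall>N\<in>\<N>. thin_set N) \<and> S i \<subseteq> \<Union>\<N>"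
    using assms(2) unfolding sigma_thin_def by blast
  then obtain F where F: "\<forall>i\<in>I. countable (F i) \<and> (\<forall>N\<in>F i. thin_set N) \<and> S i \<subseteq> \<Union>(F i)"
    unfolding bchoice_iff by blast
  have "countable (\<Union>i\<in>I. F i)" using assms(1) F by blast
  moreover have "\<forall>N\<in>(\<Union>i\<in>I. F i). thin_set N" using F by blast
  moreover have "(\<Union>i\<in>I. S i) \<subseteq> \<Union>(\<Union>i\<in>I. F i)" using F by blast
  ultimately show ?thesis unfolding sigma_thin_def by blast
qed

lemma sigma_thin_Un: "sigma_thin S \<Longrightarrow> sigma_thin T \<Longrightarrow> sigma_thin (S \<union> T)"
  using sigma_thin_UN[of UNIV "\<lambda>b. if b then S else T"] by (simp add: UNIV_bool Un_commute)

lemma haar_null_cover_if_sigma_thin: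
  fixes S :: "'a::banach set"
  assumes "sigma_thin S"
  shows "\<exists>N. haar_null N \<and> S \<subseteq> N"
proof -
  obtain \<N> where \<N>: "countable \<N>" "\<And>N. N \<in> \<N> \<Longrightarrow> thin_set N" "S \<subseteq> \<Union>\<N>"
    using assms unfolding sigma_thin_def by blast
  have "thin_set ({} :: 'a set)" by (rule thin_set_if_null_on_lines) auto
  then have "thin_set (from_nat_into (insert {} \<N>) j)" for j
    using from_nat_into[of "insert {} \<N>" j] \<N>(2) by auto
  then have "haar_null (\<Union>j. from_nat_into (insert {} \<N>) j)" by (rule haar_null_UN_thin_sets)
  moreover have "(\<Union>j. from_nat_into (insert {} \<N>) j) = \<Union>\<N>"
    using range_from_nat_into[of "insert {} \<N>"] \<N>(1) by simp
  ultimately show ?thesis using \<N>(3) by metis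
qed

section \<open>Convex sets with empty interior\<close>

text \<open>
  If the differences of points of \<open>C\<close> leave out a direction \<open>v\<close>, every line parallel to \<open>v\<close>
  meets \<open>C\<close> at most once and the uniform distribution on many points of a short segment does it. Otherwise Ptak's lemma applies to an
  escaping sequence: an infinite set of indices all of whose finite parts occur would, by the intersection
  property of reflexive spaces, occur itself.
\<close>

lemma convex_empty_interior_small_translates:
  fixes C :: "'a::real_normed_vector set" and d :: "nat \<Rightarrow> 'a"
  assumes refl: "reflexive_space TYPE('a)"
    and C: "closed C" "convex C" "interior C = {}" "bounded C"
    and d: "\<And>x e. 0 < e \<Longrightarrow> \<exists>n. dist (d n) x < e" and r: "0 < r" and \<delta>: "0 < \<delta>"
  shows "\<exists>(\<mu>::nat pmf) y. (\<forall>n. norm (y n) \<le> r) \<and> (\<forall>x. emeasure (measure_pmf \<mu>) {n. x + y n \<in> C} \<le> ennreal \<delta>)"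
proof (cases "\<forall>v. \<exists>a>0. \<exists>c\<in>C. \<exists>c'\<in>C. v = a *\<^sub>R (c - c')")
  case True
  have "\<exists>y. (\<forall>n. norm (y n) \<le> r) \<and> (\<forall>x. finite {n::nat. x + y n \<in> C})"
    by (rule escaping_sequence[OF C(1-3) True[THEN spec] d r])
  then obtain y where y: "\<And>n. norm (y n) \<le> r" "\<And>x. finite {n::nat. x + y n \<in> C}"
    by blast
  define \<F> where "\<F> = range (\<lambda>x. {n. x + y n \<in> C})"
  have "\<exists>s\<subseteq>A. finite s \<and> (\<forall>I\<in>\<F>. \<not> s \<subseteq> I)" if A: "infinite A" for A
  proof (rule ccontr)
    assume not: "\<not> ?thesis"
    have ex: "\<exists>x. \<forall>n\<in>s. x + y n \<in> C" if s: "s \<subseteq> A" "finite s" for s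
    proof -
      obtain I where "I \<in> \<F>" "s \<subseteq> I" using not s by blast
      then show ?thesis unfolding \<F>_def by auto
    qed
    obtain m where m: "m \<in> A" using A by (metis all_not_in_conv finite.emptyI)
    \<comment> \<open>The index \<open>m\<close> already takes part in \<open>D 0\<close>, which makes \<open>D 0\<close> bounded.\<close>
    define D where "D k = (\<Inter>n\<in>A \<inter> {..m + k}. (\<lambda>c. c - y n) ` C)" for k
    have img: "x \<in> (\<lambda>c. c - y n) ` C \<longleftrightarrow> x + y n \<in> C" for x n
      by (auto intro!: image_eqI[of _ _ "x + y n"])
    have "(\<Inter>k. D k) \<noteq> {}"
    proof (rule reflexive_nested_Inter_nonempty[OF refl])
      fix k
      show "closed (D k)" unfolding D_def using closed_translation_subtract[OF C(1)] by auto
      show "convex (D k)" unfolding D_def using convex_translation_subtract[OF C(2)] by (auto intro: convex_INT)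
      obtain x where "\<forall>n\<in>A \<inter> {..m + k}. x + y n \<in> C" using ex[of "A \<inter> {..m + k}"] by auto
      then show "D k \<noteq> {}" unfolding D_def using img by blast
      show "decseq D" unfolding D_def decseq_def by auto
      have "D 0 \<subseteq> (\<lambda>c. c - y m) ` C" unfolding D_def using m by auto
      then show "bounded (D 0)" using bounded_translation_minus[OF C(4)] bounded_subset by blast
    qed
    then obtain x where x: "\<And>k. x \<in> D k" by blast
    have "x + y n \<in> C" if "n \<in> A" for n using x[of n] that unfolding D_def img[symmetric] by auto
    then have "A \<subseteq> {n. x + y n \<in> C}" by auto
    then show False using A y(2) finite_subset by blast
  qed
  from Ptak_averages[OF this \<delta>] obtain \<mu> :: "nat pmf" where "\<forall>I\<in>\<F>. emeasure (measure_pmf \<mu>) I \<le> ennreal \<delta>" by blast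
  then show ?thesis using y(1) unfolding \<F>_def by blast
next
  case False
  then obtain v where v: "\<And>a c c'. 0 < a \<Longrightarrow> c \<in> C \<Longrightarrow> c' \<in> C \<Longrightarrow> v \<noteq> a *\<^sub>R (c - c')" by blast
  obtain k :: nat where k: "1 / \<delta> < real k" using reals_Archimedean2 by blast
  have "0 < 1 / \<delta>" using \<delta> by simp
  then have k0: "0 < k" using k by linarith
  \<comment> \<open>The points \<open>y n\<close> below are multiples of \<open>v\<close> with distinct coefficients and norm at most \<open>r\<close>.\<close>
  define q where "q = r / (1 + norm v)"
  have pos: "0 < 1 + norm v" by (simp add: add_pos_nonneg)
  have q: "0 < q" "q * norm v \<le> r" unfolding q_def using r pos by (auto simp: field_simps)
  define y where "y n = (q / real (Suc n)) *\<^sub>R v" for n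
  have "norm (y n) \<le> r" for n
  proof -
    have "norm (y n) = q / real (Suc n) * norm v" unfolding y_def using q by simp
    also have "\<dots> \<le> q * norm v" using q(1) by (intro mult_right_mono) (auto simp: divide_le_eq algebra_simps)
    finally show ?thesis using q(2) by simp
  qed
  moreover have "emeasure (measure_pmf (pmf_of_set {..<k})) {n. x + y n \<in> C} \<le> ennreal \<delta>" for x
  proof -
    have "m = n" if "x + y m \<in> C" "x + y n \<in> C" for m n
    proof (rule ccontr)
      have *: False if "n < m" "x + y m \<in> C" "x + y n \<in> C" for m n
      proof -
        define b where "b = q / real (Suc n) - q / real (Suc m)"
        have b: "0 < b" unfolding b_def using \<open>n < m\<close> q(1) by (simp add: frac_less2)
        have "(x + y n) - (x + y m) = b *\<^sub>R v" unfolding y_def b_def by (simp add: scaleR_diff_left)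
        then have "v = (1 / b) *\<^sub>R ((x + y n) - (x + y m))" using b by simp
        with v[of "1 / b" "x + y n" "x + y m"] b that show False by simp
      qed
      assume "m \<noteq> n"
      then show False using *[of m n] *[of n m] that by (cases m n rule: linorder_cases) auto
    qed
    then have "is_singleton ({..<k} \<inter> {n. x + y n \<in> C}) \<or> {..<k} \<inter> {n. x + y n \<in> C} = {}"
      unfolding is_singleton_def by blast
    then have "card ({..<k} \<inter> {n. x + y n \<in> C}) \<le> 1" by (auto simp: is_singleton_altdef)
    then have "real (card ({..<k} \<inter> {n. x + y n \<in> C})) / real k \<le> 1 / real k" by (intro divide_right_mono) auto
    also have "\<dots> \<le> \<delta>" using k k0 \<delta> by (simp add: field_simps)
    finally show ?thesis using k0 by (subst emeasure_pmf_of_set) (auto simp: ennreal_leI lessThan_empty_iff)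
  qed
  ultimately show ?thesis by blast
qed

lemma dense_sequence:
  assumes "separable_space (euclidean :: 'a::metric_space topology)"
  shows "\<exists>d::nat \<Rightarrow> 'a. \<forall>x. \<forall>e>0. \<exists>n. dist (d n) x < e"
proof -
  obtain C :: "'a set" where C: "countable C" "closure C = UNIV"
    using assms unfolding separable_space_def by auto
  then have "C \<noteq> {}" by auto
  have "\<exists>n. dist (from_nat_into C n) x < e" if "0 < e" for x e
  proof -
    obtain c where "c \<in> C" "dist c x < e" using C(2) closure_approachable[of x C] \<open>0 < e\<close> by auto
    then show ?thesis using from_nat_into_surj[OF C(1)] by metis
  qed
  then show ?thesis by blast
qed

lemma sigma_thin_convex_empty_interior:
  fixes C :: "'a::real_normed_vector set" and d :: "nat \<Rightarrow> 'a"
  assumes refl: "reflexive_space TYPE('a)" and d: "\<And>x e. 0 < e \<Longrightarrow> \<exists>n. dist (d n) x < e"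
    and C: "closed C" "convex C" "interior C = {}"
  shows "sigma_thin C"
proof -
  have "sigma_thin (C \<inter> cball 0 (real n))" for n
  proof (intro sigma_thin_if_thin_set thin_set_if_small_averages)
    have cl: "closed (C \<inter> cball 0 (real n))" using C(1) by (intro closed_Int) auto
    then show "C \<inter> cball 0 (real n) \<in> sets borel" by simp
    have "convex (C \<inter> cball 0 (real n))" "interior (C \<inter> cball 0 (real n)) = {}" "bounded (C \<inter> cball 0 (real n))"
      using C(2,3) by (auto intro: convex_Int simp: interior_Int)
    from convex_empty_interior_small_translates[OF refl cl this d]
    show "\<exists>(\<mu>::nat pmf) y. (\<forall>m. norm (y m) \<le> \<epsilon>) \<and>
      (\<forall>x. emeasure (measure_pmf \<mu>) {m. x + y m \<in> C \<inter> cball 0 (real n)} \<le> ennreal \<epsilon>)" if "0 < \<epsilon>" for \<epsilon>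
      using that by blast
  qed
  then have "sigma_thin (\<Union>n. C \<inter> cball 0 (real n))" by (intro sigma_thin_UN) auto
  moreover have "C \<subseteq> (\<Union>n. C \<inter> cball 0 (real n))"
    using real_arch_simple by fastforce
  ultimately show ?thesis by (rule sigma_thin_subset)
qed

section \<open>Monotone and Lipschitz functions on the line\<close>

text \<open>
  For disjoint intervals, the open intervals between the values of \<open>h\<close> at their end points are
  disjoint too, and the increments are their lengths.
\<close>

lemma sum_mono_increments_le:
  fixes h :: "real \<Rightarrow> real" and C :: "(real \<times> real) set"
  assumes fin: "finite C" and h: "mono_on {a..b} h" and ab: "a \<le> b"
    and C: "\<And>t r. (t, r) \<in> C \<Longrightarrow> 0 < r \<and> a \<le> t - r \<and> t + r \<le> b"
    and disj: "pairwise (\<lambda>i j. disjnt (cball (fst i) (snd i)) (cball (fst j) (snd j))) C"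
  shows "(\<Sum>(t, r)\<in>C. h (t + r) - h (t - r)) \<le> h b - h a"
proof -
  define J where "J i = {h (fst i - snd i)<..<h (fst i + snd i)}" for i :: "real \<times> real"
  have hm: "h x \<le> h y" if "a \<le> x" "x \<le> y" "y \<le> b" for x y
    using h that by (intro mono_onD[OF h]) auto
  have "J i \<inter> J j = {}" if ij: "i \<in> C" "j \<in> C" "i \<noteq> j" for i j
  proof -
    obtain t r u s where eq: "i = (t, r)" "j = (u, s)" by (metis surj_pair)
    have b: "0 < r" "a \<le> t - r" "t + r \<le> b" "0 < s" "a \<le> u - s" "u + s \<le> b" using C ij eq by auto
    have d: "disjnt (cball t r) (cball u s)" using pairwiseD[OF disj ij] unfolding eq by simp
    have "t + r < u - s \<or> u + s < t - r"
    proof (rule ccontr)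
      assume "\<not> ?thesis"
      then have "max (t - r) (u - s) \<in> cball t r \<inter> cball u s" using b by (auto simp: dist_real_def)
      then show False using d by (auto simp: disjnt_def)
    qed
    then show ?thesis
    proof
      assume "t + r < u - s"
      then have "h (t + r) \<le> h (u - s)" using b by (intro hm) auto
      then show ?thesis unfolding J_def eq by auto
    next
      assume "u + s < t - r"
      then have "h (u + s) \<le> h (t - r)" using b by (intro hm) auto
      then show ?thesis unfolding J_def eq by auto
    qed
  qed
  then have dj: "disjoint_family_on J C" unfolding disjoint_family_on_def by blast
  have len: "emeasure lborel (J i) = ennreal (h (fst i + snd i) - h (fst i - snd i))"
    "measure lborel (J i) = h (fst i + snd i) - h (fst i - snd i)" if "i \<in> C" for i
  proof -
    have "h (fst i - snd i) \<le> h (fst i + snd i)" using C[of "fst i" "snd i"] that by (intro hm) auto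
    then show "emeasure lborel (J i) = ennreal (h (fst i + snd i) - h (fst i - snd i))"
      "measure lborel (J i) = h (fst i + snd i) - h (fst i - snd i)" unfolding J_def by simp_all
  qed
  have "(\<Sum>(t, r)\<in>C. h (t + r) - h (t - r)) = (\<Sum>i\<in>C. measure lborel (J i))"
    using len(2) by (intro sum.cong) auto
  also have "\<dots> = measure lborel (\<Union>i\<in>C. J i)"
    by (rule measure_finite_Union[symmetric, OF fin _ dj]) (auto simp: len(1), auto simp: J_def)
  also have "\<dots> \<le> measure lborel {h a..h b}"
  proof (rule measure_mono_fmeasurable)
    show "(\<Union>i\<in>C. J i) \<subseteq> {h a..h b}"
    proof
      fix y assume "y \<in> (\<Union>i\<in>C. J i)"
      then obtain t r where i: "(t, r) \<in> C" "h (t - r) < y" "y < h (t + r)" unfolding J_def by auto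
      have "h a \<le> h (t - r)" "h (t + r) \<le> h b" using C[OF i(1)] by (auto intro!: hm)
      then show "y \<in> {h a..h b}" using i by auto
    qed
    show "(\<Union>i\<in>C. J i) \<in> sets lborel" using fin unfolding J_def by auto
    show "{h a..h b} \<in> fmeasurable lborel" using hm[of a b] ab by (simp add: fmeasurable_def)
  qed
  also have "\<dots> = h b - h a" using hm[of a b] ab by simp
  finally show ?thesis .
qed

text \<open>
  At an exceptional point there are, for every \<open>l\<close>, symmetric intervals on which the increment exceeds \<open>l\<close> times the
  radius. By Vitali's lemma, disjoint intervals of this kind cover the exceptional
  set after enlargement by the factor 5, and the sum of their radii is at most the total increment divided by \<open>l\<close>.
\<close>

lemma mono_on_imp_pointwise_lipschitz_ae:
  fixes h :: "real \<Rightarrow> real"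
  assumes h: "mono_on {a..b} h"
  shows "negligible {t \<in> {a<..<b}. \<not> (\<exists>L. \<exists>\<delta>>0. \<forall>s. \<bar>s\<bar> < \<delta> \<longrightarrow> \<bar>h (t + s) - h t\<bar> \<le> L * \<bar>s\<bar>)}"
    (is "negligible ?S")
proof (cases "a < b")
  case False
  then show ?thesis by simp
next
  case ab: True
  have hm: "h x \<le> h y" if "a \<le> x" "x \<le> y" "y \<le> b" for x y
    using h that by (intro mono_onD[OF h]) auto
  define V where "V = h b - h a"
  have V: "0 \<le> V" unfolding V_def using hm[of a b] ab by simp
  show ?thesis unfolding negligible_outer_le
  proof (intro allI impI)
    fix e :: real assume e: "0 < e"
    \<comment> \<open>The enlarged intervals have total length at most \<open>10 * V / l\<close>; the summand \<open>1\<close> keeps \<open>l\<close> positive.\<close>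
    define l where "l = 10 * (V + 1) / e"
    have l: "0 < l" unfolding l_def using e V by simp
    define K where "K = {i::real \<times> real. 0 < snd i \<and> a \<le> fst i - snd i \<and> fst i + snd i \<le> b \<and>
      l * snd i < h (fst i + snd i) - h (fst i - snd i)}"
    have cover: "?S \<subseteq> (\<Union>i\<in>K. cball (fst i) (snd i))"
    proof
      fix t assume t: "t \<in> ?S"
      define \<delta> where "\<delta> = min (t - a) (b - t)"
      have \<delta>: "0 < \<delta>" unfolding \<delta>_def using t by auto
      obtain s where s: "\<bar>s\<bar> < \<delta>" "l * \<bar>s\<bar> < \<bar>h (t + s) - h t\<bar>"
        using t \<delta> by (force simp: not_le)
      have s0: "s \<noteq> 0" using s(2) by auto
      define r where "r = \<bar>s\<bar>"
      have r: "0 < r" "a \<le> t - r" "t + r \<le> b" using s s0 unfolding r_def \<delta>_def by auto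
      have "h (t - r) \<le> h t" "h t \<le> h (t + r)" using r by (auto intro!: hm)
      moreover have "s = r \<or> s = - r" unfolding r_def by auto
      ultimately have "\<bar>h (t + s) - h t\<bar> \<le> h (t + r) - h (t - r)" by (elim disjE) auto
      then have "(t, r) \<in> K" unfolding K_def using r s(2) by (simp add: r_def)
      then show "t \<in> (\<Union>i\<in>K. cball (fst i) (snd i))" using r by (intro UN_I[of "(t, r)"]) auto
    qed
    have rad: "0 < snd i \<and> snd i \<le> b - a" if "i \<in> K" for i using that unfolding K_def by auto
    obtain C where C: "countable C" "C \<subseteq> K"
      "pairwise (\<lambda>i j. disjnt (cball (fst i) (snd i)) (cball (fst j) (snd j))) C"
      "?S \<subseteq> (\<Union>i\<in>C. cball (fst i) (5 * snd i))"
      using Vitali_covering_lemma_cballs[where a = fst and r = snd, OF cover rad] by blast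
    have meas: "cball (fst i) (5 * snd i) \<in> lmeasurable" for i :: "real \<times> real" by simp
    have bound: "measure lebesgue (\<Union>i\<in>D. cball (fst i) (5 * snd i)) \<le> e" if D: "D \<subseteq> C" "finite D" for D
    proof -
      have DK: "0 < r \<and> a \<le> t - r \<and> t + r \<le> b \<and> l * r < h (t + r) - h (t - r)" if "(t, r) \<in> D" for t r
        using that D C(2) unfolding K_def by auto
      have "measure lebesgue (\<Union>i\<in>D. cball (fst i) (5 * snd i))
        \<le> (\<Sum>i\<in>D. measure lebesgue (cball (fst i) (5 * snd i)))"
        using D(2) by (intro measure_UNION_le) auto
      also have "\<dots> \<le> (\<Sum>(t, r)\<in>D. (10 / l) * (h (t + r) - h (t - r)))"
      proof (rule sum_mono)
        fix i assume i: "i \<in> D"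
        obtain t r where eq: "i = (t, r)" by (cases i)
        have r: "0 < r" "l * r < h (t + r) - h (t - r)" using DK i eq by auto
        have "measure lebesgue (cball t (5 * r)) = 10 * r"
          using r by (simp add: cball_eq_atLeastAtMost)
        also have "\<dots> \<le> (10 / l) * (h (t + r) - h (t - r))" using r l by (simp add: field_simps)
        finally show "measure lebesgue (cball (fst i) (5 * snd i)) \<le> (case i of (t, r) \<Rightarrow> (10 / l) * (h (t + r) - h (t - r)))"
          unfolding eq by simp
      qed
      also have "\<dots> = (10 / l) * (\<Sum>(t, r)\<in>D. h (t + r) - h (t - r))"
        by (simp add: sum_distrib_left split_beta)
      also have "\<dots> \<le> (10 / l) * V" unfolding V_def
        using DK ab l C(3) D pairwise_subset
        by (intro mult_left_mono sum_mono_increments_le[OF D(2) h]) auto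
      also have "\<dots> \<le> e" unfolding l_def using e V by (simp add: field_simps)
      finally show ?thesis .
    qed
    show "\<exists>T. ?S \<subseteq> T \<and> T \<in> lmeasurable \<and> measure lebesgue T \<le> e"
      using C(4) fmeasurable_UN_bound[OF C(1) meas bound] measure_UN_bound[OF C(1) meas bound] by blast
  qed
qed

text \<open>
  Lebesgue's differentiation theorem for intervals to the right of a point gives the right derivative. Applied to
  the reflection of \<open>k\<close>, it gives the left derivative.
\<close>

lemma has_real_derivative_ae_if_density:
  fixes F k :: "real \<Rightarrow> real"
  assumes F: "\<And>a b. a \<le> b \<Longrightarrow> (k has_integral F b - F a) {a..b}"
  shows "\<exists>N. negligible N \<and> (\<forall>t. t \<notin> N \<longrightarrow> (F has_real_derivative k t) (at t))"
proof -
  have int: "k integrable_on cbox a b" for a b :: real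
    using F[of a b] by (cases "a \<le> b") (auto simp: integrable_on_def)
  have int': "(\<lambda>x. k (- x)) integrable_on cbox a b" for a b :: real
    using integrable_reflect[where f = k and a = "- b" and b = "- a"] int[of "- b" "- a"] by simp
  obtain N1 where N1: "negligible N1" and d1: "\<And>x e. x \<notin> N1 \<Longrightarrow> 0 < e \<Longrightarrow>
    \<exists>d>0. \<forall>h. 0 < h \<and> h < d \<longrightarrow> norm (integral (cbox x (x + h *\<^sub>R One)) k /\<^sub>R h ^ DIM(real) - k x) < e"
    using integrable_ccontinuous_explicit[OF int] by blast
  obtain N2 where N2: "negligible N2" and d2: "\<And>x e. x \<notin> N2 \<Longrightarrow> 0 < e \<Longrightarrow>
    \<exists>d>0. \<forall>h. 0 < h \<and> h < d \<longrightarrow> norm (integral (cbox x (x + h *\<^sub>R One)) (\<lambda>x. k (- x)) /\<^sub>R h ^ DIM(real) - k (- x)) < e"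
    using integrable_ccontinuous_explicit[OF int'] by blast
  have right: "integral (cbox x (x + h *\<^sub>R One)) k = F (x + h) - F x" if "0 < h" for x h :: real
    using F[of x "x + h"] that by (simp add: integral_unique)
  have left: "integral (cbox x (x + h *\<^sub>R One)) (\<lambda>x. k (- x)) = F (- x) - F (- x - h)" if "0 < h" for x h :: real
  proof -
    have "((\<lambda>x. k (- x)) has_integral F (- x) - F (- x - h)) {- (- x)..- (- x - h)}"
      unfolding has_integral_reflect_real using F[of "- x - h" "- x"] that by simp
    then show ?thesis by (simp add: integral_unique add.commute)
  qed
  define N where "N = N1 \<union> uminus ` N2"
  have "negligible (uminus ` N2)"
  proof (rule negligible_locally_Lipschitz_image[OF _ N2])
    fix x :: real
    show "\<exists>T B. open T \<and> x \<in> T \<and> (\<forall>y\<in>N2 \<inter> T. norm (- y - - x) \<le> B * norm (y - x))"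
      by (intro exI[of _ UNIV] exI[of _ 1]) auto
  qed simp
  then have "negligible N" unfolding N_def using N1 by (simp add: negligible_Un)
  moreover have "(F has_real_derivative k t) (at t)" if t: "t \<notin> N" for t
    unfolding DERIV_def LIM_def
  proof (intro allI impI)
    fix e :: real assume e: "0 < e"
    have t1: "t \<notin> N1" and t2: "- t \<notin> N2" using t unfolding N_def by force+
    obtain p where p: "0 < p" "\<And>h. 0 < h \<Longrightarrow> h < p \<Longrightarrow> \<bar>(F (t + h) - F t) / h - k t\<bar> < e"
      using d1[OF t1 e] right by (auto simp: divide_inverse mult.commute)
    obtain q where q: "0 < q" "\<And>h. 0 < h \<Longrightarrow> h < q \<Longrightarrow> \<bar>(F t - F (t - h)) / h - k t\<bar> < e"
      using d2[OF t2 e] left[of _ "- t"] by (auto simp: divide_inverse mult.commute)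
    show "\<exists>s>0. \<forall>x::real. x \<noteq> 0 \<and> dist x 0 < s \<longrightarrow> dist ((F (t + x) - F t) / x) (k t) < e"
    proof (intro exI[of _ "min p q"] conjI allI impI)
      fix x :: real assume x: "x \<noteq> 0 \<and> dist x 0 < min p q"
      show "dist ((F (t + x) - F t) / x) (k t) < e"
      proof (cases "0 < x")
        case True
        then show ?thesis using p(2)[of x] x by (simp add: dist_real_def)
      next
        case False
        then have "\<bar>(F t - F (t - (- x))) / (- x) - k t\<bar> < e" using x by (intro q(2)) (auto simp: dist_real_def)
        also have "(F t - F (t - (- x))) / (- x) = (F (t + x) - F t) / x" using x by (simp add: field_simps)
        finally show ?thesis by (simp add: dist_real_def)
      qed
    qed (use p q in simp)
  qed
  ultimately show ?thesis by blast
qed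

text \<open>
  Adding a large multiple of the identity turns \<open>g\<close> into a homeomorphism \<open>F\<close> that is
  Lipschitz in both directions. The measure \<open>A \<mapsto> \<bar>F ` A\<bar>\<close> is then absolutely continuous, and
  its Radon-Nikodym density is the derivative of \<open>F\<close> almost everywhere.
\<close>

lemma lipschitz_real_differentiable_ae:
  fixes g :: "real \<Rightarrow> real"
  assumes lip: "\<And>s t. \<bar>g s - g t\<bar> \<le> L * \<bar>s - t\<bar>"
  shows "\<exists>N. negligible N \<and> (\<forall>t. t \<notin> N \<longrightarrow> (\<exists>D. (g has_real_derivative D) (at t)))"
proof -
  define l where "l = \<bar>L\<bar> + 1"
  have l: "0 < l" unfolding l_def by simp
  have lip': "\<bar>g s - g t\<bar> \<le> l * \<bar>s - t\<bar>" for s t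
  proof -
    have "L * \<bar>s - t\<bar> \<le> l * \<bar>s - t\<bar>" unfolding l_def by (intro mult_right_mono) auto
    then show ?thesis using lip[of s t] by simp
  qed
  \<comment> \<open>The slopes of \<open>F\<close> lie between \<open>l\<close> and \<open>3 * l\<close>.\<close>
  define F where "F t = g t + 2 * l * t" for t
  have lower: "l * (t - s) \<le> F t - F s" if "s \<le> t" for s t
    using lip'[of t s] that unfolding F_def by (simp add: algebra_simps abs_le_iff)
  have upper: "\<bar>F t - F s\<bar> \<le> 3 * l * \<bar>t - s\<bar>" for s t
  proof -
    have "\<bar>F t - F s\<bar> \<le> \<bar>g t - g s\<bar> + \<bar>2 * l * (t - s)\<bar>" unfolding F_def by (simp add: algebra_simps)
    also have "\<dots> \<le> l * \<bar>t - s\<bar> + 2 * l * \<bar>t - s\<bar>" using lip'[of t s] l by (simp add: abs_mult)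
    finally show ?thesis by (simp add: algebra_simps)
  qed
  have contF: "continuous_on UNIV F"
    by (rule lipschitz_on_continuous_on[of "3 * l"], rule lipschitz_onI) (use upper l in \<open>auto simp: dist_real_def\<close>)
  have smono: "F s < F t" if "s < t" for s t
      proof -
    have "0 < l * (t - s)" using that l by simp
    then show ?thesis using lower[of s t] that by simp
  qed
  have mono: "F s \<le> F t \<longleftrightarrow> s \<le> t" for s t
    using smono by (metis less_eq_real_def linorder_not_le)
  have inj: "inj F" using mono by (metis injI order_antisym order_refl)
  have "\<exists>t. F t = y" for y
  proof -
    define c where "c = \<bar>y - F 0\<bar> / l"
    have c: "0 \<le> c" "l * c = \<bar>y - F 0\<bar>" unfolding c_def using l by auto
    have "F (- c) \<le> y" "y \<le> F c" using lower[of "- c" 0] lower[of 0 c] c by auto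
    then show ?thesis
      using IVT'[of F "- c" y c] c continuous_on_subset[OF contF] by auto
  qed
  then have surj: "surj F" by (metis surjI)
  define G where "G = inv F"
  have FG: "F (G y) = y" for y unfolding G_def using surj by (rule surj_f_inv_f)
  have GF: "G (F t) = t" for t unfolding G_def using inj by (rule inv_f_f)
  have lipG: "\<bar>G y - G z\<bar> \<le> (1 / l) * \<bar>y - z\<bar>" for y z
    using lower[of "G y" "G z"] lower[of "G z" "G y"] l unfolding FG
    by (cases "G y \<le> G z") (auto simp: field_simps)
  have contG: "continuous_on UNIV G"
    by (rule lipschitz_on_continuous_on[of "1 / l"], rule lipschitz_onI) (use lipG l in \<open>auto simp: dist_real_def\<close>)
  have measG: "G \<in> measurable lborel borel"
    using borel_measurable_continuous_onI[OF contG] by simp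
  have vimage: "G -` A = F ` A" for A using FG GF by (auto intro!: image_eqI)
  define M where "M = distr lborel borel G"
  have "absolutely_continuous lborel M" unfolding absolutely_continuous_def
  proof
    fix A :: "real set" assume A: "A \<in> null_sets lborel"
    have "negligible A" unfolding negligible_iff_null_sets using A by (rule null_sets_completionI)
    then have "negligible (F ` A)"
    proof (rule negligible_locally_Lipschitz_image[rotated])
      fix x show "\<exists>T B. open T \<and> x \<in> T \<and> (\<forall>y\<in>A \<inter> T. norm (F y - F x) \<le> B * norm (y - x))"
        using upper by (intro exI[of _ UNIV] exI[of _ "3 * l"]) auto
    qed simp
    then have "F ` A \<in> null_sets (completion lborel)" unfolding negligible_iff_null_sets .
    moreover have "F ` A \<in> sets lborel"
      using measurable_sets[OF measG, of A] A unfolding vimage by (simp add: null_sets_def)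
    ultimately have "F ` A \<in> null_sets lborel" using null_sets_completion_iff by blast
    then show "A \<in> null_sets M" unfolding M_def
      using A measG by (simp add: null_sets_def emeasure_distr vimage)
  qed
  then obtain k where k: "k \<in> borel_measurable lborel" "density lborel k = M"
    using sigma_finite_measure.Radon_Nikodym[OF sigma_finite_lborel, of M] unfolding M_def by auto
  define r where "r x = enn2real (k x)" for x
  have "(r has_integral F b - F a) {a..b}" if ab: "a \<le> b" for a b
  proof -
    have "F ` {a..b} = {F a..F b}"
    proof (intro equalityI subsetI)
      fix y assume "y \<in> {F a..F b}"
      then have "F a \<le> F (G y)" "F (G y) \<le> F b" by (auto simp: FG)
      then have "G y \<in> {a..b}" unfolding mono by simp
      then show "y \<in> F ` {a..b}" using FG by (metis image_eqI)
    qed (auto simp: mono)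
    then have "emeasure M {a..b} = emeasure lborel {F a..F b}"
      unfolding M_def by (simp add: emeasure_distr[OF measG] vimage)
    also have "\<dots> = ennreal (F b - F a)" using ab mono by simp
    finally have I: "(\<integral>\<^sup>+x. k x * indicator {a..b} x \<partial>lborel) = ennreal (F b - F a)"
      using emeasure_density[OF k(1), of "{a..b}"] unfolding k(2) by simp
    have "AE x in lborel. k x * indicator {a..b} x \<noteq> \<infinity>"
      by (rule nn_integral_PInf_AE) (use k(1) I in auto)
    then have "AE x in lborel. ennreal (r x * indicator {a..b} x) = k x * indicator {a..b} x"
      by eventually_elim (auto simp: r_def indicator_def less_top)
    then have "(\<integral>\<^sup>+x. ennreal (r x * indicator {a..b} x) \<partial>lborel) = ennreal (F b - F a)"
      unfolding I[symmetric] by (rule nn_integral_cong_AE)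
    then have "((\<lambda>x. r x * indicator {a..b} x) has_integral F b - F a) UNIV"
      using k(1) ab mono by (intro nn_integral_has_integral) (auto simp: r_def)
    also have "(\<lambda>x. r x * indicator {a..b} x) = (\<lambda>x. if x \<in> {a..b} then r x else 0)"
      by (auto simp: indicator_def)
    finally show ?thesis unfolding has_integral_restrict_UNIV .
  qed
  from has_real_derivative_ae_if_density[OF this] obtain N where N: "negligible N"
    "\<And>t. t \<notin> N \<Longrightarrow> (F has_real_derivative r t) (at t)" by blast
  have "(g has_real_derivative (r t - 2 * l)) (at t)" if "t \<notin> N" for t
  proof -
    have "((\<lambda>x. F x - 2 * l * x) has_real_derivative (r t - 2 * l)) (at t)"
      by (rule derivative_eq_intros N that refl | simp)+
    then show ?thesis unfolding F_def by simp
  qed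
  with N(1) show ?thesis by blast
qed

section \<open>Lipschitz functions on separable spaces\<close>

definition diff_quot :: "('a::real_vector \<Rightarrow> real) \<Rightarrow> 'a \<Rightarrow> 'a \<Rightarrow> real \<Rightarrow> real" where
  "diff_quot f x h t = (f (x + t *\<^sub>R h) - f x) / t"

text \<open>
  Singletons are compact, so this contains Gateaux differentiability.
\<close>

definition has_hadamard_derivative :: "('a::real_normed_vector \<Rightarrow> real) \<Rightarrow> ('a \<Rightarrow>\<^sub>L real) \<Rightarrow> 'a \<Rightarrow> bool" where
  "has_hadamard_derivative f D x \<longleftrightarrow>
     (\<forall>K. compact K \<longrightarrow> uniform_limit K (\<lambda>t h. diff_quot f x h t) (blinfun_apply D) (at 0))"

lemma has_hadamard_derivative_tendsto:
  assumes "has_hadamard_derivative f D x"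
  shows "(diff_quot f x h \<longlongrightarrow> blinfun_apply D h) (at 0)"
proof -
  show ?thesis
    using assms[unfolded has_hadamard_derivative_def, rule_format, of "{h}"] by simp
qed

lemma hadamard_differentiableI:
  assumes "has_hadamard_derivative f D x"
  shows "hadamard_differentiable f x"
  using assms has_hadamard_derivative_tendsto[OF assms]
  unfolding hadamard_differentiable_def has_gateaux_derivative_def has_hadamard_derivative_def diff_quot_def
  by blast

lemma tendsto_at_0_if_Cauchy:
  fixes Q :: "real \<Rightarrow> real"
  assumes "\<And>e. 0 < e \<Longrightarrow> \<exists>\<delta>>0. \<forall>s t. s \<noteq> 0 \<longrightarrow> t \<noteq> 0 \<longrightarrow> \<bar>s\<bar> < \<delta> \<longrightarrow> \<bar>t\<bar> < \<delta> \<longrightarrow> \<bar>Q s - Q t\<bar> \<le> e"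
  shows "\<exists>l. (Q \<longlongrightarrow> l) (at 0)"
proof -
  define s where "s n = inverse (real (Suc n))" for n
  have s0: "s n \<noteq> 0" for n unfolding s_def by simp
  have s: "s \<longlonglongrightarrow> 0" unfolding s_def by (rule LIMSEQ_inverse_real_of_nat)
  have "Cauchy (\<lambda>n. Q (s n))"
  proof (rule metric_CauchyI)
    fix e :: real assume "0 < e"
    then obtain \<delta> where \<delta>: "\<delta> > 0" "\<And>s t. s \<noteq> 0 \<Longrightarrow> t \<noteq> 0 \<Longrightarrow> \<bar>s\<bar> < \<delta> \<Longrightarrow> \<bar>t\<bar> < \<delta> \<Longrightarrow> \<bar>Q s - Q t\<bar> \<le> e / 2"
      using assms[of "e / 2"] by auto
    obtain M where "\<And>n. n \<ge> M \<Longrightarrow> \<bar>s n\<bar> < \<delta>"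
      using LIMSEQ_D[OF s \<delta>(1)] by auto
    then have "\<bar>Q (s m) - Q (s n)\<bar> \<le> e / 2" if "M \<le> m" "M \<le> n" for m n
      using \<delta>(2)[OF s0 s0] that by blast
    then show "\<exists>M. \<forall>m\<ge>M. \<forall>n\<ge>M. dist (Q (s m)) (Q (s n)) < e"
      using \<open>0 < e\<close> unfolding dist_real_def by (intro exI[of _ M]) fastforce
  qed
  then obtain l where l: "(\<lambda>n. Q (s n)) \<longlonglongrightarrow> l" using Cauchy_convergent convergent_def by blast
  have "(Q \<longlongrightarrow> l) (at 0)" unfolding LIM_def
  proof (intro allI impI)
    fix e :: real assume "0 < e"
    then obtain \<delta> where \<delta>: "\<delta> > 0" "\<And>s t. s \<noteq> 0 \<Longrightarrow> t \<noteq> 0 \<Longrightarrow> \<bar>s\<bar> < \<delta> \<Longrightarrow> \<bar>t\<bar> < \<delta> \<Longrightarrow> \<bar>Q s - Q t\<bar> \<le> e / 2"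
      using assms[of "e / 2"] by auto
    have "\<bar>Q t - l\<bar> \<le> e / 2" if t: "t \<noteq> 0" "\<bar>t\<bar> < \<delta>" for t
    proof (rule LIMSEQ_le_const2)
      show "(\<lambda>n. \<bar>Q t - Q (s n)\<bar>) \<longlonglongrightarrow> \<bar>Q t - l\<bar>" using l by (intro tendsto_intros)
      obtain M where "\<And>n. n \<ge> M \<Longrightarrow> \<bar>s n\<bar> < \<delta>"
        using LIMSEQ_D[OF s \<delta>(1)] by auto
      then show "\<exists>N. \<forall>n\<ge>N. \<bar>Q t - Q (s n)\<bar> \<le> e / 2" using \<delta>(2)[OF t(1) s0 t(2)] by blast
    qed
    then show "\<exists>\<delta>>0. \<forall>t. t \<noteq> 0 \<and> dist t 0 < \<delta> \<longrightarrow> dist (Q t) l < e"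
      using \<delta>(1) \<open>0 < e\<close> by (intro exI[of _ \<delta>]) (fastforce simp: dist_real_def)
  qed
  then show ?thesis by blast
qed

lemma tendsto_at_0_imp_Cauchy:
  fixes Q :: "real \<Rightarrow> real"
  assumes "(Q \<longlongrightarrow> l) (at 0)" "0 < e"
  shows "\<exists>\<delta>>0. \<forall>s t. s \<noteq> 0 \<longrightarrow> t \<noteq> 0 \<longrightarrow> \<bar>s\<bar> < \<delta> \<longrightarrow> \<bar>t\<bar> < \<delta> \<longrightarrow> \<bar>Q s - Q t\<bar> \<le> e"
proof -
  obtain \<delta> where \<delta>: "0 < \<delta>" "\<And>t. t \<noteq> 0 \<Longrightarrow> \<bar>t\<bar> < \<delta> \<Longrightarrow> \<bar>Q t - l\<bar> < e / 2"
    using LIM_D[OF assms(1), of "e / 2"] assms(2) by auto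
  have "\<bar>Q s - Q t\<bar> \<le> e" if "s \<noteq> 0" "t \<noteq> 0" "\<bar>s\<bar> < \<delta>" "\<bar>t\<bar> < \<delta>" for s t
    using \<delta>(2)[of s] \<delta>(2)[of t] that by linarith
  with \<delta>(1) show ?thesis by blast
qed

lemma countable_separated_reals:
  fixes S :: "real set"
  assumes "0 < \<delta>" "\<And>s t. s \<in> S \<Longrightarrow> t \<in> S \<Longrightarrow> s < t \<Longrightarrow> \<delta> \<le> t - s"
  shows "countable S"
proof -
  have "inj_on (\<lambda>t. \<lfloor>t / \<delta>\<rfloor>) S"
  proof (rule linorder_inj_onI')
    fix s t assume st: "s \<in> S" "t \<in> S" "s < t"
    have "1 \<le> (t - s) / \<delta>" using assms(2)[OF st] assms(1) by (simp add: le_divide_eq)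
    then have "s / \<delta> + 1 \<le> t / \<delta>" by (simp add: diff_divide_distrib)
    then show "\<lfloor>s / \<delta>\<rfloor> \<noteq> \<lfloor>t / \<delta>\<rfloor>" by linarith
  qed
  then show ?thesis by (rule countable_image_inj_on[rotated]) simp
qed

context
  fixes u :: "'a::real_normed_vector \<Rightarrow> real" and L :: real
  assumes lip: "\<And>x y. \<bar>u x - u y\<bar> \<le> L * norm (x - y)" and L: "0 \<le> L"
begin

lemma continuous_on_lipschitz: "continuous_on S u"
  by (rule lipschitz_on_continuous_on[of L], rule lipschitz_onI) (use lip L in \<open>auto simp: dist_norm\<close>)

lemma continuous_on_lipschitz_compose: "continuous_on S g \<Longrightarrow> continuous_on S (\<lambda>x. u (g x))"
  by (rule continuous_on_compose2[OF continuous_on_lipschitz[of UNIV]]) auto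

lemma diff_quot_direction_lipschitz: "\<bar>diff_quot u x h t - diff_quot u x k t\<bar> \<le> L * norm (h - k)"
proof (cases "t = 0")
  case False
  have eq: "diff_quot u x h t - diff_quot u x k t = (u (x + t *\<^sub>R h) - u (x + t *\<^sub>R k)) / t"
    unfolding diff_quot_def by (simp add: diff_divide_distrib)
  have "\<bar>u (x + t *\<^sub>R h) - u (x + t *\<^sub>R k)\<bar> \<le> L * (\<bar>t\<bar> * norm (h - k))"
    using lip[of "x + t *\<^sub>R h" "x + t *\<^sub>R k"] by (simp flip: scaleR_diff_right)
  then show ?thesis unfolding eq abs_divide using False by (simp add: divide_le_eq mult_ac)
qed (simp add: diff_quot_def L)

text \<open>
  By continuity of \<open>u\<close> the Cauchy condition for the difference quotients describes a Borel set. On a line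
  of direction \<open>v\<close> the complement consists of the points where a Lipschitz function of one variable is not
  differentiable.
\<close>

lemma sigma_thin_no_directional_derivative:
  "sigma_thin {x. \<nexists>l. (diff_quot u x v \<longlongrightarrow> l) (at 0)}"
proof -
  define T where "T m = {t::real. t \<noteq> 0 \<and> \<bar>t\<bar> < 1 / real (Suc m)}" for m
  define A where "A n m = (\<Inter>s\<in>T m. \<Inter>t\<in>T m. {x. \<bar>diff_quot u x v s - diff_quot u x v t\<bar> \<le> 1 / real (Suc n)})" for n m
  define E where "E = {x. \<nexists>l. (diff_quot u x v \<longlongrightarrow> l) (at 0)}"
  have "closed (A n m)" for n m unfolding A_def diff_quot_def T_def
    by (intro closed_INT ballI closed_Collect_le continuous_intros continuous_on_lipschitz_compose) auto
  then have borel: "A n m \<in> sets borel" for n m by simp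
  have "E = UNIV - (\<Inter>n. \<Union>m. A n m)"
  proof -
    have "(\<exists>l. (diff_quot u x v \<longlongrightarrow> l) (at 0)) \<longleftrightarrow> x \<in> (\<Inter>n. \<Union>m. A n m)" for x
    proof
      assume "\<exists>l. (diff_quot u x v \<longlongrightarrow> l) (at 0)"
      then obtain l where l: "(diff_quot u x v \<longlongrightarrow> l) (at 0)" by blast
      show "x \<in> (\<Inter>n. \<Union>m. A n m)"
      proof
        fix n
        obtain \<delta> where \<delta>: "\<delta> > 0" "\<And>s t. s \<noteq> 0 \<Longrightarrow> t \<noteq> 0 \<Longrightarrow> \<bar>s\<bar> < \<delta> \<Longrightarrow> \<bar>t\<bar> < \<delta> \<Longrightarrow>
          \<bar>diff_quot u x v s - diff_quot u x v t\<bar> \<le> 1 / real (Suc n)"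
          using tendsto_at_0_imp_Cauchy[OF l, of "1 / real (Suc n)"] by auto
        obtain m where m: "1 / real (Suc m) < \<delta>" using nat_approx_posE[OF \<delta>(1)] by blast
        then have "x \<in> A n m" unfolding A_def T_def using \<delta>(2) by auto
        then show "x \<in> (\<Union>m. A n m)" by blast
      qed
    next
      assume x: "x \<in> (\<Inter>n. \<Union>m. A n m)"
      show "\<exists>l. (diff_quot u x v \<longlongrightarrow> l) (at 0)"
      proof (rule tendsto_at_0_if_Cauchy)
        fix e :: real assume "0 < e"
        then obtain n where n: "1 / real (Suc n) < e" using nat_approx_posE by blast
        obtain m where m: "x \<in> A n m" using x by blast
        have "\<bar>diff_quot u x v s - diff_quot u x v t\<bar> \<le> e"
          if "s \<noteq> 0" "t \<noteq> 0" "\<bar>s\<bar> < 1 / real (Suc m)" "\<bar>t\<bar> < 1 / real (Suc m)" for s t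
        proof -
          have "s \<in> T m" "t \<in> T m" unfolding T_def using that by auto
          then have "\<bar>diff_quot u x v s - diff_quot u x v t\<bar> \<le> 1 / real (Suc n)"
            using m unfolding A_def by blast
          with n show ?thesis by simp
        qed
        then show "\<exists>\<delta>>0. \<forall>s t. s \<noteq> 0 \<longrightarrow> t \<noteq> 0 \<longrightarrow> \<bar>s\<bar> < \<delta> \<longrightarrow> \<bar>t\<bar> < \<delta> \<longrightarrow>
          \<bar>diff_quot u x v s - diff_quot u x v t\<bar> \<le> e"
          by (intro exI[of _ "1 / real (Suc m)"]) auto
      qed
    qed
    then show ?thesis unfolding E_def by blast
  qed
  also have "\<dots> \<in> sets borel" using borel by (intro sets.Diff sets.countable_INT' sets.countable_UN') auto
  finally have "E \<in> sets borel" .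
  moreover have "negligible {t. x + t *\<^sub>R v \<in> E}" for x
  proof -
    define g where "g t = u (x + t *\<^sub>R v)" for t
    have "\<bar>g s - g t\<bar> \<le> (L * norm v) * \<bar>s - t\<bar>" for s t
      using lip[of "x + s *\<^sub>R v" "x + t *\<^sub>R v"] unfolding g_def
      by (simp flip: scaleR_diff_left add: mult_ac)
    from lipschitz_real_differentiable_ae[OF this] obtain N where N: "negligible N"
      "\<And>t. t \<notin> N \<Longrightarrow> \<exists>D. (g has_real_derivative D) (at t)" by blast
    have "t \<in> N" if t: "x + t *\<^sub>R v \<in> E" for t
    proof (rule ccontr)
      assume "t \<notin> N"
      then obtain D where D: "(g has_real_derivative D) (at t)" using N(2) by blast
      have "(\<lambda>h. (g (t + h) - g t) / h) = diff_quot u (x + t *\<^sub>R v) v"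
        unfolding g_def diff_quot_def by (auto simp: algebra_simps)
      with D have "(diff_quot u (x + t *\<^sub>R v) v \<longlongrightarrow> D) (at 0)" unfolding DERIV_def by simp
      with t show False unfolding E_def by blast
    qed
    then have "{t. x + t *\<^sub>R v \<in> E} \<subseteq> N" by auto
    then show ?thesis by (rule negligible_subset[OF N(1)])
  qed
  ultimately have "thin_set E" by (rule thin_set_if_null_on_lines)
  then show ?thesis unfolding E_def by (rule sigma_thin_if_thin_set)
qed

text \<open>
  If \<open>y\<close> and \<open>y + r v\<close> both belong to the set with \<open>0 < r < \<delta>\<close>, the increments of \<open>u\<close> from \<open>y\<close> to
  \<open>y + r v\<close> and on to \<open>y + r v + r w\<close> add up to the increment in direction \<open>v + w\<close>, contrary to the gap. So
  the points of the set on a line of direction \<open>v\<close> are at distance at least \<open>\<delta>\<close>.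
\<close>

lemma thin_set_almost_nonadditive:
  assumes gap: "\<bar>a + b - c\<bar> > 3 * e" and \<delta>: "0 < \<delta>"
  shows "thin_set {x. \<forall>t\<in>{0<..<\<delta>}. \<bar>diff_quot u x v t - a\<bar> \<le> e \<and> \<bar>diff_quot u x w t - b\<bar> \<le> e \<and>
    \<bar>diff_quot u x (v + w) t - c\<bar> \<le> e}" (is "thin_set ?E")
proof (rule thin_set_if_null_on_lines)
  have "?E = (\<Inter>t\<in>{0<..<\<delta>}. {x. \<bar>diff_quot u x v t - a\<bar> \<le> e} \<inter> {x. \<bar>diff_quot u x w t - b\<bar> \<le> e} \<inter>
    {x. \<bar>diff_quot u x (v + w) t - c\<bar> \<le> e})" by auto
  also have "closed \<dots>" unfolding diff_quot_def
    by (intro closed_INT ballI closed_Int closed_Collect_le continuous_intros continuous_on_lipschitz_compose) auto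
  finally show "?E \<in> sets borel" by simp
  fix x
  have "countable {t. x + t *\<^sub>R v \<in> ?E}"
  proof (rule countable_separated_reals[OF \<delta>], rule ccontr)
    fix s t assume s: "s \<in> {t. x + t *\<^sub>R v \<in> ?E}" and t: "t \<in> {t. x + t *\<^sub>R v \<in> ?E}"
      and st: "s < t" and close: "\<not> \<delta> \<le> t - s"
    define r where "r = t - s"
    define y where "y = x + s *\<^sub>R v"
    have r: "r \<in> {0<..<\<delta>}" unfolding r_def using st close by auto
    have yt: "x + t *\<^sub>R v = y + r *\<^sub>R v" unfolding y_def r_def by (simp add: algebra_simps)
    have 1: "\<bar>diff_quot u y v r - a\<bar> \<le> e" "\<bar>diff_quot u y (v + w) r - c\<bar> \<le> e"
      using s r unfolding y_def by auto
    have 2: "\<bar>diff_quot u (y + r *\<^sub>R v) w r - b\<bar> \<le> e" using t r yt by auto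
    have eq: "y + r *\<^sub>R v + r *\<^sub>R w = y + r *\<^sub>R (v + w)" by (simp add: algebra_simps)
    have "diff_quot u y v r + diff_quot u (y + r *\<^sub>R v) w r = diff_quot u y (v + w) r"
      unfolding diff_quot_def eq by (simp flip: add_divide_distrib)
    then show False using 1 2 gap by linarith
  qed
  then show "negligible {t. x + t *\<^sub>R v \<in> ?E}" 
    unfolding negligible_iff_null_sets by (intro null_sets_completionI countable_imp_null_set_lborel)
qed

lemma sigma_thin_nonadditive:
  "sigma_thin {x. \<exists>a b c. (diff_quot u x v \<longlongrightarrow> a) (at 0) \<and> (diff_quot u x w \<longlongrightarrow> b) (at 0) \<and>
     (diff_quot u x (v + w) \<longlongrightarrow> c) (at 0) \<and> c \<noteq> a + b}" (is "sigma_thin ?S")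
proof -
  define E where "E a b c e m = {x. \<forall>t\<in>{0<..<1 / real (Suc m)}. \<bar>diff_quot u x v t - a\<bar> \<le> e \<and>
    \<bar>diff_quot u x w t - b\<bar> \<le> e \<and> \<bar>diff_quot u x (v + w) t - c\<bar> \<le> e}" for a b c e m
  \<comment> \<open>Rational values suffice, which makes the covering family countable.\<close>
  define I where "I = {(a, b, c, e, m::nat). a \<in> \<rat> \<and> b \<in> \<rat> \<and> c \<in> \<rat> \<and> e \<in> \<rat> \<and> \<bar>a + b - c\<bar> > 3 * (e::real)}"
  have "I \<subseteq> \<rat> \<times> \<rat> \<times> \<rat> \<times> \<rat> \<times> UNIV" unfolding I_def by auto
  then have "countable I" by (rule countable_subset) (intro countable_SIGMA countable_rat countableI_type)
  then have "sigma_thin (\<Union>i\<in>I. case i of (a, b, c, e, m) \<Rightarrow> E a b c e m)"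
    by (rule sigma_thin_UN)
      (auto simp: I_def E_def intro!: sigma_thin_if_thin_set thin_set_almost_nonadditive)
  moreover have "?S \<subseteq> (\<Union>i\<in>I. case i of (a, b, c, e, m) \<Rightarrow> E a b c e m)"
  proof
    fix x assume "x \<in> ?S"
    then obtain a b c where lim: "(diff_quot u x v \<longlongrightarrow> a) (at 0)" "(diff_quot u x w \<longlongrightarrow> b) (at 0)"
      "(diff_quot u x (v + w) \<longlongrightarrow> c) (at 0)" and ne: "c \<noteq> a + b" by blast
    have "0 < \<bar>a + b - c\<bar> / 8" using ne by simp
    \<comment> \<open>The gap exceeds \<open>3 * e\<close> even after each of \<open>a\<close>, \<open>b\<close>, \<open>c\<close> is moved by \<open>e / 2\<close> to a rational number.\<close>
    then obtain e where e: "e \<in> \<rat>" "0 < e" "e < \<bar>a + b - c\<bar> / 8" using Rats_dense_in_real by blast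
    have near: "\<exists>r\<in>\<rat>. \<exists>m. \<forall>k\<ge>m. \<forall>t\<in>{0<..<1 / real (Suc k)}. \<bar>diff_quot u x h t - r\<bar> \<le> e \<and> \<bar>l - r\<bar> \<le> e / 2"
      if hl: "(diff_quot u x h \<longlongrightarrow> l) (at 0)" for h l
    proof -
      obtain r where r: "r \<in> \<rat>" "l < r" "r < l + e / 2" using Rats_dense_in_real[of l "l + e / 2"] e by auto
      obtain \<delta> where \<delta>: "0 < \<delta>" "\<And>t. t \<noteq> 0 \<Longrightarrow> \<bar>t\<bar> < \<delta> \<Longrightarrow> \<bar>diff_quot u x h t - l\<bar> < e / 2"
        using LIM_D[OF hl, of "e / 2"] e by auto
      obtain m where m: "1 / real (Suc m) < \<delta>" using nat_approx_posE[OF \<delta>(1)] by blast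
      have "\<bar>diff_quot u x h t - r\<bar> \<le> e" if "m \<le> k" "t \<in> {0<..<1 / real (Suc k)}" for k t
      proof -
        have "1 / real (Suc k) \<le> 1 / real (Suc m)" using that(1) by (simp add: frac_le)
        then have "t \<noteq> 0" "\<bar>t\<bar> < \<delta>" using that(2) m by auto
        from \<delta>(2)[OF this] show ?thesis using r by linarith
      qed
      with r show ?thesis by (intro bexI[of _ r] exI[of _ m]) auto
    qed
    obtain a' b' c' i j k where abc: "a' \<in> \<rat>" "b' \<in> \<rat>" "c' \<in> \<rat>"
      and i: "\<forall>k\<ge>i. \<forall>t\<in>{0<..<1 / real (Suc k)}. \<bar>diff_quot u x v t - a'\<bar> \<le> e \<and> \<bar>a - a'\<bar> \<le> e / 2"
      and j: "\<forall>k\<ge>j. \<forall>t\<in>{0<..<1 / real (Suc k)}. \<bar>diff_quot u x w t - b'\<bar> \<le> e \<and> \<bar>b - b'\<bar> \<le> e / 2"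
      and k: "\<forall>l\<ge>k. \<forall>t\<in>{0<..<1 / real (Suc l)}. \<bar>diff_quot u x (v + w) t - c'\<bar> \<le> e \<and> \<bar>c - c'\<bar> \<le> e / 2"
      using near[OF lim(1)] near[OF lim(2)] near[OF lim(3)] by blast
    define m where "m = max i (max j k)"
    have "i \<le> m" "j \<le> m" "k \<le> m" unfolding m_def by auto
    note at_m = i[rule_format, OF this(1)] j[rule_format, OF this(2)] k[rule_format, OF this(3)]
    have "1 / (2 * real (Suc m)) \<in> {0<..<1 / real (Suc m)}" by (simp add: field_simps)
    then have "\<bar>a - a'\<bar> \<le> e / 2" "\<bar>b - b'\<bar> \<le> e / 2" "\<bar>c - c'\<bar> \<le> e / 2"
      using at_m by blast+
    then have "\<bar>(a' + b' - c') - (a + b - c)\<bar> \<le> 3 * e / 2" unfolding abs_le_iff by linarith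
    then have close: "\<bar>a + b - c\<bar> - \<bar>a' + b' - c'\<bar> \<le> 3 * e / 2"
      using abs_triangle_ineq2[of "a + b - c" "a' + b' - c'"] by (simp only: abs_minus_commute)
    have "p - q \<le> 3 * e / 2 \<Longrightarrow> e < p / 8 \<Longrightarrow> 3 * e < q" for p q :: real using e(2) by linarith
    from this[OF close e(3)] have "3 * e < \<bar>a' + b' - c'\<bar>" .
    then have "(a', b', c', e, m) \<in> I" unfolding I_def using abc e(1) by simp
    moreover have "x \<in> E a' b' c' e m" unfolding E_def using at_m by blast
    ultimately show "x \<in> (\<Union>i\<in>I. case i of (a, b, c, e, m) \<Rightarrow> E a b c e m)" by (intro UN_I) auto
  qed
  ultimately show ?thesis by (rule sigma_thin_subset)
qed

text \<open>
  The difference quotients are \<open>L\<close>-Lipschitz in the direction, uniformly in \<open>t\<close>. So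
  existence and additivity pass from a dense set to all directions, and convergence at the points of a
  finite net gives uniform convergence on a compact set.
\<close>

lemma hadamard_derivative_if_additive_on_dense:
  fixes d :: "nat \<Rightarrow> 'a"
  assumes dense: "\<And>x e. 0 < e \<Longrightarrow> \<exists>n. dist (d n) x < e"
    and ex: "\<And>i. \<exists>l. (diff_quot u x (d i) \<longlongrightarrow> l) (at 0)"
    and add: "\<And>i j a b c. (diff_quot u x (d i) \<longlongrightarrow> a) (at 0) \<Longrightarrow> (diff_quot u x (d j) \<longlongrightarrow> b) (at 0) \<Longrightarrow>
      (diff_quot u x (d i + d j) \<longlongrightarrow> c) (at 0) \<Longrightarrow> c = a + b"
  shows "\<exists>D. has_hadamard_derivative u D x"
proof -
  define q where "q = diff_quot u x"
  have ql: "\<bar>q h t - q k t\<bar> \<le> L * norm (h - k)" for h k t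
    unfolding q_def by (rule diff_quot_direction_lipschitz)
  have approx: "\<exists>n. L * norm (h - d n) < e" if e: "0 < e" for h e
  proof -
    obtain n where n: "dist (d n) h < e / (L + 1)" using dense[of "e / (L + 1)" h] e L by auto
    have "L * norm (h - d n) \<le> (L + 1) * dist (d n) h"
      using L by (intro mult_mono) (auto simp: dist_norm norm_minus_commute)
    also have "\<dots> < e" using n L by (simp add: field_simps)
    finally show ?thesis by blast
  qed
  have "\<exists>l. (q h \<longlongrightarrow> l) (at 0)" for h
  proof (rule tendsto_at_0_if_Cauchy)
    fix e :: real assume e: "0 < e"
    obtain n where n: "L * norm (h - d n) < e / 3" using approx[of "e / 3" h] e by auto
    obtain l where l: "(q (d n) \<longlongrightarrow> l) (at 0)" using ex unfolding q_def by blast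
    obtain \<delta> where \<delta>: "0 < \<delta>" "\<And>s t. s \<noteq> 0 \<Longrightarrow> t \<noteq> 0 \<Longrightarrow> \<bar>s\<bar> < \<delta> \<Longrightarrow> \<bar>t\<bar> < \<delta> \<Longrightarrow> \<bar>q (d n) s - q (d n) t\<bar> \<le> e / 3"
      using tendsto_at_0_imp_Cauchy[OF l, of "e / 3"] e by auto
    have "\<bar>q h s - q h t\<bar> \<le> e" if "s \<noteq> 0" "t \<noteq> 0" "\<bar>s\<bar> < \<delta>" "\<bar>t\<bar> < \<delta>" for s t
      using \<delta>(2)[OF that] ql[of h s "d n"] ql[of h t "d n"] n by linarith
    with \<delta>(1) show "\<exists>\<delta>>0. \<forall>s t. s \<noteq> 0 \<longrightarrow> t \<noteq> 0 \<longrightarrow> \<bar>s\<bar> < \<delta> \<longrightarrow> \<bar>t\<bar> < \<delta> \<longrightarrow> \<bar>q h s - q h t\<bar> \<le> e" by blast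
  qed
  then obtain D where D: "\<And>h. (q h \<longlongrightarrow> D h) (at 0)" by metis
  have Dl: "\<bar>D h - D k\<bar> \<le> L * norm (h - k)" for h k
  proof (rule tendsto_upperbound)
    show "((\<lambda>t. \<bar>q h t - q k t\<bar>) \<longlongrightarrow> \<bar>D h - D k\<bar>) (at 0)" by (intro tendsto_intros D)
  qed (use ql in auto)
  have "linear D"
  proof (rule linearI)
    fix h k
    have "\<bar>D (h + k) - (D h + D k)\<bar> \<le> e" if e: "0 < e" for e
    proof -
      obtain i where i: "L * norm (h - d i) < e / 4" using approx[of "e / 4" h] e by auto
      obtain j where j: "L * norm (k - d j) < e / 4" using approx[of "e / 4" k] e by auto
      have a: "D (d i + d j) = D (d i) + D (d j)" using add D unfolding q_def by blast
      have "norm (h + k - (d i + d j)) \<le> norm (h - d i) + norm (k - d j)"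
        using norm_triangle_ineq[of "h - d i" "k - d j"] by (simp add: algebra_simps)
      then have "L * norm (h + k - (d i + d j)) \<le> L * norm (h - d i) + L * norm (k - d j)"
        using L by (metis distrib_left mult_left_mono)
      then show ?thesis
        using Dl[of "h + k" "d i + d j"] Dl[of h "d i"] Dl[of k "d j"] a i j by linarith
    qed
    then have "\<bar>D (h + k) - (D h + D k)\<bar> \<le> 0"
      using field_le_epsilon[of "\<bar>D (h + k) - (D h + D k)\<bar>" 0] by simp
    then show "D (h + k) = D h + D k" by simp
  next
    fix c :: real and h
    show "D (c *\<^sub>R h) = c *\<^sub>R D h"
    proof (cases "c = 0")
      case True
      have "(q 0 \<longlongrightarrow> 0) (at 0)" unfolding q_def diff_quot_def by simp
      then have "D 0 = 0" using D[of 0] LIM_unique by blast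
      then show ?thesis using True by simp
    next
      case False
      have "filterlim (\<lambda>t. c * t) (at 0) (at 0)"
        unfolding filterlim_at eventually_at_filter using False by (auto intro!: tendsto_eq_intros)
      then have "((\<lambda>t. q h (c * t)) \<longlongrightarrow> D h) (at 0)" by (rule filterlim_compose[OF D])
      then have "((\<lambda>t. c * q h (c * t)) \<longlongrightarrow> c * D h) (at 0)" by (rule tendsto_mult_left)
      also have "(\<lambda>t. c * q h (c * t)) = q (c *\<^sub>R h)"
        unfolding q_def diff_quot_def using False by (auto simp: mult.commute)
      finally show ?thesis using D[of "c *\<^sub>R h"] LIM_unique by fastforce
    qed
  qed
  moreover have "\<bar>D h\<bar> \<le> L * norm h" for h
    using Dl[of h 0] linear_0[OF \<open>linear D\<close>] by simp
  ultimately have "bounded_linear D"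
    by (intro bounded_linear_intro[where K = L]) (auto simp: linear_add linear_scale mult.commute)
  then have BD: "blinfun_apply (Blinfun D) = D" by (rule bounded_linear_Blinfun_apply)
  have "has_hadamard_derivative u (Blinfun D) x"
    unfolding has_hadamard_derivative_def BD q_def[symmetric]
  proof (intro allI impI uniform_limitI)
    fix K :: "'a set" and e :: real assume K: "compact K" and e: "0 < e"
    \<comment> \<open>Passing to the nearest net point changes difference quotient and derivative by at most \<open>e / 4\<close> each.\<close>
    define r where "r = e / (4 * (L + 1))"
    have r: "0 < r" "L * r \<le> e / 4" unfolding r_def using e L by (auto simp: field_simps)
    obtain F where F: "finite F" "F \<subseteq> K" "K \<subseteq> (\<Union>k\<in>F. ball k r)"
      using seq_compact_imp_totally_bounded[OF compact_imp_seq_compact[OF K], rule_format, OF r(1)] by auto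
    have "\<forall>\<^sub>F t in at 0. \<forall>k\<in>F. dist (q k t) (D k) < e / 4"
      using F(1) tendstoD[OF D, of "e / 4"] e by (simp add: eventually_ball_finite_distrib)
    then show "\<forall>\<^sub>F t in at 0. \<forall>h\<in>K. dist (q h t) (D h) < e"
    proof eventually_elim
      case (elim t)
      show ?case
      proof
        fix h assume "h \<in> K"
        then obtain k where k: "k \<in> F" "dist k h < r" using F(3) by auto
        have "L * norm (h - k) \<le> L * r" using k(2) L
          by (intro mult_left_mono) (auto simp: dist_norm norm_minus_commute)
        moreover have "\<bar>q k t - D k\<bar> < e / 4" using elim k(1) by (simp add: dist_real_def)
        ultimately show "dist (q h t) (D h) < e"
          using ql[of h t k] Dl[of h k] r(2) e unfolding dist_real_def by linarith
      qed
    qed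
  qed
  then show ?thesis by blast
qed

theorem lipschitz_hadamard_differentiable_off_sigma_thin:
  fixes d :: "nat \<Rightarrow> 'a"
  assumes dense: "\<And>x e. 0 < e \<Longrightarrow> \<exists>n. dist (d n) x < e"
  shows "sigma_thin {x. \<nexists>D. has_hadamard_derivative u D x}"
proof -
  define E where "E v = {x. \<nexists>l. (diff_quot u x v \<longlongrightarrow> l) (at 0)}" for v
  define N where "N v w = {x. \<exists>a b c. (diff_quot u x v \<longlongrightarrow> a) (at 0) \<and> (diff_quot u x w \<longlongrightarrow> b) (at 0) \<and>
     (diff_quot u x (v + w) \<longlongrightarrow> c) (at 0) \<and> c \<noteq> a + b}" for v w
  have "sigma_thin ((\<Union>i. E (d i)) \<union> (\<Union>i. \<Union>j. N (d i) (d j)))"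
    unfolding E_def N_def
    by (intro sigma_thin_Un sigma_thin_UN sigma_thin_no_directional_derivative sigma_thin_nonadditive) auto
  moreover have "{x. \<nexists>D. has_hadamard_derivative u D x} \<subseteq> (\<Union>i. E (d i)) \<union> (\<Union>i. \<Union>j. N (d i) (d j))"
  proof (rule subsetI, rule ccontr)
    fix x assume x: "x \<in> {x. \<nexists>D. has_hadamard_derivative u D x}"
      and no: "x \<notin> (\<Union>i. E (d i)) \<union> (\<Union>i. \<Union>j. N (d i) (d j))"
    have "\<exists>D. has_hadamard_derivative u D x"
      by (rule hadamard_derivative_if_additive_on_dense[OF dense]) (use no in \<open>auto simp: E_def N_def\<close>)
    with x show False by blast
  qed
  ultimately show ?thesis by (rule sigma_thin_subset)
qed

end

section \<open>Points of pointwise Lipschitz continuity\<close>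

definition pointwise_lipschitz :: "('a::real_normed_vector \<Rightarrow> real) \<Rightarrow> 'a \<Rightarrow> bool" where
  "pointwise_lipschitz f x \<longleftrightarrow>
     (\<exists>L. \<exists>\<delta>>0. \<forall>w. norm w < \<delta> \<longrightarrow> \<bar>f (x + w) - f x\<bar> \<le> L * norm w)"

definition lipschitz_at_on :: "real \<Rightarrow> 'a::real_normed_vector set \<Rightarrow> ('a \<Rightarrow> real) \<Rightarrow> 'a \<Rightarrow> bool" where
  "lipschitz_at_on n B f x \<longleftrightarrow> x \<in> B \<and> (\<forall>z\<in>B. \<bar>f z - f x\<bar> \<le> n * norm (z - x))"

text \<open>
  The largest function with Lipschitz constant \<open>n\<close> that is below \<open>f\<close> on \<open>B\<close>; it is
  finite as soon as \<open>f\<close> is Lipschitz at one point relative to \<open>B\<close>.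
\<close>

definition lower_envelope :: "real \<Rightarrow> 'a::real_normed_vector set \<Rightarrow> ('a \<Rightarrow> real) \<Rightarrow> 'a \<Rightarrow> real" where
  "lower_envelope n B f y = (INF z\<in>B. f z + n * norm (y - z))"

definition upper_envelope :: "real \<Rightarrow> 'a::real_normed_vector set \<Rightarrow> ('a \<Rightarrow> real) \<Rightarrow> 'a \<Rightarrow> real" where
  "upper_envelope n B f y = - lower_envelope n B (\<lambda>z. - f z) y"

lemma lower_envelope_properties:
  assumes x: "lipschitz_at_on n B f x" and n: "0 \<le> n"
  shows "\<bar>lower_envelope n B f y - lower_envelope n B f y'\<bar> \<le> n * norm (y - y')"
    and "y \<in> B \<Longrightarrow> lower_envelope n B f y \<le> f y"
    and "lower_envelope n B f x = f x"
proof -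
  have xB: "x \<in> B" and lip: "\<And>z. z \<in> B \<Longrightarrow> \<bar>f z - f x\<bar> \<le> n * norm (z - x)"
    using x unfolding lipschitz_at_on_def by auto
  have tri: "n * norm (y - z) \<le> n * norm (y - y') + n * norm (y' - z)" for y y' z :: 'a
    using norm_triangle_ineq[of "y - y'" "y' - z"] n by (simp flip: distrib_left add: mult_left_mono)
  have lb: "f x - n * norm (y - x) \<le> f z + n * norm (y - z)" if "z \<in> B" for y z
    using lip[OF that] tri[of z x y] by (simp add: norm_minus_commute)
  have low: "lower_envelope n B f y \<le> f z + n * norm (y - z)" if "z \<in> B" for y z
    unfolding lower_envelope_def using lb that
    by (intro cINF_lower bdd_belowI2[where m = "f x - n * norm (y - x)"]) auto
  have great: "c \<le> lower_envelope n B f y" if "\<And>z. z \<in> B \<Longrightarrow> c \<le> f z + n * norm (y - z)" for y c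
    unfolding lower_envelope_def using that xB by (intro cINF_greatest) auto
  have half: "lower_envelope n B f y - n * norm (y - y') \<le> lower_envelope n B f y'" for y y'
  proof (rule great)
    fix z assume "z \<in> B"
    then show "lower_envelope n B f y - n * norm (y - y') \<le> f z + n * norm (y' - z)"
      using low[of z y] tri[of y z y'] by simp
  qed
  show "\<bar>lower_envelope n B f y - lower_envelope n B f y'\<bar> \<le> n * norm (y - y')"
    using half[of y y'] half[of y' y] by (simp add: abs_le_iff norm_minus_commute)
  show "y \<in> B \<Longrightarrow> lower_envelope n B f y \<le> f y" using low[of y y] by simp
  have "f x \<le> lower_envelope n B f x" using lb[of _ x] by (intro great) simp
  then show "lower_envelope n B f x = f x" using low[OF xB, of x] by simp
qed

lemma upper_envelope_properties:
  assumes x: "lipschitz_at_on n B f x" and n: "0 \<le> n"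
  shows "\<bar>upper_envelope n B f y - upper_envelope n B f y'\<bar> \<le> n * norm (y - y')"
    and "y \<in> B \<Longrightarrow> f y \<le> upper_envelope n B f y"
    and "upper_envelope n B f x = f x"
proof -
  have "lipschitz_at_on n B (\<lambda>z. - f z) x"
    using x unfolding lipschitz_at_on_def by (simp add: abs_minus_commute)
  note * = lower_envelope_properties[OF this n]
  show "\<bar>upper_envelope n B f y - upper_envelope n B f y'\<bar> \<le> n * norm (y - y')"
    using *(1)[of y' y] unfolding upper_envelope_def by (simp add: norm_minus_commute)
  show "y \<in> B \<Longrightarrow> f y \<le> upper_envelope n B f y" using *(2)[of y] unfolding upper_envelope_def by simp
  show "upper_envelope n B f x = f x" using *(3) unfolding upper_envelope_def by simp
qed

text \<open>
  The nonnegative function \<open>v - u\<close> vanishes at \<open>x\<close>, so the two derivatives agree, and each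
  difference quotient of \<open>f\<close> lies between those of \<open>u\<close> and \<open>v\<close>.
\<close>

lemma hadamard_derivative_sandwich:
  assumes u: "has_hadamard_derivative u D x" and v: "has_hadamard_derivative v D' x"
    and B: "open B" "x \<in> B" and between: "\<And>y. y \<in> B \<Longrightarrow> u y \<le> f y \<and> f y \<le> v y"
    and touch: "u x = f x" "v x = f x"
  shows "has_hadamard_derivative f D x"
proof -
  obtain r where r: "0 < r" "ball x r \<subseteq> B" using B openE by blast
  have inB: "x + t *\<^sub>R h \<in> B" if "\<bar>t\<bar> * norm h < r" for t h
    using that r(2) by (auto simp: dist_norm subset_iff)
  have le: "blinfun_apply D h \<le> blinfun_apply D' h" for h
  proof (rule tendsto_le)
    show "(diff_quot v x h \<longlongrightarrow> blinfun_apply D' h) (at_right 0)"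
      by (rule tendsto_within_subset[OF has_hadamard_derivative_tendsto[OF v]]) simp
    show "(diff_quot u x h \<longlongrightarrow> blinfun_apply D h) (at_right 0)"
      by (rule tendsto_within_subset[OF has_hadamard_derivative_tendsto[OF u]]) simp
    have pos: "0 < 1 + norm h" by (simp add: add_pos_nonneg)
    have "\<forall>\<^sub>F t in at_right 0. 0 < t \<and> t < r / (1 + norm h)"
      using r pos by (intro eventually_at_rightI[of 0 "r / (1 + norm h)"]) auto
    then show "\<forall>\<^sub>F t in at_right 0. diff_quot u x h t \<le> diff_quot v x h t"
    proof eventually_elim
      case (elim t)
      have "t * norm h \<le> t * (1 + norm h)" using elim by simp
      also have "\<dots> < r" using elim pos by (simp add: field_simps)
      finally have "x + t *\<^sub>R h \<in> B" using elim by (intro inB) simp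
      then have "u (x + t *\<^sub>R h) \<le> v (x + t *\<^sub>R h)" using between by (meson order_trans)
      then show ?case unfolding diff_quot_def using elim touch by (intro divide_right_mono) auto
    qed
  qed simp
  have eq: "blinfun_apply D' = blinfun_apply D"
    using le le[of "- h" for h] by (intro ext antisym) (auto simp: blinfun.minus_right)
  show ?thesis unfolding has_hadamard_derivative_def
  proof (intro allI impI uniform_limitI)
    fix K :: "'a set" and e :: real assume K: "compact K" and e: "0 < e"
    obtain R where R: "0 < R" "\<And>h. h \<in> K \<Longrightarrow> norm h \<le> R"
      using compact_imp_bounded[OF K] unfolding bounded_pos by auto
    have "\<forall>\<^sub>F t in at 0. \<bar>t\<bar> * R < r"
      unfolding eventually_at using r R by (intro exI[of _ "r / R"]) (auto simp: field_simps)
    moreover have "\<forall>\<^sub>F t in at 0. \<forall>h\<in>K. dist (diff_quot u x h t) (blinfun_apply D h) < e"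
      using u K e unfolding has_hadamard_derivative_def by (intro uniform_limitD) auto
    moreover have "\<forall>\<^sub>F t in at 0. \<forall>h\<in>K. dist (diff_quot v x h t) (blinfun_apply D h) < e"
      using v K e unfolding has_hadamard_derivative_def eq by (intro uniform_limitD) auto
    ultimately show "\<forall>\<^sub>F t in at 0. \<forall>h\<in>K. dist (diff_quot f x h t) (blinfun_apply D h) < e"
    proof eventually_elim
      case (elim t)
      show ?case
      proof
        fix h assume h: "h \<in> K"
        have "\<bar>t\<bar> * norm h \<le> \<bar>t\<bar> * R" using R(2)[OF h] by (intro mult_left_mono) auto
        then have "x + t *\<^sub>R h \<in> B" using elim by (intro inB) simp
        from between[OF this] have b: "u (x + t *\<^sub>R h) - u x \<le> f (x + t *\<^sub>R h) - f x"
          "f (x + t *\<^sub>R h) - f x \<le> v (x + t *\<^sub>R h) - v x" using touch by auto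
        have "(diff_quot u x h t \<le> diff_quot f x h t \<and> diff_quot f x h t \<le> diff_quot v x h t) \<or>
          (diff_quot v x h t \<le> diff_quot f x h t \<and> diff_quot f x h t \<le> diff_quot u x h t)"
          unfolding diff_quot_def using b
          by (cases "0 \<le> t") (auto intro: divide_right_mono divide_right_mono_neg)
        then show "dist (diff_quot f x h t) (blinfun_apply D h) < e"
          using elim(2,3) h unfolding dist_real_def by (smt (verit, best))
      qed
    qed
  qed
qed

text \<open>
  \<open>G\<close> is the set of points at which the two envelopes for one of
  countably many balls and integers \<open>n\<close> agree. As the envelopes are continuous, \<open>G\<close> is Borel without any
  measurability of \<open>f\<close>.
\<close>

theorem stepanov_haar:
  fixes f :: "'a::real_normed_vector \<Rightarrow> real" and d :: "nat \<Rightarrow> 'a"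
  assumes dense: "\<And>x e. 0 < e \<Longrightarrow> \<exists>n. dist (d n) x < e"
  shows "\<exists>G. G \<in> sets borel \<and> (\<forall>x. pointwise_lipschitz f x \<longrightarrow> x \<in> G) \<and>
    sigma_thin {x \<in> G. \<not> hadamard_differentiable f x}"
proof -
  define B where "B k j = ball (d k) (1 / real (Suc j))" for k j
  define P where "P = {(k, j, n). \<exists>x. lipschitz_at_on (real n) (B k j) f x}"
  define lo where "lo i = (case i of (k, j, n) \<Rightarrow> lower_envelope (real n) (B k j) f)" for i :: "nat \<times> nat \<times> nat"
  define up where "up i = (case i of (k, j, n) \<Rightarrow> upper_envelope (real n) (B k j) f)" for i :: "nat \<times> nat \<times> nat"
  define BB where "BB i = (case i of (k, j, n) \<Rightarrow> B k j)" for i :: "nat \<times> nat \<times> nat"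
  have env: "\<exists>L\<ge>0. (\<forall>y y'. \<bar>lo i y - lo i y'\<bar> \<le> L * norm (y - y')) \<and> (\<forall>y y'. \<bar>up i y - up i y'\<bar> \<le> L * norm (y - y'))"
    and sand: "\<And>y. y \<in> BB i \<Longrightarrow> lo i y \<le> f y \<and> f y \<le> up i y" if iP: "i \<in> P" for i
  proof -
    obtain k j n x where i: "i = (k, j, n)" "lipschitz_at_on (real n) (B k j) f x"
      using iP unfolding P_def by blast
    note lo = lower_envelope_properties[OF i(2) of_nat_0_le_iff]
    note up = upper_envelope_properties[OF i(2) of_nat_0_le_iff]
    show "\<exists>L\<ge>0. (\<forall>y y'. \<bar>lo i y - lo i y'\<bar> \<le> L * norm (y - y')) \<and> (\<forall>y y'. \<bar>up i y - up i y'\<bar> \<le> L * norm (y - y'))"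
      unfolding lo_def up_def i(1) using lo(1) up(1) by (intro exI[of _ "real n"]) auto
    show "lo i y \<le> f y \<and> f y \<le> up i y" if "y \<in> BB i" for y
      using that lo(2) up(2) unfolding lo_def up_def i(1) BB_def by auto
  qed
  have opn: "open (BB i)" for i unfolding BB_def B_def by (auto split: prod.split)
  define G where "G = (\<Union>i\<in>P. {x \<in> BB i. lo i x = up i x})"
  have "{x \<in> BB i. lo i x = up i x} \<in> sets borel" if iP: "i \<in> P" for i
  proof -
    obtain L where L: "0 \<le> L" "\<And>y y'. \<bar>lo i y - lo i y'\<bar> \<le> L * norm (y - y')"
      "\<And>y y'. \<bar>up i y - up i y'\<bar> \<le> L * norm (y - y')" using env[OF iP] by blast
    have "closed {x. lo i x = up i x}"
      by (intro closed_Collect_eq continuous_on_lipschitz[of _ L] L)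
    then have "{x. lo i x = up i x} \<in> sets borel" by simp
    moreover have "BB i \<in> sets borel" using opn by simp
    ultimately have "BB i \<inter> {x. lo i x = up i x} \<in> sets borel" by blast
    then show ?thesis by (simp add: Collect_conj_eq)
  qed
  then have "G \<in> sets borel" unfolding G_def by (intro sets.countable_UN') auto
  moreover have "x \<in> G" if pl: "pointwise_lipschitz f x" for x
  proof -
    obtain L \<delta> where L: "0 < \<delta>" "\<And>w. norm w < \<delta> \<Longrightarrow> \<bar>f (x + w) - f x\<bar> \<le> L * norm w"
      using pl unfolding pointwise_lipschitz_def by blast
    obtain j where j: "1 / real (Suc j) < \<delta> / 2" using nat_approx_posE[of "\<delta> / 2"] L(1) by auto
    obtain k where k: "dist (d k) x < 1 / real (Suc j)" using dense[of "1 / real (Suc j)" x] by auto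
    obtain n :: nat where n: "L \<le> real n" using real_arch_simple by blast
    have "lipschitz_at_on (real n) (B k j) f x" unfolding lipschitz_at_on_def
    proof (intro conjI ballI)
      show "x \<in> B k j" unfolding B_def using k by simp
      fix z assume "z \<in> B k j"
      then have "norm (z - x) < \<delta>"
        using dist_triangle3[of z x "d k"] k j unfolding B_def by (simp add: dist_norm)
      then have "\<bar>f z - f x\<bar> \<le> L * norm (z - x)" using L(2)[of "z - x"] by simp
      also have "\<dots> \<le> real n * norm (z - x)" using n by (intro mult_right_mono) auto
      finally show "\<bar>f z - f x\<bar> \<le> real n * norm (z - x)" .
    qed
    note lip = this
    have "(k, j, n) \<in> P" unfolding P_def using lip by blast
    moreover have "x \<in> BB (k, j, n)" unfolding BB_def using lip unfolding lipschitz_at_on_def by simp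
    moreover have "lo (k, j, n) x = up (k, j, n) x" unfolding lo_def up_def
      using lower_envelope_properties(3)[OF lip] upper_envelope_properties(3)[OF lip] by simp
    ultimately show ?thesis unfolding G_def by blast
  qed
  moreover have "sigma_thin {x \<in> G. \<not> hadamard_differentiable f x}"
  proof (rule sigma_thin_subset)
    show "sigma_thin (\<Union>i\<in>P. {x. \<nexists>D. has_hadamard_derivative (lo i) D x} \<union> {x. \<nexists>D. has_hadamard_derivative (up i) D x})"
    proof (intro sigma_thin_UN sigma_thin_Un)
      fix i assume "i \<in> P"
      then obtain L where L: "0 \<le> L" "\<And>y y'. \<bar>lo i y - lo i y'\<bar> \<le> L * norm (y - y')"
        "\<And>y y'. \<bar>up i y - up i y'\<bar> \<le> L * norm (y - y')" using env by blast
      show "sigma_thin {x. \<nexists>D. has_hadamard_derivative (lo i) D x}"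
        by (rule lipschitz_hadamard_differentiable_off_sigma_thin[OF L(2,1) dense])
      show "sigma_thin {x. \<nexists>D. has_hadamard_derivative (up i) D x}"
        by (rule lipschitz_hadamard_differentiable_off_sigma_thin[OF L(3,1) dense])
    qed simp
    show "{x \<in> G. \<not> hadamard_differentiable f x} \<subseteq>
      (\<Union>i\<in>P. {x. \<nexists>D. has_hadamard_derivative (lo i) D x} \<union> {x. \<nexists>D. has_hadamard_derivative (up i) D x})"
    proof
      fix x assume x: "x \<in> {x \<in> G. \<not> hadamard_differentiable f x}"
      then obtain i where i: "i \<in> P" "x \<in> BB i" "lo i x = up i x" unfolding G_def by blast
      have touch: "lo i x = f x" "up i x = f x" using sand[OF i(1,2)] i(3) by auto
      have "\<not> (has_hadamard_derivative (lo i) D x \<and> has_hadamard_derivative (up i) D' x)" for D D'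
        using hadamard_derivative_sandwich[where u = "lo i" and v = "up i" and f = f and x = x, OF _ _ opn i(2) sand[OF i(1)] touch]
          x hadamard_differentiableI by blast
      then show "x \<in> (\<Union>i\<in>P. {x. \<nexists>D. has_hadamard_derivative (lo i) D x} \<union> {x. \<nexists>D. has_hadamard_derivative (up i) D x})"
        using i(1) by blast
    qed
  qed
  ultimately show ?thesis by blast
qed

section \<open>Interior and boundary of convex sets\<close>

text \<open>
  A point \<open>y\<close> of the closure is replaced by a nearby point of \<open>A\<close>, at the cost of half
  the radius.
\<close>

lemma ball_in_convex_combination:
  fixes A :: "'a::real_normed_vector set"
  assumes A: "convex A" and c: "ball c r \<subseteq> A" "0 < r" and y: "y \<in> closure A" and l: "0 < l" "l \<le> 1"
  shows "ball ((1 - l) *\<^sub>R y + l *\<^sub>R c) (l * r / 2) \<subseteq> A"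
proof
  fix z assume z: "z \<in> ball ((1 - l) *\<^sub>R y + l *\<^sub>R c) (l * r / 2)"
  have "0 < l * r / 2" using l c by simp
  then obtain y' where y': "y' \<in> A" "dist y' y < l * r / 2" using y closure_approachable by blast
  define p where "p = (1 / l) *\<^sub>R (z - (1 - l) *\<^sub>R y')"
  have zp: "z = (1 - l) *\<^sub>R y' + l *\<^sub>R p" unfolding p_def using l by simp
  have "l *\<^sub>R (p - c) = (z - ((1 - l) *\<^sub>R y + l *\<^sub>R c)) + (1 - l) *\<^sub>R (y - y')"
    unfolding zp by (simp add: algebra_simps)
  then have "norm (l *\<^sub>R (p - c)) \<le> norm (z - ((1 - l) *\<^sub>R y + l *\<^sub>R c)) + norm ((1 - l) *\<^sub>R (y - y'))"
    by (metis norm_triangle_ineq)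
  also have "norm ((1 - l) *\<^sub>R (y - y')) \<le> norm (y - y')"
    using l by (simp add: mult_left_le_one_le)
  also have "norm (z - ((1 - l) *\<^sub>R y + l *\<^sub>R c)) + norm (y - y') < l * r"
    using z y'(2) by (simp add: dist_norm norm_minus_commute)
  finally have "l * norm (p - c) < l * r" using l by simp
  then have "p \<in> ball c r" using l by (simp add: dist_norm norm_minus_commute)
  then have "p \<in> A" using c by blast
  then show "z \<in> A" unfolding zp using y'(1) l by (intro convexD[OF A]) auto
qed

text \<open>
  Every point of the interior of the closure lies strictly between a point of the closure and the
  centre \<open>c\<close>.
\<close>

lemma interior_closure_subset_convex:
  fixes A :: "'a::real_normed_vector set"
  assumes A: "convex A" and c: "ball c r \<subseteq> A" "0 < r"
  shows "interior (closure A) \<subseteq> A"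
proof
  fix x assume "x \<in> interior (closure A)"
  then obtain e where e: "0 < e" "ball x e \<subseteq> closure A" by (auto simp: mem_interior)
  \<comment> \<open>Going from \<open>c\<close> beyond \<open>x\<close> by the factor \<open>1 + s\<close> stays in the ball around \<open>x\<close>.\<close>
  define s where "s = e / (2 * (1 + norm (x - c)))"
  have pos: "0 < 1 + norm (x - c)" by (simp add: add_pos_nonneg)
  have s: "0 < s" unfolding s_def using e pos by simp
  have "s * norm (x - c) \<le> s * (1 + norm (x - c))" using s by simp
  also have "\<dots> = e / 2" unfolding s_def using pos by (simp add: field_simps)
  finally have "x + s *\<^sub>R (x - c) \<in> ball x e" using e(1) s by (simp add: dist_norm)
  then have y: "x + s *\<^sub>R (x - c) \<in> closure A" using e(2) by blast
  define l where "l = s / (1 + s)"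
  have l: "0 < l" "l \<le> 1" "(1 - l) * (1 + s) = 1" "(1 - l) * s = l"
    unfolding l_def using s by (auto simp: field_simps)
  have "(1 - l) *\<^sub>R (x + s *\<^sub>R (x - c)) + l *\<^sub>R c = ((1 - l) * (1 + s)) *\<^sub>R x + (l - (1 - l) * s) *\<^sub>R c"
    by (simp add: algebra_simps)
  also have "\<dots> = x" unfolding l(3,4) by simp
  finally have eq: "(1 - l) *\<^sub>R (x + s *\<^sub>R (x - c)) + l *\<^sub>R c = x" .
  have "0 < l * r / 2" using l(1) c(2) by simp
  then have "x \<in> ball x (l * r / 2)" by simp
  then show "x \<in> A" using ball_in_convex_combination[OF A c y l(1,2)] unfolding eq by blast
qed

text \<open>
  The point \<open>y + t e\<close> lies strictly between \<open>y\<close> and \<open>y + t e + e\<close>. The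
  target moves along with \<open>t\<close>, so there is no upper bound on \<open>t\<close>.
\<close>

lemma interior_beyond_closure_point:
  fixes A :: "'a::real_normed_vector set"
  assumes A: "convex A" and y: "y \<in> closure A" and t: "0 < t"
    and r: "0 < r" "ball (y + t *\<^sub>R e + e) r \<subseteq> A"
  shows "y + t *\<^sub>R e \<in> interior A"
proof -
  define l where "l = t / (1 + t)"
  have l: "0 < l" "l \<le> 1" "l * (1 + t) = t" unfolding l_def using t by (auto simp: field_simps)
  have "(1 - l) *\<^sub>R y + l *\<^sub>R (y + t *\<^sub>R e + e) = y + (l * (1 + t)) *\<^sub>R e"
    by (simp add: algebra_simps)
  then have eq: "(1 - l) *\<^sub>R y + l *\<^sub>R (y + t *\<^sub>R e + e) = y + t *\<^sub>R e" unfolding l(3) .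
  have "0 < l * r / 2" using l(1) r(1) by simp
  then show ?thesis
    using ball_in_convex_combination[OF A r(2,1) y l(1,2)] unfolding eq mem_interior by blast
qed

lemma negligible_if_at_most_one:
  fixes S :: "real set"
  assumes "\<And>s t. s \<in> S \<Longrightarrow> t \<in> S \<Longrightarrow> s < t \<Longrightarrow> False"
  shows "negligible S"
proof (cases "S = {}")
  case False
  then obtain s where "s \<in> S" by blast
  then have "S \<subseteq> {s}" using assms by (metis linorder_neqE singletonI subsetI)
  then show ?thesis by (rule negligible_subset[rotated]) simp
qed simp

lemma ball_shifted_by_direction:
  assumes "ball b \<rho> \<subseteq> A" "dist z q < \<rho> / 2"
  shows "ball (q + (b - z)) (\<rho> / 2) \<subseteq> (A :: 'a::real_normed_vector set)"
proof
  fix p assume "p \<in> ball (q + (b - z)) (\<rho> / 2)"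
  moreover have "dist b (q + (b - z)) = dist z q" by (simp add: dist_norm)
  ultimately have "dist b p < \<rho>" using assms(2) dist_triangle[of b p "q + (b - z)"] by simp
  then show "p \<in> A" using assms(1) by auto
qed

text \<open>
  Near \<open>d k\<close> all lines in the direction from \<open>d k\<close> to the centre \<open>b\<close> run into the ball, and once
  such a line has met the closure it stays in the interior as long as it remains near \<open>d k\<close>; so it meets the boundary
  at most once there.
\<close>

lemma sigma_thin_convex_boundary:
  fixes A :: "'a::real_normed_vector set" and d :: "nat \<Rightarrow> 'a"
  assumes d: "\<And>x e. 0 < e \<Longrightarrow> \<exists>n. dist (d n) x < e"
    and A: "convex A" and b: "ball b \<rho> \<subseteq> A" "0 < \<rho>"
  shows "sigma_thin (closure A - interior A)"
proof (rule sigma_thin_subset)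
  define E where "E k = ball (d k) (\<rho> / 2) \<inter> (closure A - interior A)" for k
  have "thin_set (E k)" for k
  proof (rule thin_set_if_null_on_lines[where v = "b - d k"])
    show "E k \<in> sets borel" unfolding E_def by (intro sets.Int sets.Diff) auto
    show "negligible {t. x + t *\<^sub>R (b - d k) \<in> E k}" for x
    proof (rule negligible_if_at_most_one)
      fix s t assume s: "s \<in> {t. x + t *\<^sub>R (b - d k) \<in> E k}" and t: "t \<in> {t. x + t *\<^sub>R (b - d k) \<in> E k}" and st: "s < t"
      define e where "e = b - d k"
      have "dist (d k) (x + t *\<^sub>R e) < \<rho> / 2" using t unfolding E_def e_def by simp
      from ball_shifted_by_direction[OF b(1) this]
      have "ball (x + s *\<^sub>R e + (t - s) *\<^sub>R e + e) (\<rho> / 2) \<subseteq> A" by (simp add: e_def algebra_simps)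
      then have "x + s *\<^sub>R e + (t - s) *\<^sub>R e \<in> interior A"
        using s st b(2) unfolding E_def by (intro interior_beyond_closure_point[OF A]) (auto simp: e_def)
      then have "x + t *\<^sub>R e \<in> interior A" by (simp add: algebra_simps)
      then show False using t unfolding E_def e_def by simp
    qed
  qed
  then show "sigma_thin (\<Union>k. E k)" by (intro sigma_thin_UN sigma_thin_if_thin_set) auto
  show "closure A - interior A \<subseteq> (\<Union>k. E k)"
  proof
    fix x assume x: "x \<in> closure A - interior A"
    obtain k where "dist (d k) x < \<rho> / 2" using d[of "\<rho> / 2" x] b(2) by auto
    then show "x \<in> (\<Union>k. E k)" using x unfolding E_def by auto
  qed
qed

section \<open>Quasiconvex functions outside a sublevel set\<close>

lemma quasiconvexD:
  assumes "quasiconvex f" "0 \<le> t" "t \<le> 1"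
  shows "f ((1 - t) *\<^sub>R x + t *\<^sub>R y) \<le> max (f x) (f y)"
  using assms(1)[unfolded quasiconvex_def, rule_format, where x = y and y = x and t = t] assms(2,3)
  by (simp add: add.commute max.commute)

text \<open>
  On the segment from \<open>x\<close> to a point \<open>p\<close> of low value, a point whose value is not low
  cannot exceed \<open>x\<close>.
\<close>

lemma quasiconvex_downhill:
  assumes f: "quasiconvex f" and t: "0 \<le> t" "t \<le> 1" and p: "f p < \<alpha>"
    and z: "\<alpha> \<le> f z" "z = (1 - t) *\<^sub>R x + t *\<^sub>R p"
  shows "f z \<le> f x"
  using quasiconvexD[OF f t, of x p] p z by auto

lemma convex_strict_sublevel:
  assumes "quasiconvex f"
  shows "convex {x. f x < (\<alpha>::real)}"
proof (rule convexI)
  fix x y and u v :: real assume *: "x \<in> {x. f x < \<alpha>}" "y \<in> {x. f x < \<alpha>}" "0 \<le> u" "0 \<le> v" "u + v = 1"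
  then have uv: "u = 1 - v" "v \<le> 1" by auto
  show "u *\<^sub>R x + v *\<^sub>R y \<in> {x. f x < \<alpha>}"
    unfolding uv(1) using quasiconvexD[OF assms *(4) uv(2), of x y] *(1,2) by auto
qed

lemma convex_sublevel:
  assumes "quasiconvex f"
  shows "convex {x. f x \<le> (\<alpha>::real)}"
proof (rule convexI)
  fix x y and u v :: real assume *: "x \<in> {x. f x \<le> \<alpha>}" "y \<in> {x. f x \<le> \<alpha>}" "0 \<le> u" "0 \<le> v" "u + v = 1"
  then have uv: "u = 1 - v" "v \<le> 1" by auto
  show "u *\<^sub>R x + v *\<^sub>R y \<in> {x. f x \<le> \<alpha>}"
    unfolding uv(1) using quasiconvexD[OF assms *(4) uv(2), of x y] *(1,2) by auto
qed

text \<open>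
  For small \<open>w\<close> and \<open>s\<close> proportional to \<open>norm w\<close>, the point \<open>y + s e\<close> lies on
  a segment from \<open>y + w\<close> to the low ball around \<open>y + e\<close>, and \<open>y + w\<close> on a segment from \<open>y - s e\<close> to that ball. So
  \<open>f (y + w)\<close> is caught between two values of \<open>f\<close> on the line through \<open>y\<close> in direction \<open>e\<close>.
\<close>

lemma pointwise_lipschitz_if_lipschitz_in_direction:
  fixes f :: "'a::real_normed_vector \<Rightarrow> real"
  assumes f: "quasiconvex f"
    and down: "0 < \<rho>" "\<And>p. p \<in> ball (y + e) \<rho> \<Longrightarrow> f p < \<alpha>"
    and up: "0 < r" "\<And>z. z \<in> ball y r \<Longrightarrow> \<alpha> \<le> f z"
    and dir: "0 < \<delta>" "\<And>s. \<bar>s\<bar> < \<delta> \<Longrightarrow> \<bar>f (y + s *\<^sub>R e) - f y\<bar> \<le> L * \<bar>s\<bar>"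
  shows "pointwise_lipschitz f y"
proof -
  \<comment> \<open>With \<open>s = c * norm w\<close> the vectors by which \<open>p\<close> misses \<open>y + e\<close> below have norm at most \<open>\<rho> / 2\<close>.\<close>
  define c where "c = 4 / \<rho>"
  have c: "0 < c" "1 / c = \<rho> / 4" unfolding c_def using down by auto
  define m where "m = min 1 (min \<delta> (r / (1 + norm e)))"
  have pos: "0 < 1 + norm e" by (simp add: add_pos_nonneg)
  have m: "0 < m" unfolding m_def using dir(1) up(1) pos by auto
  have "\<bar>f (y + w) - f y\<bar> \<le> (L * c) * norm w" if w: "norm w < min r (m / c)" for w
  proof (cases "w = 0")
    case False
    define s where "s = c * norm w"
    have s: "0 < s" "s < m" unfolding s_def using w c False by (auto simp: field_simps)
    have s1: "s < 1" "s < \<delta>" "s < r / (1 + norm e)" using s(2) unfolding m_def by auto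
    have ws: "norm w = (\<rho> / 4) * s" unfolding s_def using c by (simp add: field_simps)
    have "s * norm e \<le> s * (1 + norm e)" using s by simp
    also have "\<dots> < r" using s1(3) pos by (simp add: field_simps)
    finally have se: "y + \<sigma> *\<^sub>R e \<in> ball y r" if "\<bar>\<sigma>\<bar> = s" for \<sigma>
      using that by (simp add: dist_norm)
    have yw: "y + w \<in> ball y r" using w by (simp add: dist_norm)
    have low: "f (y + s *\<^sub>R e) \<le> f (y + w)"
    proof (rule quasiconvex_downhill[OF f])
      define p where "p = y + e - ((1 - s) / s) *\<^sub>R w"
      show "0 \<le> s" "s \<le> 1" using s s1 by auto
      have "norm (((1 - s) / s) *\<^sub>R w) = (1 - s) * (\<rho> / 4)" unfolding norm_scaleR ws using s s1 by simp
      also have "\<dots> < \<rho>" using mult_left_le_one_le[of "\<rho> / 4" "1 - s"] s s1 down(1) by simp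
      finally show "f p < \<alpha>" unfolding p_def by (intro down(2)) (simp add: dist_norm)
      show "\<alpha> \<le> f (y + s *\<^sub>R e)" using se[of s] s up(2) by simp
      have "s *\<^sub>R p = s *\<^sub>R y + s *\<^sub>R e - (1 - s) *\<^sub>R w"
        unfolding p_def scaleR_diff_right scaleR_add_right using s by simp
      then show "y + s *\<^sub>R e = (1 - s) *\<^sub>R (y + w) + s *\<^sub>R p" by (simp add: algebra_simps)
    qed
    have high: "f (y + w) \<le> f (y + (- s) *\<^sub>R e)"
    proof (rule quasiconvex_downhill[OF f])
      define p where "p = y + e + ((1 + s) / s) *\<^sub>R w"
      show "0 \<le> s / (1 + s)" "s / (1 + s) \<le> 1" using s by (auto simp: divide_le_eq)
      have "norm (((1 + s) / s) *\<^sub>R w) = (1 + s) * (\<rho> / 4)" unfolding norm_scaleR ws using s by simp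
      also have "\<dots> \<le> 2 * (\<rho> / 4)" using s1 down(1) by (intro mult_right_mono) auto
      also have "\<dots> < \<rho>" using down(1) by simp
      finally show "f p < \<alpha>" unfolding p_def by (intro down(2)) (simp add: dist_norm)
      show "\<alpha> \<le> f (y + w)" using yw up(2) by simp
      define l where "l = s / (1 + s)"
      have "1 + s \<noteq> 0" using s by simp
      then have l: "1 - l = 1 / (1 + s)" "l = s * (1 / (1 + s))" "l * ((1 + s) / s) = 1"
        unfolding l_def using s by (simp_all add: diff_divide_eq_iff)
      have "(1 - l) *\<^sub>R (y + (- s) *\<^sub>R e) + l *\<^sub>R p = y + (l - (1 - l) * s) *\<^sub>R e + (l * ((1 + s) / s)) *\<^sub>R w"
        unfolding p_def by (simp add: algebra_simps)
      also have "\<dots> = y + w" unfolding l(3) using l(1,2) by simp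
      finally show "y + w = (1 - s / (1 + s)) *\<^sub>R (y + (- s) *\<^sub>R e) + (s / (1 + s)) *\<^sub>R p" unfolding l_def by simp
    qed
    have "\<bar>f (y + s *\<^sub>R e) - f y\<bar> \<le> L * s" "\<bar>f (y + (- s) *\<^sub>R e) - f y\<bar> \<le> L * s"
      using dir(2)[of s] dir(2)[of "- s"] s s1 by auto
    then have "\<bar>f (y + w) - f y\<bar> \<le> L * s" using low high by linarith
    then show ?thesis unfolding s_def by simp
  qed simp
  moreover have "0 < min r (m / c)" using up(1) m c by simp
  ultimately show ?thesis unfolding pointwise_lipschitz_def by blast
qed

text \<open>
  On the open set of parameters for which a line in direction \<open>b - d k\<close>
  runs near \<open>d k\<close> and outside the closure of \<open>{f < \<alpha>}\<close>, \<open>f\<close> decreases along the line, so it is pointwise Lipschitz along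
  the line almost everywhere.
\<close>

lemma sigma_thin_above_level:
  fixes f :: "'a::real_normed_vector \<Rightarrow> real" and d :: "nat \<Rightarrow> 'a"
  assumes d: "\<And>x e. 0 < e \<Longrightarrow> \<exists>n. dist (d n) x < e"
    and f: "quasiconvex f" and b: "ball b \<rho> \<subseteq> {x. f x < \<alpha>}" "0 < \<rho>"
    and G: "G \<in> sets borel" "\<And>x. pointwise_lipschitz f x \<Longrightarrow> x \<in> G"
  shows "sigma_thin ({x. \<alpha> \<le> f x} - G)"
proof -
  define A where "A = {x. f x < \<alpha>}"
  have A: "convex A" unfolding A_def by (rule convex_strict_sublevel[OF f])
  have bA: "ball b \<rho> \<subseteq> A" using b(1) unfolding A_def .
  define E where "E k = ball (d k) (\<rho> / 2) \<inter> (- closure A) - G" for k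
  have "thin_set (E k)" for k
  proof (rule thin_set_if_null_on_lines[where v = "b - d k"])
    show "E k \<in> sets borel" unfolding E_def using G(1) by (intro sets.Int sets.Diff) auto
    fix x
    define e where "e = b - d k"
    define J where "J = {t. x + t *\<^sub>R e \<in> ball (d k) (\<rho> / 2) \<inter> (- closure A)}"
    have "open J" unfolding J_def by (intro open_vimage[unfolded vimage_def] continuous_intros) auto
    have beyond: "ball (x + t *\<^sub>R e + e) (\<rho> / 2) \<subseteq> A" if "t \<in> J" for t
    proof -
      have "dist (d k) (x + t *\<^sub>R e) < \<rho> / 2" using that unfolding J_def by simp
      from ball_shifted_by_direction[OF bA this] show ?thesis unfolding e_def .
    qed
    have above: "\<alpha> \<le> f (x + t *\<^sub>R e)" if "t \<in> J" for t
      using that closure_subset[of A] unfolding J_def A_def by force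
    have anti: "f (x + t *\<^sub>R e) \<le> f (x + s *\<^sub>R e)" if st: "s \<le> t" "t \<in> J" for s t
    proof (rule quasiconvex_downhill[OF f])
      define l where "l = (t - s) / (1 + (t - s))"
      have l: "0 \<le> l" "l \<le> 1" "l * (1 + (t - s)) = t - s" unfolding l_def using st by (auto simp: field_simps)
      show "0 \<le> l" "l \<le> 1" by fact+
      have "x + t *\<^sub>R e + e \<in> A" using beyond[OF st(2)] b(2) by force
      then show "f (x + t *\<^sub>R e + e) < \<alpha>" unfolding A_def by simp
      show "\<alpha> \<le> f (x + t *\<^sub>R e)" by (rule above[OF st(2)])
      have "(1 - l) *\<^sub>R (x + s *\<^sub>R e) + l *\<^sub>R (x + t *\<^sub>R e + e) = x + (s + l * (1 + (t - s))) *\<^sub>R e"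
        by (simp add: algebra_simps)
      also have "\<dots> = x + t *\<^sub>R e" unfolding l(3) by simp
      finally show "x + t *\<^sub>R e = (1 - l) *\<^sub>R (x + s *\<^sub>R e) + l *\<^sub>R (x + t *\<^sub>R e + e)" by simp
    qed
    define h where "h t = - f (x + t *\<^sub>R e)" for t
    define X where "X = (\<lambda>(p, q). {t \<in> {p<..<q}. \<not> (\<exists>L. \<exists>\<delta>>0. \<forall>s. \<bar>s\<bar> < \<delta> \<longrightarrow> \<bar>h (t + s) - h t\<bar> \<le> L * \<bar>s\<bar>)})"
    define Q where "Q = {(p, q). p \<in> \<rat> \<and> q \<in> \<rat> \<and> mono_on {p..q} h}"
    have "countable Q"
      by (rule countable_subset[of _ "\<rat> \<times> \<rat>"]) (auto simp: Q_def countable_rat)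
    then have "negligible (\<Union>(X ` Q))"
      using mono_on_imp_pointwise_lipschitz_ae by (intro negligible_countable_Union) (auto simp: Q_def X_def)
    moreover have "{t. x + t *\<^sub>R (b - d k) \<in> E k} \<subseteq> \<Union>(X ` Q)"
    proof (rule subsetI, rule ccontr)
      fix t assume t: "t \<in> {t. x + t *\<^sub>R (b - d k) \<in> E k}" and no: "t \<notin> \<Union>(X ` Q)"
      have tJ: "t \<in> J" and tG: "x + t *\<^sub>R e \<notin> G" using t unfolding E_def J_def e_def by auto
      obtain \<eta> where \<eta>: "0 < \<eta>" "ball t \<eta> \<subseteq> J" using \<open>open J\<close> tJ openE by blast
      obtain p where p: "p \<in> \<rat>" "t - \<eta> < p" "p < t" using Rats_dense_in_real[of "t - \<eta>" t] \<eta>(1) by auto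
      obtain q where q: "q \<in> \<rat>" "t < q" "q < t + \<eta>" using Rats_dense_in_real[of t "t + \<eta>"] \<eta>(1) by auto
      have "{p..q} \<subseteq> ball t \<eta>" using p q by (auto simp: dist_real_def)
      then have pqJ: "{p..q} \<subseteq> J" using \<eta>(2) by blast
      have "mono_on {p..q} h"
      proof (rule mono_onI)
        fix r s assume "r \<in> {p..q}" "s \<in> {p..q}" "r \<le> s"
        moreover from this have "s \<in> J" using pqJ by blast
        ultimately show "h r \<le> h s" unfolding h_def using anti[of r s] by simp
      qed
      then have "(p, q) \<in> Q" unfolding Q_def using p q by simp
      then have "t \<notin> X (p, q)" using no by blast
      then obtain L \<delta> where L: "0 < \<delta>" "\<And>s. \<bar>s\<bar> < \<delta> \<Longrightarrow> \<bar>h (t + s) - h t\<bar> \<le> L * \<bar>s\<bar>"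
        unfolding X_def using p q by auto
      obtain r where r: "0 < r" "ball (x + t *\<^sub>R e) r \<subseteq> - closure A"
        using tJ openE[of "- closure A" "x + t *\<^sub>R e"] unfolding J_def by auto
      have "pointwise_lipschitz f (x + t *\<^sub>R e)"
      proof (rule pointwise_lipschitz_if_lipschitz_in_direction[OF f])
        show "0 < \<rho> / 2" using b(2) by simp
        show "f p < \<alpha>" if "p \<in> ball (x + t *\<^sub>R e + e) (\<rho> / 2)" for p
          using that beyond[OF tJ] unfolding A_def by blast
        show "0 < r" by fact
        show "\<alpha> \<le> f z" if "z \<in> ball (x + t *\<^sub>R e) r" for z
        proof -
          have "z \<notin> A" using that r(2) closure_subset[of A] by blast
          then show ?thesis unfolding A_def by simp
        qed
        show "0 < \<delta>" by (rule L(1))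
        show "\<bar>f (x + t *\<^sub>R e + s *\<^sub>R e) - f (x + t *\<^sub>R e)\<bar> \<le> L * \<bar>s\<bar>" if "\<bar>s\<bar> < \<delta>" for s
        proof -
          have "x + (t + s) *\<^sub>R e = x + t *\<^sub>R e + s *\<^sub>R e" by (simp add: scaleR_left_distrib)
          then show ?thesis using L(2)[OF that] unfolding h_def by (simp add: abs_minus_commute add.assoc)
        qed
      qed
      then show False using G(2) tG by blast
    qed
    ultimately show "negligible {t. x + t *\<^sub>R (b - d k) \<in> E k}" by (rule negligible_subset)
  qed
  then have "sigma_thin (\<Union>k. E k)" by (intro sigma_thin_UN sigma_thin_if_thin_set) auto
  then have "sigma_thin ((\<Union>k. E k) \<union> (closure A - interior A))"
    by (intro sigma_thin_Un sigma_thin_convex_boundary[OF d A bA b(2)])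
  moreover have "{x. \<alpha> \<le> f x} - G \<subseteq> (\<Union>k. E k) \<union> (closure A - interior A)"
  proof
    fix x assume x: "x \<in> {x. \<alpha> \<le> f x} - G"
    then have "x \<notin> interior A" using interior_subset[of A] unfolding A_def by force
    moreover obtain k where "dist (d k) x < \<rho> / 2" using d[of "\<rho> / 2" x] b(2) by auto
    ultimately show "x \<in> (\<Union>k. E k) \<union> (closure A - interior A)" using x unfolding E_def by auto
  qed
  ultimately show ?thesis by (rule sigma_thin_subset)
qed

section \<open>The essential infimum\<close>

text \<open>
  The sets of points with a neighbourhood on which \<open>f\<close> oscillates by less than \<open>1 / Suc n\<close> are
  open, contain the points of continuity and are therefore dense.
\<close>

lemma first_category_discontinuities:
  fixes f :: "'a::metric_space \<Rightarrow> real"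
  assumes "densely_continuous f"
  shows "first_category {x. \<not> isCont f x}"
proof -
  define U where "U n = \<Union>{V. open V \<and> (\<forall>y\<in>V. \<forall>z\<in>V. dist (f y) (f z) < 1 / real (Suc n))}" for n
  have op: "open (U n)" for n unfolding U_def by (intro open_Union) auto
  have cont: "x \<in> U n" if x: "isCont f x" for x n
  proof -
    obtain \<delta> where \<delta>: "0 < \<delta>" "\<And>y. dist y x < \<delta> \<Longrightarrow> dist (f y) (f x) < 1 / real (Suc n) / 2"
      using x[unfolded continuous_at_eps_delta, rule_format, of "1 / real (Suc n) / 2"] by auto
    have "dist (f y) (f z) < 1 / real (Suc n)" if "y \<in> ball x \<delta>" "z \<in> ball x \<delta>" for y z
      using that \<delta>(2)[of y] \<delta>(2)[of z] dist_triangle_half_l[of "f y" "f x" "1 / real (Suc n)" "f z"]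
      by (simp add: dist_commute)
    then have "ball x \<delta> \<subseteq> U n" unfolding U_def by blast
    then show ?thesis using \<delta>(1) by auto
  qed
  have cl: "closure (U n) = UNIV" for n
    using assms closure_mono[of "{x. isCont f x}" "U n"] cont unfolding densely_continuous_def by blast
  have nd: "nowhere_dense (- U n)" for n
    unfolding nowhere_dense_def using op[of n] cl[of n]
    by (simp add: closure_complement interior_complement interior_open)
  have "{x. \<not> isCont f x} \<subseteq> (\<Union>n. - U n)"
  proof (rule subsetI, rule ccontr)
    fix x assume x: "x \<in> {x. \<not> isCont f x}" and "x \<notin> (\<Union>n. - U n)"
    then have xU: "x \<in> U n" for n by blast
    have "isCont f x" unfolding continuous_at_eps_delta
    proof (intro allI impI)
      fix e :: real assume "0 < e"
      then obtain n where n: "1 / real (Suc n) < e" using nat_approx_posE by blast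
      obtain V where V: "open V" "x \<in> V" "\<And>y z. y \<in> V \<Longrightarrow> z \<in> V \<Longrightarrow> dist (f y) (f z) < 1 / real (Suc n)"
        using xU[of n] unfolding U_def by blast
      obtain r where r: "0 < r" "ball x r \<subseteq> V" using V(1,2) openE by blast
      have "dist (f y) (f x) < e" if "dist y x < r" for y
      proof -
        have "y \<in> V" using r(2) that by (auto simp: dist_commute)
        from V(3)[OF this V(2)] n show ?thesis by simp
      qed
      then show "\<exists>r>0. \<forall>y. dist y x < r \<longrightarrow> dist (f y) (f x) < e" using r(1) by blast
    qed
    with x show False by simp
  qed
  moreover have "first_category (\<Union>n. - U n)"
    unfolding first_category_def using nd by (intro exI[of _ "\<lambda>n. - U n"]) auto
  ultimately show ?thesis by (rule first_category_subset[rotated])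
qed

text \<open>
  A sublevel set of second category cannot consist of discontinuities only.
\<close>

lemma ball_in_second_category_sublevel:
  fixes f :: "'a::metric_space \<Rightarrow> real"
  assumes f: "densely_continuous f" and \<alpha>: "top_ess_inf f < ereal \<alpha>"
  shows "\<exists>b \<rho>. 0 < \<rho> \<and> ball b \<rho> \<subseteq> {x. f x < \<alpha>}"
proof -
  have sl: "strict_sublevel f (ereal \<alpha>) = {x. f x < \<alpha>}" unfolding strict_sublevel_def by simp
  have "second_category {x. f x < \<alpha>}"
  proof
    assume "first_category {x. f x < \<alpha>}"
    then have "ereal \<alpha> \<le> top_ess_inf f" unfolding top_ess_inf_def by (intro SUP_upper) (simp add: sl)
    with \<alpha> show False by simp
  qed
  then have "\<not> {x. f x < \<alpha>} \<subseteq> {x. \<not> isCont f x}"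
    using first_category_subset[OF first_category_discontinuities[OF f]] by blast
  then obtain x where x: "f x < \<alpha>" "isCont f x" by blast
  obtain \<rho> where \<rho>: "0 < \<rho>" "\<And>y. dist y x < \<rho> \<Longrightarrow> dist (f y) (f x) < \<alpha> - f x"
    using x(2)[unfolded continuous_at_eps_delta, rule_format, of "\<alpha> - f x"] x(1) by auto
  have "ball x \<rho> \<subseteq> {x. f x < \<alpha>}"
  proof
    fix y assume "y \<in> ball x \<rho>"
    then have "dist (f y) (f x) < \<alpha> - f x" by (intro \<rho>(2)) (simp add: dist_commute)
    then show "y \<in> {x. f x < \<alpha>}" by (simp add: dist_real_def)
  qed
  with \<rho>(1) show ?thesis by blast
qed

text \<open>
  If the closure of the convex set \<open>{f \<le> m}\<close> has interior points, these belong to \<open>{f < \<alpha>}\<close> for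
  every \<open>\<alpha> > m\<close>, because the latter set is convex with nonempty interior; so they belong to \<open>{f \<le> m}\<close>.
\<close>

lemma sigma_thin_at_or_below_ess_inf:
  fixes f :: "'a::real_normed_vector \<Rightarrow> real" and d :: "nat \<Rightarrow> 'a"
  assumes refl: "reflexive_space TYPE('a)" and d: "\<And>x e. 0 < e \<Longrightarrow> \<exists>n. dist (d n) x < e"
    and f: "quasiconvex f" "densely_continuous f"
    and m: "top_ess_inf f = ereal m" and nd: "nowhere_dense {x. f x < m}"
    and G: "\<And>x. pointwise_lipschitz f x \<Longrightarrow> x \<in> G"
  shows "sigma_thin ({x. f x \<le> m} - G)"
proof -
  define A where "A = {x. f x \<le> m}"
  have A: "convex A" unfolding A_def by (rule convex_sublevel[OF f(1)])
  define C where "C = closure {x. f x < m}"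
  show ?thesis
  proof (cases "interior (closure A) = {}")
    case True
    have "sigma_thin (closure A)"
      using True A by (intro sigma_thin_convex_empty_interior[OF refl d]) auto
    then show ?thesis by (rule sigma_thin_subset) (use closure_subset[of A] in \<open>auto simp: A_def\<close>)
  next
    case False
    have int: "interior (closure A) \<subseteq> A"
    proof
      fix x assume x: "x \<in> interior (closure A)"
      have "f x \<le> m + e" if e: "0 < e" for e
      proof -
        have me: "top_ess_inf f < ereal (m + e)" using m e by simp
        obtain b \<rho> where b: "0 < \<rho>" "ball b \<rho> \<subseteq> {x. f x < m + e}"
          using ball_in_second_category_sublevel[OF f(2) me] by blast
        have "A \<subseteq> {x. f x < m + e}" unfolding A_def using e by auto
        then have "x \<in> interior (closure {x. f x < m + e})"
          using x interior_mono[OF closure_mono] by blast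
        then show ?thesis
          using interior_closure_subset_convex[OF convex_strict_sublevel[OF f(1)] b(2,1)] by force
      qed
      then have "f x \<le> m" by (rule field_le_epsilon)
      then show "x \<in> A" unfolding A_def by simp
    qed
    obtain b \<rho> where b: "0 < \<rho>" "ball b \<rho> \<subseteq> interior (closure A)"
      using False open_interior openE by blast
    have "sigma_thin C" unfolding C_def
      using nd convex_strict_sublevel[OF f(1)] unfolding nowhere_dense_def
      by (intro sigma_thin_convex_empty_interior[OF refl d]) auto
    moreover have "sigma_thin (closure A - interior A)"
      using b int by (intro sigma_thin_convex_boundary[OF d A]) auto
    ultimately have "sigma_thin (C \<union> (closure A - interior A))" by (rule sigma_thin_Un)
    moreover have "A - G \<subseteq> C \<union> (closure A - interior A)"
    proof (rule subsetI, rule ccontr)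
      fix x assume x: "x \<in> A - G" and "x \<notin> C \<union> (closure A - interior A)"
      then have "x \<in> interior A - C" using closure_subset[of A] by blast
      moreover have "open (interior A - C)" unfolding C_def by (intro open_Diff) auto
      ultimately obtain r where r: "0 < r" "ball x r \<subseteq> interior A - C" using openE by blast
      have const: "f y = m" if "y \<in> ball x r" for y
      proof -
        have "y \<in> A" "y \<notin> {x. f x < m}"
          using that r(2) interior_subset[of A] closure_subset[of "{x. f x < m}"] unfolding C_def by blast+
        then show ?thesis unfolding A_def by simp
      qed
      have "\<bar>f (x + w) - f x\<bar> \<le> 0 * norm w" if "norm w < r" for w
        using const[of x] const[of "x + w"] that r(1) by (simp add: dist_norm)
      then have "pointwise_lipschitz f x" unfolding pointwise_lipschitz_def using r(1) by blast
      with G x show False by blast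
    qed
    ultimately show ?thesis unfolding A_def by (rule sigma_thin_subset)
  qed
qed

section \<open>Differentiability of quasiconvex functions\<close>

theorem theorem5p5:
  fixes f :: "'a::banach \<Rightarrow> real"
  assumes "reflexive_space TYPE('a)"
    and "separable_space (euclidean :: 'a topology)"
    and "quasiconvex f"
    and "densely_continuous f"
    and "nowhere_dense (strict_sublevel f (top_ess_inf f))"
  shows "\<exists>N. haar_null N \<and> (\<forall>x. x \<notin> N \<longrightarrow> hadamard_differentiable f x)"
proof -
  obtain d :: "nat \<Rightarrow> 'a" where d: "\<And>x e. 0 < e \<Longrightarrow> \<exists>n. dist (d n) x < e"
    using dense_sequence[OF assms(2)] by blast
  obtain G where G: "G \<in> sets borel" "\<And>x. pointwise_lipschitz f x \<Longrightarrow> x \<in> G"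
    and thinG: "sigma_thin {x \<in> G. \<not> hadamard_differentiable f x}"
    using stepanov_haar[OF d, of f] by blast
  define R where "R = {\<alpha>\<in>\<rat>. top_ess_inf f < ereal \<alpha>}"
  have "countable R" unfolding R_def by (rule countable_subset[OF _ countable_rat]) auto
  moreover have "sigma_thin ({x. \<alpha> \<le> f x} - G)" if "\<alpha> \<in> R" for \<alpha>
  proof -
    obtain b \<rho> where b: "0 < \<rho>" "ball b \<rho> \<subseteq> {x. f x < \<alpha>}"
      using ball_in_second_category_sublevel[OF assms(4)] \<open>\<alpha> \<in> R\<close> unfolding R_def by blast
    show ?thesis by (rule sigma_thin_above_level[OF d assms(3) b(2,1) G])
  qed
  ultimately have above: "sigma_thin (\<Union>\<alpha>\<in>R. {x. \<alpha> \<le> f x} - G)" by (rule sigma_thin_UN)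
  have below: "sigma_thin ({x. ereal (f x) \<le> top_ess_inf f} - G)"
  proof (cases "top_ess_inf f")
    case (real m)
    have "strict_sublevel f (top_ess_inf f) = {x. f x < m}" unfolding strict_sublevel_def real by simp
    with assms(5) have "nowhere_dense {x. f x < m}" by simp
    from sigma_thin_at_or_below_ess_inf[OF assms(1) d assms(3,4) real this G(2)]
    show ?thesis unfolding real by simp
  next
    case PInf
    have "strict_sublevel f (top_ess_inf f) = UNIV" unfolding strict_sublevel_def PInf by simp
    with assms(5) show ?thesis unfolding nowhere_dense_def by simp
  next
    \<comment> \<open>No point is at or below \<open>- \<infinity>\<close>.\<close>
    case MInf
    then have "{x. ereal (f x) \<le> top_ess_inf f} - G \<subseteq> {x \<in> G. \<not> hadamard_differentiable f x}" by simp
    then show ?thesis using thinG by (rule sigma_thin_subset[rotated])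
  qed
  have "{x. \<not> hadamard_differentiable f x} \<subseteq> {x \<in> G. \<not> hadamard_differentiable f x} \<union>
    ((\<Union>\<alpha>\<in>R. {x. \<alpha> \<le> f x} - G) \<union> ({x. ereal (f x) \<le> top_ess_inf f} - G))"
  proof (rule subsetI, rule ccontr)
    fix x assume x: "x \<in> {x. \<not> hadamard_differentiable f x}"
      and no: "x \<notin> {x \<in> G. \<not> hadamard_differentiable f x} \<union>
        ((\<Union>\<alpha>\<in>R. {x. \<alpha> \<le> f x} - G) \<union> ({x. ereal (f x) \<le> top_ess_inf f} - G))"
    then have xG: "x \<notin> G" by simp
    then have "top_ess_inf f < ereal (f x)" using no by auto
    then obtain \<beta> where \<beta>: "top_ess_inf f < ereal \<beta>" "ereal \<beta> < ereal (f x)" using ereal_dense2 by blast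
    then obtain \<alpha> where \<alpha>: "\<alpha> \<in> \<rat>" "\<beta> < \<alpha>" "\<alpha> < f x" using Rats_dense_in_real[of \<beta> "f x"] by auto
    have "\<alpha> \<in> R" unfolding R_def using \<alpha>(1,2) \<beta>(1) by (auto intro: less_trans)
    then show False using no xG \<alpha>(3) by auto
  qed
  then have "sigma_thin {x. \<not> hadamard_differentiable f x}"
    by (rule sigma_thin_subset[rotated]) (intro sigma_thin_Un thinG above below)
  from haar_null_cover_if_sigma_thin[OF this] show ?thesis by blast
qed

end
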